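(* There is a (randomized) algorithm that, given a bipartite directed graph $G$ on $n$ vertices, computes $\oplus\mathscr H$ (the parity of the number of directed Hamiltonian cycles of $G$) in expected time within a polynomial factor (in $n$) of $1.5^n$, using polynomial space.
   Context: For a directed graph $G=(V,E)$, $\mathscr H$ denotes the set of directed Hamiltonian cycles of $G$ (directed cycles visiting every vertex exactly once), and $\oplus\mathscr H=|\mathscr H| \bmod 2$. A directed graph is bipartite if its vertex set can be split into two parts $V_1, V_2$ such that every directed edge goes between $V_1$ and $V_2$. *)

theory Defs
  imports
    "Graph_Theory.Pair_Digraph"
    "HOL-Computational_Algebra.Polynomial"
    "HOL-Library.Log_Nat"
    "HOL-Probability.Probability"
begin

section \<open>Directed Hamiltonian cycles\<close>

text \<open>
  \<^const>\<open>pre_digraph.cycle\<close> represents a cycle by its list of arcs from some starting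
  vertex, so the same cycle has one such list for every starting vertex. Passing to the
  \<^emph>\<open>set\<close> of arcs identifies exactly these rotations. On a nonempty closed walk the visited
  vertices are the tails of its arcs, and a cycle visits none of them twice.
\<close>

definition ham_cycles :: "'a pair_pre_digraph \<Rightarrow> ('a \<times> 'a) set set" where
  "ham_cycles G = {set p |p. pre_digraph.cycle (with_proj G) p \<and> fst ` set p = pverts G}"

lemma ham_cycles_subset: "ham_cycles G \<subseteq> Pow (parcs G)"
  by (auto simp: ham_cycles_def pre_digraph.cycle_def pre_digraph.awalk_def)

definition ham_parity :: "'a pair_pre_digraph \<Rightarrow> nat" where
  "ham_parity G = card (ham_cycles G) mod 2"

definition bipartite :: "'a pair_pre_digraph \<Rightarrow> bool" where
  "bipartite G \<longleftrightarrow> (\<exists>A B. A \<union> B = pverts G \<and> A \<inter> B = {} \<and>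
     (\<forall>(u, v) \<in> parcs G. (u \<in> A \<and> v \<in> B) \<or> (u \<in> B \<and> v \<in> A)))"


section \<open>Probabilistic random access machines with logarithmic cost\<close>

text \<open>
  Algorithms are programs of a small imperative language over finitely many named memories,
  each of which is an unbounded array of natural numbers (a scalar is cell 0 of its
  memory). Operations and costs are those of the usual RAM with logarithmic cost criterion
  (arithmetic, indirect addressing, every number handled is charged its binary length),
  with an additional instruction that tosses a fair coin. A Turing machine simulates each
  step in time polynomial in the size of the store, so for computations in polynomial space
  the time bounds of the two models agree up to a factor polynomial in the input size.
\<close>

type_synonym store = "string \<Rightarrow> nat \<Rightarrow> nat"

text \<open>\<open>Minus\<close> is truncated at 0 and \<open>Div\<close> rounds down, with \<open>x div 0 = 0\<close>.\<close>

datatype aexp =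
    N nat
  | Cell string aexp
  | Plus aexp aexp
  | Minus aexp aexp
  | Times aexp aexp
  | Div aexp aexp

datatype com =
    Skip
  | Assign string aexp aexp  \<comment> \<open>memory, address, new content\<close>
  | Flip string aexp         \<comment> \<open>store a random bit at the given memory and address\<close>
  | Seq com com
  | If aexp com com          \<comment> \<open>a condition holds if its value is not 0\<close>
  | While aexp com

primrec aval :: "aexp \<Rightarrow> store \<Rightarrow> nat" where
  "aval (N k) s = k"
| "aval (Cell x a) s = s x (aval a s)"
| "aval (Plus a b) s = aval a s + aval b s"
| "aval (Minus a b) s = aval a s - aval b s"
| "aval (Times a b) s = aval a s * aval b s"
| "aval (Div a b) s = aval a s div aval b s"

definition write_cell :: "string \<Rightarrow> nat \<Rightarrow> nat \<Rightarrow> store \<Rightarrow> store" where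
  "write_cell x i v s = s(x := (s x)(i := v))"

text \<open>
  The argument \<open>b\<close> is the outcome of a fresh coin toss, which only \<open>Flip\<close> looks at.
\<close>

primrec step :: "bool \<Rightarrow> com \<Rightarrow> store \<Rightarrow> com \<times> store" where
  "step b Skip s = (Skip, s)"
| "step b (Assign x i a) s = (Skip, write_cell x (aval i s) (aval a s) s)"
| "step b (Flip x i) s = (Skip, write_cell x (aval i s) (of_bool b) s)"
| "step b (Seq c d) s =
     (if c = Skip then (d, s) else (let (c', s') = step b c s in (Seq c' d, s')))"
| "step b (If a c d) s = (if aval a s \<noteq> 0 then (c, s) else (d, s))"
| "step b (While a c) s = (if aval a s \<noteq> 0 then (Seq c (While a c), s) else (Skip, s))"

text \<open>Step \<open>t\<close> uses the \<open>t\<close>-th element of the sequence \<open>\<omega>\<close> of coin tosses.\<close>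

primrec run :: "com \<Rightarrow> store \<Rightarrow> bool stream \<Rightarrow> nat \<Rightarrow> com \<times> store" where
  "run c s \<omega> 0 = (c, s)"
| "run c s \<omega> (Suc t) = (let (c', s') = run c s \<omega> t in step (\<omega> !! t) c' s')"

definition halted :: "com \<times> store \<Rightarrow> bool" where
  "halted cfg \<longleftrightarrow> fst cfg = Skip"

definition coins :: "bool stream measure" where
  "coins = stream_space (measure_pmf (bernoulli_pmf (1/2)))"


subsection \<open>Time\<close>

text \<open>Number of binary digits, where the number 0 has one digit.\<close>

definition bits :: "nat \<Rightarrow> nat" where
  "bits k = max 1 (floorlog 2 k)"

text \<open>Evaluation is charged the length of every intermediate value.\<close>

primrec acost :: "aexp \<Rightarrow> store \<Rightarrow> nat" where
  "acost (N k) s = bits k"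
| "acost (Cell x a) s = acost a s + bits (aval (Cell x a) s)"
| "acost (Plus a b) s = acost a s + acost b s + bits (aval (Plus a b) s)"
| "acost (Minus a b) s = acost a s + acost b s + bits (aval (Minus a b) s)"
| "acost (Times a b) s = acost a s + acost b s + bits (aval (Times a b) s)"
| "acost (Div a b) s = acost a s + acost b s + bits (aval (Div a b) s)"

primrec step_cost :: "com \<Rightarrow> store \<Rightarrow> nat" where
  "step_cost Skip s = 0"
| "step_cost (Assign x i a) s = 1 + acost i s + acost a s"
| "step_cost (Flip x i) s = 1 + acost i s"
| "step_cost (Seq c d) s = (if c = Skip then 1 else step_cost c s)"
| "step_cost (If a c d) s = 1 + acost a s"
| "step_cost (While a c) s = 1 + acost a s"

text \<open>
  All steps before halting cost at least 1, so a run that does not halt has infinite time.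
\<close>

definition run_time :: "com \<Rightarrow> store \<Rightarrow> bool stream \<Rightarrow> ennreal" where
  "run_time c s \<omega> = (\<Sum>t. of_nat (case run c s \<omega> t of (c', s') \<Rightarrow> step_cost c' s'))"

definition expected_time :: "com \<Rightarrow> store \<Rightarrow> ennreal" where
  "expected_time c s = (\<integral>\<^sup>+ \<omega>. run_time c s \<omega> \<partial>coins)"


subsection \<open>Space\<close>

text \<open>
  The size of a store is its length when written as a list of address/content pairs of the
  nonzero cells. The residual program takes only finitely many values during all runs of a
  fixed program and is not counted. Reachable stores have only finitely many nonzero cells
  (see \<open>finite_support_run\<close> below), so the sum is over a finite set.
\<close>

definition support :: "store \<Rightarrow> (string \<times> nat) set" where
  "support s = {(x, i). s x i \<noteq> 0}"

definition store_size :: "store \<Rightarrow> nat" where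
  "store_size s = (\<Sum>(x, i) \<in> support s. bits i + bits (s x i))"


subsection \<open>Input and output\<close>

text \<open>The number of vertices, and the adjacency matrix row by row.\<close>

definition graph_input :: "nat \<Rightarrow> nat pair_pre_digraph \<Rightarrow> store" where
  "graph_input n G x i =
     (if x = ''n'' \<and> i = 0 then n
      else if x = ''adj'' \<and> i < n * n then of_bool ((i div n, i mod n) \<in> parcs G)
      else 0)"

definition result :: "com \<times> store \<Rightarrow> nat" where
  "result cfg = snd cfg ''out'' 0"


subsection \<open>Sanity checks\<close>

lemma finite_support_graph_input: "finite (support (graph_input n G))"
proof (rule finite_subset)
  show "support (graph_input n G) \<subseteq> {''n'', ''adj''} \<times> ({0} \<union> {..<n * n})"
    by (auto simp: support_def graph_input_def split: if_splits)
qed simp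

lemma finite_support_write_cell: "finite (support s) \<Longrightarrow> finite (support (write_cell x i v s))"
  by (rule finite_subset[of _ "insert (x, i) (support s)"])
     (auto simp: support_def write_cell_def split: if_splits)

lemma finite_support_step: "finite (support s) \<Longrightarrow> finite (support (snd (step b c s)))"
  by (induction c) (auto simp: finite_support_write_cell split: prod.splits)

lemma finite_support_run: "finite (support s) \<Longrightarrow> finite (support (snd (run c s \<omega> t)))"
proof (induction t)
  case (Suc t)
  then show ?case
    using finite_support_step[of "snd (run c s \<omega> t)" "\<omega> !! t" "fst (run c s \<omega> t)"]
    by (simp add: case_prod_beta Let_def)
qed simp

lemma step_cost_pos: "c \<noteq> Skip \<Longrightarrow> 0 < step_cost c s"
  by (induction c) auto

lemma run_cong_prefix:
  "(\<And>i. i < t \<Longrightarrow> \<omega> !! i = \<omega>' !! i) \<Longrightarrow> run c s \<omega> t = run c s \<omega>' t"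
  by (induction t) auto

lemma run_stake: "run c s \<omega> t = run c s (stake t \<omega> @- sconst False) t"
  by (rule run_cong_prefix) (simp add: shift_snth)

lemma measurable_run: "(\<lambda>\<omega>. run c s \<omega> t) \<in> measurable coins (count_space UNIV)"
proof -
  have sets: "sets coins = sets (stream_space (count_space (UNIV :: bool set)))"
    unfolding coins_def by (rule sets_stream_space_cong) simp
  have "(\<lambda>\<omega>. run c s (stake t \<omega> @- sconst False) t) \<in> measurable coins (count_space UNIV)"
    unfolding measurable_cong_sets[OF sets refl]
    by (rule measurable_compose[OF measurable_stake]) simp
  then show ?thesis
    by (simp only: run_stake[symmetric])
qed

lemma borel_measurable_run_time: "run_time c s \<in> borel_measurable coins"
proof -
  have "(\<lambda>\<omega>. of_nat (case run c s \<omega> t of (c', s') \<Rightarrow> step_cost c' s') :: ennreal)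
      \<in> borel_measurable coins" for t
    by (rule measurable_compose[OF measurable_run]) simp
  then show ?thesis
    unfolding run_time_def[abs_def] by (intro borel_measurable_suminf_order)
qed

lemma run_time_eq_top:
  assumes "\<And>t. \<not> halted (run c s \<omega> t)"
  shows "run_time c s \<omega> = \<infinity>"
proof -
  have "(1 :: ennreal) \<le> of_nat (case run c s \<omega> t of (c', s') \<Rightarrow> step_cost c' s')" for t
  proof -
    have "Suc 0 \<le> (case run c s \<omega> t of (c', s') \<Rightarrow> step_cost c' s')"
      using assms[of t] step_cost_pos by (auto simp: halted_def Suc_le_eq split: prod.splits)
    then have "of_nat (Suc 0) \<le> (of_nat (case run c s \<omega> t of (c', s') \<Rightarrow> step_cost c' s') :: ennreal)"
      by (simp only: of_nat_le_iff)
    then show ?thesis by simp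
  qed
  then have "(\<Sum>t. 1 :: ennreal) \<le> run_time c s \<omega>"
    unfolding run_time_def by (intro suminf_le) auto
  moreover have "(\<Sum>t. 1 :: ennreal) = \<infinity>"
    by (simp add: suminf_eq_SUP ennreal_SUP_of_nat_eq_top)
  ultimately show ?thesis
    by (simp add: top_unique)
qed

end

theory Submission
  imports Defs "Jordan_Normal_Form.Determinant" "HOL-Library.Z2"
begin

text \<open>
  The proof follows Bjorklund and Husfeldt. Split vertex 0 into a source and a sink. Over GF(2), the
  determinant of the Laplacian with arc weights \<open>t v\<close> (\<open>v\<close> the head) counts spanning arborescences, and
  summing it over all vectors \<open>t\<close> keeps only those in which every vertex is a head exactly once,
  that is, the Hamiltonian cycles. Only the top degree in \<open>t\<close> matters for the sum, so any vector
  \<open>g\<close> may be added to the diagonal. The determinant vanishes unless the diagonal entry of each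
  vertex \<open>v\<close> with \<open>t v = 0\<close> is 1, because column \<open>v\<close> is zero elsewhere. If \<open>g\<close> is random, the vectors
  \<open>t\<close> satisfying this number \<open>(1 + 1/2)^n\<close> in expectation. In a bipartite graph, once \<open>t\<close>
  is fixed on one side (\<open>2^(n/2)\<close> choices, as the sides are balanced in a Hamiltonian graph), the condition is
  a system of linear equations for \<open>t\<close> on the other side, whose solutions Gaussian elimination
  enumerates with polynomial delay. Elimination also decides whether the determinant is zero.
\<close>

text \<open>Why only the top degree counts: a monomial whose variables form the set \<open>C\<close>
  is 1 on exactly the sets containing \<open>C\<close>, and their number is even unless
  \<open>C\<close> is everything. Each row has degree at most one in \<open>t\<close>, so the
  \<open>n\<close> rows involve all \<open>n\<close> variables only if none of them contributes its
  constant \<open>g v\<close>. The expected count is a binomial sum: a set of size k survives if n -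
  k independent tosses come out as prescribed. The obstacle is to list the survivors without trying
  all 2^n sets, since the condition "\<open>v\<close> in \<open>T\<close> or diagonal entry 1" is
  quadratic in \<open>T\<close>. In a bipartite graph every arc joins the classes. Fixing
  \<open>T\<close> on one class therefore turns the entries of the other class into known constants
  and leaves those of the fixed class linear in the unknown part. Each survivor is met for just one
  choice on the fixed class, so the cost is a polynomial times the sum of 2^(n/2) and the number of
  survivors; the former is below 1.5^n because 2 < 2.25. One vector \<open>g\<close> is drawn per
  run. The parity is right for every outcome of the tosses; only the time is random.\<close>

section \<open>Sum of Laplacian determinants\<close>

text \<open>These rules turn sums and products over GF(2) into Boolean operations and so hide the ring structure.\<close>

declare add_bit_eq_xor [simp del] mult_bit_eq_and [simp del]

lemma bit_add_self [simp]: "(a::bit) + a = 0"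
  by (cases a) auto

lemma of_nat_bit: "(of_nat k :: bit) = of_bool (odd k)"
  by (induction k) auto

lemma sum_of_bool_bit:
  "finite S \<Longrightarrow> (\<Sum>x\<in>S. of_bool (P x) :: bit) = of_nat (card {x\<in>S. P x})"
  by (simp add: Int_def flip: sum.inter_filter)

text \<open>The sets between \<open>C\<close> and \<open>S\<close> are \<open>C\<close> joined with
  an arbitrary subset of \<open>S - C\<close>, so their number is a power of two, odd only for
  \<open>C = S\<close>.\<close>

lemma sum_Pow_superset:
  assumes "finite S" "C \<subseteq> S"
  shows "(\<Sum>T\<in>Pow S. of_bool (C \<subseteq> T) :: bit) = of_bool (C = S)"
proof -
  have "bij_betw (\<lambda>U. C \<union> U) (Pow (S - C)) {T\<in>Pow S. C \<subseteq> T}"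
    by (rule bij_betwI[where g = "\<lambda>T. T - C"]) (use assms in auto)
  then have "card {T\<in>Pow S. C \<subseteq> T} = 2 ^ card (S - C)"
    using assms by (simp add: card_Pow bij_betw_same_card[symmetric])
  moreover have "card (S - C) = 0 \<longleftrightarrow> C = S"
    using assms by auto
  moreover have "(\<Sum>T\<in>Pow S. of_bool (C \<subseteq> T) :: bit) = of_nat (card {T\<in>Pow S. C \<subseteq> T})"
    using assms by (intro sum_of_bool_bit) simp
  ultimately show ?thesis
    by (simp add: of_nat_bit)
qed

text \<open>The determinant over GF(2), where signs disappear. A bare sum over permutations can be
  expanded term by term; \<open>det_bit\<close> links it to matrices in order to import the kernel
  criterion.\<close>

definition perm_sum :: "nat \<Rightarrow> (nat \<Rightarrow> nat \<Rightarrow> bit) \<Rightarrow> bit" where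
  "perm_sum n M = (\<Sum>\<pi> | \<pi> permutes {..<n}. \<Prod>v<n. M v (\<pi> v))"

lemma det_bit: "Determinant.det (mat n n (\<lambda>(i, j). M i j)) = perm_sum n M"
proof -
  have "of_int (sign p) = (1::bit)" for p :: "nat \<Rightarrow> nat"
    by (simp add: sign_def)
  then have "Determinant.det (mat n n (\<lambda>(i, j). M i j)) =
      (\<Sum>\<pi> | \<pi> permutes {..<n}. \<Prod>v<n. mat n n (\<lambda>(i, j). M i j) $$ (v, \<pi> v))"
    using det_def'[of "mat n n (\<lambda>(i, j). M i j)" n] by (simp only: mat_carrier atLeast0LessThan mult_1)
  also have "\<dots> = perm_sum n M"
    unfolding perm_sum_def
  proof (intro sum.cong prod.cong refl)
    fix \<pi> v assume "\<pi> \<in> {\<pi>. \<pi> permutes {..<n}}" "v \<in> {..<n}"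
    then have "\<pi> v < n" by (metis lessThan_iff mem_Collect_eq permutes_in_image)
    then show "mat n n (\<lambda>(i, j). M i j) $$ (v, \<pi> v) = M v (\<pi> v)"
      using \<open>v \<in> {..<n}\<close> by simp
  qed
  finally show ?thesis .
qed

text \<open>The singularity criterion without matrix types. The zero-column argument and Gaussian
  elimination both speak about kernel vectors in this form.\<close>

lemma perm_sum_eq_0_iff:
  "perm_sum n M = 0 \<longleftrightarrow> (\<exists>x. (\<exists>w<n. x w \<noteq> 0) \<and> (\<forall>v<n. (\<Sum>w<n. M v w * x w) = 0))"
proof -
  let ?M = "mat n n (\<lambda>(i, j). M i j)"
  have row: "row ?M v \<bullet> y = (\<Sum>w<n. M v w * y $ w)" if "v < n" "y \<in> carrier_vec n" for v y
    using that by (auto simp: scalar_prod_def atLeast0LessThan intro!: sum.cong)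
  have "perm_sum n M = 0 \<longleftrightarrow> (\<exists>y. y \<in> carrier_vec n \<and> y \<noteq> 0\<^sub>v n \<and> ?M *\<^sub>v y = 0\<^sub>v n)"
    using det_0_iff_vec_prod_zero[of ?M n] by (simp add: det_bit)
  also have "\<dots> \<longleftrightarrow> (\<exists>x. (\<exists>w<n. x w \<noteq> 0) \<and> (\<forall>v<n. (\<Sum>w<n. M v w * x w) = 0))"
  proof safe
    fix y :: "bit vec"
    assume y: "y \<in> carrier_vec n" "y \<noteq> 0\<^sub>v n" "?M *\<^sub>v y = 0\<^sub>v n"
    have "\<exists>w<n. y $ w \<noteq> 0"
    proof (rule ccontr)
      assume "\<not> (\<exists>w<n. y $ w \<noteq> 0)"
      then have "y = 0\<^sub>v n" using y(1) by (intro eq_vecI) auto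
      then show False using y(2) by simp
    qed
    moreover have "(\<Sum>w<n. M v w * y $ w) = 0" if "v < n" for v
      using arg_cong[OF y(3), of "\<lambda>z. z $ v"] that y(1) row[OF that y(1)] by auto
    ultimately show "\<exists>x. (\<exists>w<n. x w \<noteq> 0) \<and> (\<forall>v<n. (\<Sum>w<n. M v w * x w) = 0)"
      by (intro exI[of _ "\<lambda>w. y $ w"]) auto
  next
    fix x :: "nat \<Rightarrow> bit" and w
    assume x: "w < n" "x w \<noteq> 0" "\<forall>v<n. (\<Sum>w<n. M v w * x w) = 0"
    have "vec n x \<noteq> 0\<^sub>v n"
      using x(1,2) by (metis index_vec index_zero_vec(1))
    moreover have "?M *\<^sub>v vec n x = 0\<^sub>v n"
      using x(3) row[of _ "vec n x"] by (intro eq_vecI) auto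
    ultimately show "\<exists>y. y \<in> carrier_vec n \<and> y \<noteq> 0\<^sub>v n \<and> ?M *\<^sub>v y = 0\<^sub>v n"
      by (intro exI[of _ "vec n x"]) auto
  qed
  finally show ?thesis .
qed

text \<open>
  The Laplacian of the arc weights \<open>A v u * [u \<in> T]\<close> over GF(2) with \<open>g\<close> added to the diagonal. Vertex 0
  is split into a sink, which is the root and has no row, and a source, where no arc ends: the arcs
  into 0 end in the sink and contribute to the diagonal only.
\<close>

definition tlap :: "nat \<Rightarrow> (nat \<Rightarrow> nat \<Rightarrow> bit) \<Rightarrow> (nat \<Rightarrow> bit) \<Rightarrow> nat set \<Rightarrow> nat \<Rightarrow> nat \<Rightarrow> bit" where
  "tlap n A g T v w =
     (if v = w then g v + (\<Sum>u<n. A v u * of_bool (u \<in> T)) else A v w * of_bool (w \<in> T \<and> w \<noteq> 0))"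

text \<open>Toggling a fixed nonempty union of cycles avoiding 0 pairs up the invariant sets.\<close>

lemma card_invariant_sets:
  fixes h :: "nat \<Rightarrow> nat"
  assumes h: "bij_betw h {..<n} {..<n}" and n: "0 < n"
  shows "odd (card {X. X \<subseteq> {..<n} \<and> h ` X = X \<and> 0 \<notin> X}) \<longleftrightarrow> (\<forall>v<n. \<exists>k. (h ^^ k) 0 = v)"
    (is "odd (card ?S) \<longleftrightarrow> ?c")
proof -
  define O' where "O' = {v. \<exists>k. (h ^^ k) 0 = v}"
  have hV: "h v < n" if "v < n" for v
    using h that by (auto simp: bij_betw_def)
  have inj: "inj_on h {..<n}" using h by (simp add: bij_betw_def)
  have O_sub: "O' \<subseteq> {..<n}"
  proof -
    have "(h ^^ k) 0 < n" for k by (induction k) (use n hV in auto)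
    then show ?thesis by (auto simp: O'_def)
  qed
  have O_h: "h ` O' \<subseteq> O'"
  proof
    fix v assume "v \<in> h ` O'"
    then obtain k where "v = (h ^^ Suc k) 0" by (auto simp: O'_def)
    then show "v \<in> O'" unfolding O'_def by blast
  qed
  have O0: "0 \<in> O'" by (auto simp: O'_def intro: exI[of _ 0])
  have inv: "h ` X = X" if "X \<subseteq> {..<n}" "h ` X \<subseteq> X" for X
    using that inj by (meson card_image card_subset_eq finite_lessThan finite_subset inj_on_subset)
  have O_inv: "h ` O' = O'" using inv O_sub O_h by blast
  have compl: "h ` ({..<n} - X) = {..<n} - X" if "X \<subseteq> {..<n}" "h ` X = X" for X
    using h that inj by (simp add: inj_on_image_set_diff bij_betw_def)
  have fin: "finite ?S" by (rule finite_subset[of _ "Pow {..<n}"]) auto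
  have O_least: "O' \<subseteq> X" if "0 \<in> X" "h ` X \<subseteq> X" for X
  proof -
    have "(h ^^ k) 0 \<in> X" for k by (induction k) (use that in auto)
    then show ?thesis by (auto simp: O'_def)
  qed
  show ?thesis
  proof (cases ?c)
    case True
    then have O_all: "O' = {..<n}" using O_sub by (auto simp: O'_def)
    \<comment> \<open>The complement of an invariant set avoiding 0 is invariant and contains 0,
      hence the whole orbit.\<close>
    have "?S = {{}}"
    proof -
      have "X = {}" if X: "X \<subseteq> {..<n}" "h ` X = X" "0 \<notin> X" for X
      proof -
        have "O' \<subseteq> {..<n} - X"
          using compl[OF X(1,2)] X(3) n by (intro O_least) auto
        then show ?thesis using O_all X(1) by auto
      qed
      then show ?thesis by auto
    qed
    then show ?thesis using True by simp
  next
    case False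
    then obtain w where w: "w < n" "w \<notin> O'" by (auto simp: O'_def)
    define W where "W = {..<n} - O'"
    have W: "W \<subseteq> {..<n}" "h ` W = W" "w \<in> W" "0 \<notin> W"
      using compl[OF O_sub O_inv] w O0 by (auto simp: W_def)
    have W_sub: "X - O' = X \<inter> W" if "X \<subseteq> {..<n}" for X using that by (auto simp: W_def)
    let ?S1 = "{X\<in>?S. w \<in> X}" and ?S2 = "{X\<in>?S. w \<notin> X}"
    let ?f = "\<lambda>X. (X - W) \<union> (W - X)"
    have f: "?f X \<in> ?S" if "X \<in> ?S" for X
    proof -
      have X: "X \<subseteq> {..<n}" "h ` X = X" "0 \<notin> X" using that by auto
      have "X - W \<subseteq> {..<n}" "W - X \<subseteq> {..<n}" using X(1) W(1) by auto
      then have "h ` (X - W) = X - W" "h ` (W - X) = W - X"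
        using inj_on_image_set_diff[OF inj, of X W] inj_on_image_set_diff[OF inj, of W X] X(1,2) W(1,2)
        by simp_all
      then have "h ` ?f X = ?f X" by (simp only: image_Un)
      moreover have "?f X \<subseteq> {..<n}" "0 \<notin> ?f X" using X(1,3) W(1,4) by auto
      ultimately show ?thesis by (simp only: mem_Collect_eq) simp
    qed
    have ff: "?f (?f X) = X" for X by auto
    have "bij_betw ?f ?S1 ?S2"
    proof (rule bij_betwI[where g = ?f])
      show "?f \<in> ?S1 \<rightarrow> ?S2"
      proof
        fix X assume "X \<in> ?S1"
        then have "X \<in> ?S" "w \<in> X" by simp_all
        from f[OF this(1)] this(2) W(3) show "?f X \<in> ?S2" by simp
      qed
      show "?f \<in> ?S2 \<rightarrow> ?S1"
      proof
        fix X assume "X \<in> ?S2"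
        then have "X \<in> ?S" "w \<notin> X" by simp_all
        from f[OF this(1)] this(2) W(3) show "?f X \<in> ?S1" by simp
      qed
      show "?f (?f X) = X" for X by (rule ff)
      show "?f (?f X) = X" for X by (rule ff)
    qed
    then have "card ?S1 = card ?S2" by (rule bij_betw_same_card)
    moreover have "card ?S = card ?S1 + card ?S2"
      using fin by (subst card_Un_disjoint[symmetric]) (auto intro!: arg_cong[where f = card])
    ultimately show ?thesis using False by simp
  qed
qed

text \<open>Such a permutation is determined by its set of moved points. \<pi> maps moved points to
  moved points injectively, hence onto, and agrees with \<open>h\<close> there; conversely
  \<open>ne\<close> makes every point of an invariant set move. Forbidding the image 0 amounts to 0
  not being moved.\<close>

lemma card_partial_perms:
  fixes h :: "nat \<Rightarrow> nat"
  assumes h: "bij_betw h {..<n} {..<n}" and ne: "\<And>v. v < n \<Longrightarrow> h v \<noteq> v"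
  shows "card {\<pi>. \<pi> permutes {..<n} \<and> (\<forall>v<n. \<pi> v = v \<or> \<pi> v = h v \<and> h v \<noteq> 0)} =
         card {X. X \<subseteq> {..<n} \<and> h ` X = X \<and> 0 \<notin> X}"
    (is "card ?P = card ?S")
proof -
  let ?f = "\<lambda>X v. if v \<in> X then h v else v"
  have inj: "inj_on h {..<n}" using h by (simp add: bij_betw_def)
  have "bij_betw ?f ?S ?P"
  proof (rule bij_betwI[where g = "\<lambda>\<pi>. {v. v < n \<and> \<pi> v \<noteq> v}"])
    show "?f \<in> ?S \<rightarrow> ?P"
    proof
      fix X assume "X \<in> ?S"
      then have X: "X \<subseteq> {..<n}" "h ` X = X" "0 \<notin> X" by auto
      have "inj_on (?f X) {..<n}"
      proof (rule inj_onI)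
        fix a b assume ab: "a \<in> {..<n}" "b \<in> {..<n}" "?f X a = ?f X b"
        have "h a \<in> X" if "a \<in> X" for a using X(2) that by blast
        then show "a = b"
          using ab inj by (auto split: if_splits simp: inj_on_def)
      qed
      moreover have "?f X ` {..<n} \<subseteq> {..<n}"
        using h X(1) by (auto simp: bij_betw_def)
      ultimately have "bij_betw (?f X) {..<n} {..<n}"
        unfolding bij_betw_def using endo_inj_surj[of "{..<n}" "?f X"] by blast
      then have "?f X permutes {..<n}"
        using X(1) by (intro bij_imp_permutes) auto
      moreover have "h v \<noteq> 0" if "v \<in> X" for v
        using X(2,3) that by (metis imageI)
      ultimately show "?f X \<in> ?P" by auto
    qed
    show "(\<lambda>\<pi>. {v. v < n \<and> \<pi> v \<noteq> v}) \<in> ?P \<rightarrow> ?S"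
    proof
      fix \<pi> assume "\<pi> \<in> ?P"
      then have p: "\<pi> permutes {..<n}" "\<And>v. v < n \<Longrightarrow> \<pi> v = v \<or> \<pi> v = h v \<and> h v \<noteq> 0" by auto
      let ?X = "{v. v < n \<and> \<pi> v \<noteq> v}"
      have X: "\<pi> ` ?X = h ` ?X" using p(2) by (intro image_cong) auto
      have "\<pi> v < n" if "v < n" for v
        using permutes_in_image[OF p(1), of v] that by simp
      then have "\<pi> ` ?X \<subseteq> ?X"
        by (simp add: image_subset_iff inj_eq[OF permutes_inj[OF p(1)]])
      moreover have "card (\<pi> ` ?X) = card ?X"
        using p(1) by (intro card_image) (meson inj_on_subset permutes_inj subset_UNIV)
      ultimately have "\<pi> ` ?X = ?X" by (intro card_subset_eq) auto
      moreover have "0 \<notin> ?X"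
      proof
        assume "0 \<in> ?X"
        then obtain v where "v \<in> ?X" "\<pi> v = 0" using \<open>\<pi> ` ?X = ?X\<close> by (metis (no_types, lifting) imageE)
        then show False using p(2)[of v] by auto
      qed
      moreover have "h ` ?X = ?X" using X \<open>\<pi> ` ?X = ?X\<close> by (simp only:)
      moreover have "?X \<subseteq> {..<n}" by auto
      ultimately show "?X \<in> ?S" by (simp only: mem_Collect_eq) simp
    qed
    show "{v. v < n \<and> ?f X v \<noteq> v} = X" if "X \<in> ?S" for X
      using that ne by auto
    show "?f {v. v < n \<and> \<pi> v \<noteq> v} = \<pi>" if "\<pi> \<in> ?P" for \<pi>
    proof
      fix v
      from that have p: "\<pi> permutes {..<n}" "v < n \<Longrightarrow> \<pi> v = v \<or> \<pi> v = h v" by auto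
      then show "?f {v. v < n \<and> \<pi> v \<noteq> v} v = \<pi> v"
        by (cases "v < n") (auto simp: permutes_not_in[OF p(1)])
    qed
  qed
  then show ?thesis by (simp add: bij_betw_same_card)
qed

text \<open>The successor functions of Hamiltonian cycles. They are extensional so that
  \<open>card\<close> counts each cycle once; a bijection is a single cycle if the orbit of 0 is
  everything.\<close>

definition ham_maps :: "nat \<Rightarrow> (nat \<Rightarrow> nat \<Rightarrow> bit) \<Rightarrow> (nat \<Rightarrow> nat) set" where
  "ham_maps n A = {h \<in> {..<n} \<rightarrow>\<^sub>E {..<n}. bij_betw h {..<n} {..<n} \<and>
     (\<forall>v<n. A v (h v) = 1) \<and> (\<forall>v<n. \<exists>k. (h ^^ k) 0 = v)}"

text \<open>If the diagonal entries are expanded too, a term is a permutation \<pi> with a map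
  \<open>h\<close> that picks one summand in every row. Summing over \<open>T\<close> leaves the
  \<open>h\<close> that hit every vertex. Such an \<open>h\<close> along arcs is a bijection, and
  the permutations compatible with it correspond to the unions of its cycles that avoid 0; their
  number is odd exactly for a single cycle.\<close>

theorem sum_perm_sum_tlap:
  assumes n: "0 < n" and loop: "\<And>v. v < n \<Longrightarrow> A v v = 0"
  shows "(\<Sum>T\<in>Pow {..<n}. perm_sum n (tlap n A g T)) = of_nat (card (ham_maps n A))"
proof -
  let ?V = "{..<n}"
  \<comment> \<open>\<open>u\<close> indexes the summands of the entry in row \<open>v\<close>; the
    value \<open>n\<close>, which is no vertex, stands for the constant \<open>g v\<close>. Off the
    diagonal at most one summand is nonzero.\<close>
  define c where "c = (\<lambda>\<pi> v u. if \<pi> v = v then (if u = n then g v else A v u)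
     else A v u * of_bool (u = \<pi> v \<and> u \<noteq> 0))"
  have lap: "tlap n A g T v (\<pi> v) = (\<Sum>u\<in>{..n}. c \<pi> v u * of_bool (u = n \<or> u \<in> T))"
    if "v < n" "\<pi> permutes ?V" "T \<subseteq> ?V" for \<pi> v T
  proof (cases "\<pi> v = v")
    case True
    have "{..n} = insert n {..<n}" by auto
    then have "(\<Sum>u\<in>{..n}. c \<pi> v u * of_bool (u = n \<or> u \<in> T)) =
      g v + (\<Sum>u\<in>{..<n}. c \<pi> v u * of_bool (u = n \<or> u \<in> T))"
      using True by (simp only: sum.insert finite_lessThan lessThan_iff less_irrefl not_False_eq_True)
        (simp add: c_def)
    also have "(\<Sum>u\<in>{..<n}. c \<pi> v u * of_bool (u = n \<or> u \<in> T)) = (\<Sum>u<n. A v u * of_bool (u \<in> T))"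
      using True by (intro sum.cong) (auto simp: c_def)
    finally show ?thesis using True by (simp only: tlap_def refl if_True)
  next
    case False
    have "\<pi> v < n" using that by (metis lessThan_iff permutes_in_image)
    then have "(\<Sum>u\<in>{..n}. c \<pi> v u * of_bool (u = n \<or> u \<in> T)) =
      (\<Sum>u\<in>{..n}. if u = \<pi> v then A v u * of_bool (u \<noteq> 0 \<and> u \<in> T) else 0)"
      using False by (intro sum.cong) (auto simp: c_def)
    then show ?thesis using \<open>\<pi> v < n\<close> False by (auto simp: tlap_def sum.delta)
  qed
  let ?F = "?V \<rightarrow>\<^sub>E {..n}"
  have finF: "finite ?F" by (simp add: finite_PiE)
  have finP: "finite {\<pi>. \<pi> permutes ?V}" by (simp add: finite_permutations)
  have perm: "(\<Sum>T\<in>Pow ?V. \<Prod>v<n. tlap n A g T v (\<pi> v)) =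
     (\<Sum>h\<in>?F. of_bool (?V \<subseteq> h ` ?V) * (\<Prod>v<n. c \<pi> v (h v)))" if "\<pi> permutes ?V" for \<pi>
  proof -
    have "(\<Sum>T\<in>Pow ?V. \<Prod>v<n. tlap n A g T v (\<pi> v)) =
      (\<Sum>T\<in>Pow ?V. \<Prod>v<n. \<Sum>u\<in>{..n}. c \<pi> v u * of_bool (u = n \<or> u \<in> T))"
      using lap that by (intro sum.cong prod.cong) auto
    also have "\<dots> = (\<Sum>T\<in>Pow ?V. \<Sum>h\<in>?F. \<Prod>v<n. c \<pi> v (h v) * of_bool (h v = n \<or> h v \<in> T))"
      by (subst prod_sum_PiE) auto
    also have "\<dots> = (\<Sum>h\<in>?F. \<Sum>T\<in>Pow ?V. of_bool (h ` ?V - {n} \<subseteq> T) * (\<Prod>v<n. c \<pi> v (h v)))"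
    proof (subst sum.swap, intro sum.cong refl)
      fix h T
      have "(\<Prod>v<n. of_bool (h v = n \<or> h v \<in> T) :: bit) = of_bool (h ` ?V - {n} \<subseteq> T)"
      proof (cases "h ` ?V - {n} \<subseteq> T")
        case True
        then show ?thesis by (auto intro!: prod.neutral)
      next
        case False
        then obtain v where "v < n" "h v \<noteq> n" "h v \<notin> T" by auto
        then show ?thesis using False by (auto intro!: prod_zero)
      qed
      then show "(\<Prod>v<n. c \<pi> v (h v) * of_bool (h v = n \<or> h v \<in> T)) =
          of_bool (h ` ?V - {n} \<subseteq> T) * (\<Prod>v<n. c \<pi> v (h v))"
        by (simp only: prod.distrib mult.commute)
    qed
    also have "\<dots> = (\<Sum>h\<in>?F. of_bool (?V \<subseteq> h ` ?V) * (\<Prod>v<n. c \<pi> v (h v)))"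
    proof (intro sum.cong refl)
      fix h assume "h \<in> ?F"
      then have "h ` ?V \<subseteq> {..n}" by auto
      then have "h ` ?V - {n} \<subseteq> ?V" by (auto simp: le_less)
      moreover have "h ` ?V - {n} = ?V \<longleftrightarrow> ?V \<subseteq> h ` ?V"
        using \<open>h ` ?V \<subseteq> {..n}\<close> by (auto simp: le_less)
      ultimately show "(\<Sum>T\<in>Pow ?V. of_bool (h ` ?V - {n} \<subseteq> T) * (\<Prod>v<n. c \<pi> v (h v))) =
          of_bool (?V \<subseteq> h ` ?V) * (\<Prod>v<n. c \<pi> v (h v))"
        by (simp only: sum_Pow_superset[OF finite_lessThan] flip: sum_distrib_right)
    qed
    finally show ?thesis .
  qed
  have "(\<Sum>T\<in>Pow ?V. perm_sum n (tlap n A g T)) =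
      (\<Sum>\<pi> | \<pi> permutes ?V. \<Sum>T\<in>Pow ?V. \<Prod>v<n. tlap n A g T v (\<pi> v))"
    unfolding perm_sum_def by (rule sum.swap)
  also have "\<dots> = (\<Sum>\<pi> | \<pi> permutes ?V. \<Sum>h\<in>?F. of_bool (?V \<subseteq> h ` ?V) * (\<Prod>v<n. c \<pi> v (h v)))"
    using perm by (intro sum.cong) auto
  also have "\<dots> = (\<Sum>h\<in>?F. of_bool (?V \<subseteq> h ` ?V) * (\<Sum>\<pi> | \<pi> permutes ?V. \<Prod>v<n. c \<pi> v (h v)))"
    by (subst sum.swap) (simp only: sum_distrib_left)
  also have "\<dots> = (\<Sum>h\<in>?F. of_bool (h \<in> ham_maps n A))"
  proof (intro sum.cong refl)
    fix h assume hF: "h \<in> ?F"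
    show "of_bool (?V \<subseteq> h ` ?V) * (\<Sum>\<pi> | \<pi> permutes ?V. \<Prod>v<n. c \<pi> v (h v)) =
        (of_bool (h \<in> ham_maps n A) :: bit)"
    proof (cases "?V \<subseteq> h ` ?V")
      case False
      then show ?thesis by (auto simp: ham_maps_def bij_betw_def)
    next
      case True
      \<comment> \<open>The \<open>n\<close> rows have to cover \<open>n\<close> vertices, so no row
        picks the constant: \<open>g\<close> disappears here.\<close>
      have img: "h ` ?V = ?V"
        using True by (metis card_image_le card_seteq finite_imageI finite_lessThan)
      then have h: "bij_betw h ?V ?V"
        by (simp add: bij_betw_def eq_card_imp_inj_on)
      have hE: "h \<in> ?V \<rightarrow>\<^sub>E ?V" using hF img by (auto simp: PiE_iff)
      have hn: "h v \<noteq> n" if "v < n" for v using img that by (metis imageI lessThan_iff less_irrefl)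
      show ?thesis
      proof (cases "\<forall>v<n. A v (h v) = 1")
        case False
        then obtain v where v: "v < n" "A v (h v) = 0" by auto
        have "(\<Prod>v<n. c \<pi> v (h v)) = 0" for \<pi>
          using v hn[of v] by (intro prod_zero) (auto intro!: bexI[of _ v] simp: c_def)
        then have "(\<Sum>\<pi> | \<pi> permutes ?V. \<Prod>v<n. c \<pi> v (h v)) = 0"
          by (intro sum.neutral) blast
        moreover have "h \<notin> ham_maps n A" using False by (simp add: ham_maps_def)
        ultimately show ?thesis by simp
      next
        case arcs: True
        have ne: "h v \<noteq> v" if "v < n" for v using arcs loop that by (metis bit_not_one_iff)
        have prod: "(\<Prod>v<n. c \<pi> v (h v)) = of_bool (\<forall>v<n. \<pi> v = v \<or> \<pi> v = h v \<and> h v \<noteq> 0)" for \<pi>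
        proof (cases "\<forall>v<n. \<pi> v = v \<or> \<pi> v = h v \<and> h v \<noteq> 0")
          case True
          have "c \<pi> v (h v) = 1" if "v < n" for v
            using True[rule_format, OF that] arcs[rule_format, OF that] hn[OF that]
            by (cases "\<pi> v = v") (simp_all add: c_def)
          then have "(\<Prod>v<n. c \<pi> v (h v)) = 1" by (intro prod.neutral) simp
          then show ?thesis using True by simp
        next
          case False
          then obtain v where "v < n" "\<pi> v \<noteq> v" "\<not> (\<pi> v = h v \<and> h v \<noteq> 0)" by auto
          then have "c \<pi> v (h v) = 0" by (auto simp: c_def)
          then have "(\<Prod>v<n. c \<pi> v (h v)) = 0" using \<open>v < n\<close> by (intro prod_zero) auto
          then show ?thesis using False by (simp only: of_bool_eq)
        qed
        have "{\<pi> \<in> {\<pi>. \<pi> permutes ?V}. \<forall>v<n. \<pi> v = v \<or> \<pi> v = h v \<and> h v \<noteq> 0} =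
            {\<pi>. \<pi> permutes ?V \<and> (\<forall>v<n. \<pi> v = v \<or> \<pi> v = h v \<and> h v \<noteq> 0)}" by auto
        then have "(\<Sum>\<pi> | \<pi> permutes ?V. \<Prod>v<n. c \<pi> v (h v)) =
            of_bool (\<forall>v<n. \<exists>k. (h ^^ k) 0 = v)"
          unfolding prod sum_of_bool_bit[OF finP]
          using card_invariant_sets[OF h n] card_partial_perms[OF h ne]
          by (simp only: of_nat_bit)
        then show ?thesis using True h hE arcs by (simp add: ham_maps_def)
      qed
    qed
  qed
  also have "\<dots> = of_nat (card {h\<in>?F. h \<in> ham_maps n A})"
    using finF by (rule sum_of_bool_bit)
  also have "{h\<in>?F. h \<in> ham_maps n A} = ham_maps n A"
    by (auto simp: ham_maps_def PiE_iff less_imp_le)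
  finally show ?thesis .
qed

definition alive :: "nat \<Rightarrow> (nat \<Rightarrow> nat \<Rightarrow> bit) \<Rightarrow> (nat \<Rightarrow> bit) \<Rightarrow> nat set set" where
  "alive n A g = {T \<in> Pow {..<n}. \<forall>v<n. v \<notin> T \<longrightarrow> g v + (\<Sum>u<n. A v u * of_bool (u \<in> T)) = 1}"

text \<open>If \<open>v \<notin> T\<close> then column \<open>v\<close> is zero outside the diagonal.\<close>

lemma perm_sum_tlap_eq_0:
  assumes "T \<subseteq> {..<n}" "T \<notin> alive n A g"
  shows "perm_sum n (tlap n A g T) = 0"
proof -
  obtain v where v: "v < n" "v \<notin> T" "g v + (\<Sum>u<n. A v u * of_bool (u \<in> T)) = 0"
    using assms by (auto simp: alive_def)
  have "(\<Sum>w<n. tlap n A g T u w * of_bool (w = v)) = 0" for u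
  proof -
    have "tlap n A g T u v = 0" using v by (auto simp: tlap_def)
    then show ?thesis by (intro sum.neutral) auto
  qed
  then show ?thesis using v(1)
    unfolding perm_sum_eq_0_iff by (intro exI[of _ "\<lambda>w. of_bool (w = v)"]) auto
qed

section \<open>Hamiltonian cycles as maps\<close>

text \<open>Among the iterates 0 to \<open>n\<close> two agree by pigeonhole, and injectivity of
  \<open>h\<close> moves the coincidence down to a return to 0 after some \<open>r\<close> \<le>
  \<open>n\<close> steps. All vertices occur among the first \<open>r\<close> iterates, so
  \<open>r = n\<close>.\<close>

lemma funpow_orbit:
  fixes h :: "nat \<Rightarrow> nat"
  assumes n: "0 < n" and h: "bij_betw h {..<n} {..<n}" and orb: "\<forall>v<n. \<exists>k. (h ^^ k) 0 = v"
  shows "(h ^^ n) 0 = 0" "bij_betw (\<lambda>k. (h ^^ k) 0) {..<n} {..<n}"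
proof -
  let ?o = "\<lambda>k. (h ^^ k) 0"
  have inj: "inj_on h {..<n}" and hV: "\<And>v. v < n \<Longrightarrow> h v < n"
    using h by (auto simp: bij_betw_def)
  have oV: "?o k < n" for k by (induction k) (use n hV in auto)
  have "\<not> inj_on ?o {..n}"
    using card_inj_on_le[of ?o "{..n}" "{..<n}"] oV by auto
  then obtain i j where ij: "i < j" "j \<le> n" "?o i = ?o j"
    unfolding inj_on_def by (metis atMost_iff linorder_neqE_nat)
  have "?o (j - i) = 0"
    using ij(1,3)
  proof (induction i arbitrary: j)
    case (Suc i)
    from Suc.prems obtain j' where j: "j = Suc j'" by (cases j) auto
    then have "h (?o i) = h (?o j')" using Suc.prems by simp
    then have "?o i = ?o j'" using inj oV by (auto simp: inj_on_def)
    then show ?case using Suc.IH[of j'] Suc.prems j by simp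
  qed simp
  moreover define r where "r = j - i"
  ultimately have r: "0 < r" "r \<le> n" "?o r = 0" using ij by auto
  have "{..<n} \<subseteq> ?o ` {..<r}"
  proof
    fix v assume "v \<in> {..<n}"
    then obtain k where "?o k = v" using orb by auto
    then have "?o (k mod r) = v" using funpow_mod_eq[where f = h and n = r and x = 0 and m = k] r(3) by simp
    then show "v \<in> ?o ` {..<r}" using r(1) by (auto intro!: rev_image_eqI[of "k mod r"])
  qed
  then have sub: "{..<n} \<subseteq> ?o ` {..<r}" .
  then have "n \<le> card (?o ` {..<r})" by (metis card_lessThan card_mono finite_imageI finite_lessThan)
  also have "\<dots> \<le> r" using card_image_le[of "{..<r}" ?o] by simp
  finally have "r = n" using r(2) by simp
  with r(3) show "?o n = 0" by simp
  have "?o ` {..<n} = {..<n}" using sub \<open>r = n\<close> oV by auto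
  then show "bij_betw ?o {..<n} {..<n}"
    by (simp add: bij_betw_def eq_card_imp_inj_on)
qed

section \<open>Closed walks and successor maps\<close>

lemma pcas_iff_nth:
  "p \<noteq> [] \<Longrightarrow> pcas u p v \<longleftrightarrow> fst (p ! 0) = u \<and> snd (p ! (length p - 1)) = v \<and>
     (\<forall>i. Suc i < length p \<longrightarrow> fst (p ! Suc i) = snd (p ! i))"
proof (induction p arbitrary: u)
  case IH: (Cons e p)
  show ?case
  proof (cases p)
    case (Cons e' p')
    have all: "(\<forall>i. P i) \<longleftrightarrow> P 0 \<and> (\<forall>i. P (Suc i))" for P :: "nat \<Rightarrow> bool"
      by (metis not0_implies_Suc)
    have "(\<forall>i. Suc i < length (e # p) \<longrightarrow> fst ((e # p) ! Suc i) = snd ((e # p) ! i)) \<longleftrightarrow>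
       fst (p ! 0) = snd e \<and> (\<forall>i. Suc i < length p \<longrightarrow> fst (p ! Suc i) = snd (p ! i))"
      by (subst all) (simp add: Cons)
    moreover have "pcas (snd e) p v \<longleftrightarrow> fst (p ! 0) = snd e \<and> snd (p ! (length p - 1)) = v \<and>
      (\<forall>i. Suc i < length p \<longrightarrow> fst (p ! Suc i) = snd (p ! i))"
      using IH.IH[of "snd e"] Cons by simp
    moreover have "snd ((e # p) ! (length (e # p) - 1)) = snd (p ! (length p - 1))"
      by (simp add: Cons)
    ultimately show ?thesis by (simp only: pcas.simps nth_Cons_0) blast
  qed auto
qed simp

lemma map_pawalk_verts: "pcas u p v \<Longrightarrow> pawalk_verts u p = u # map snd p"
  by (induction p arbitrary: u) auto

lemma pawalk_verts_map_fst: "pcas u p v \<Longrightarrow> pawalk_verts u p = map fst p @ [v]"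
  by (induction p arbitrary: u) auto

context
  fixes G :: "nat pair_pre_digraph" and n :: nat
  assumes verts: "pverts G = {..<n}" and n: "0 < n"
begin

lemma cycle_iff:
  "pre_digraph.cycle (with_proj G) p \<longleftrightarrow>
     p \<noteq> [] \<and> set p \<subseteq> parcs G \<and> (\<exists>u. u < n \<and> pcas u p u) \<and> distinct (map snd p)"
proof -
  have "pcas u p u \<and> distinct (tl (pawalk_verts u p)) \<longleftrightarrow> pcas u p u \<and> distinct (map snd p)" for u
    using map_pawalk_verts[of u p u] by auto
  then show ?thesis
    unfolding pre_digraph.cycle_def pre_digraph.awalk_def cas_with_proj_eq awalk_verts_with_proj_eq
      with_proj_simps verts lessThan_iff by blast
qed

lemma ham_map_imp_cycle:
  assumes "h \<in> ham_maps n (\<lambda>u v. of_bool ((u, v) \<in> parcs G))"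
  shows "(\<lambda>v. (v, h v)) ` {..<n} \<in> ham_cycles G"
proof -
  have h: "bij_betw h {..<n} {..<n}" "\<forall>v<n. \<exists>k. (h ^^ k) 0 = v" "\<And>v. v < n \<Longrightarrow> (v, h v) \<in> parcs G"
    using assms by (auto simp: ham_maps_def)
  let ?o = "\<lambda>k. (h ^^ k) 0"
  note o = funpow_orbit[OF n h(1,2)]
  have img: "?o ` {..<n} = {..<n}" using o(2) by (simp add: bij_betw_def)
  \<comment> \<open>The arcs in the order in which the orbit of 0 passes them; the orbit closes up
    after \<open>n\<close> steps.\<close>
  define p where "p = map (\<lambda>k. (?o k, h (?o k))) [0..<n]"
  have "set p = (\<lambda>v. (v, h v)) ` (?o ` {..<n})"
    by (auto simp: p_def image_image atLeast0LessThan)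
  then have set_p: "set p = (\<lambda>v. (v, h v)) ` {..<n}" by (simp only: img)
  have "pcas 0 p 0"
  proof -
    have "p \<noteq> []" using n by (simp add: p_def)
    moreover have "h (?o (n - Suc 0)) = 0" using o(1) n by (metis One_nat_def Suc_diff_1 comp_apply funpow.simps(2))
    ultimately show ?thesis using n by (auto simp: pcas_iff_nth p_def)
  qed
  moreover have "distinct (map snd p)"
  proof -
    have "inj_on (h \<circ> ?o) {..<n}"
      using h(1) o(2) by (intro comp_inj_on) (auto simp: bij_betw_def)
    then show ?thesis by (simp add: p_def distinct_map atLeast0LessThan comp_def inj_on_def)
  qed
  moreover have "set p \<subseteq> parcs G" using h(3) by (auto simp: set_p)
  moreover have "fst ` set p = pverts G" by (auto simp: set_p verts image_image)
  ultimately have "pre_digraph.cycle (with_proj G) p \<and> fst ` set p = pverts G"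
    unfolding cycle_iff using n by (auto simp: p_def)
  then show ?thesis unfolding ham_cycles_def set_p[symmetric] by blast
qed

text \<open>The heads of the arcs are distinct and form the same set as the tails, so the tails are
  distinct too, and the arc list, read as an association list, is the successor map.\<close>

lemma cycle_imp_ham_map:
  assumes "C \<in> ham_cycles G"
  shows "C \<in> (\<lambda>h. (\<lambda>v. (v, h v)) ` {..<n}) ` ham_maps n (\<lambda>u v. of_bool ((u, v) \<in> parcs G))"
proof -
  obtain p where "C = set p" "pre_digraph.cycle (with_proj G) p" and fst_p: "fst ` set p = {..<n}"
    using assms unfolding ham_cycles_def verts by blast
  then obtain u where p: "p \<noteq> []" "set p \<subseteq> parcs G" "pcas u p u" "distinct (map snd p)" "C = set p"
    unfolding cycle_iff by blast
  let ?k = "length p"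
  have k: "0 < ?k" using p(1) by simp
  \<comment> \<open>The vertex sequence of the closed walk, written once with the tails and once
    with the heads.\<close>
  have eq: "map fst p @ [u] = u # map snd p"
    using map_pawalk_verts[OF p(3)] pawalk_verts_map_fst[OF p(3)] by simp
  have "fst (p ! 0) = u" "snd (p ! (?k - 1)) = u"
    using p(3) pcas_iff_nth[OF p(1)] by simp_all
  then have u: "u \<in> fst ` set p" "u \<in> snd ` set p"
    using k by (auto intro!: image_eqI[of _ fst "p ! 0"] image_eqI[of _ snd "p ! (?k - 1)"])
  have sets: "set (map fst p) = set (map snd p)"
    using arg_cong[OF eq, of set] u by (simp add: insert_absorb)
  have dist: "distinct (map fst p)"
    using p(4) sets by (metis card_distinct distinct_card length_map)
  define h where "h = (\<lambda>v\<in>{..<n}. the (map_of p v))"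
  have h: "h v = w" if "(v, w) \<in> set p" for v w
  proof -
    have "map_of p v = Some w" using that dist by (rule map_of_is_SomeI[rotated])
    moreover have "v \<in> fst ` set p" using that by force
    then have "v < n" using fst_p by simp
    ultimately show ?thesis by (simp add: h_def)
  qed
  have hp: "(v, h v) \<in> set p" if "v < n" for v
  proof -
    have "v \<in> fst ` set p" using that fst_p by simp
    then obtain e where e: "e \<in> set p" "v = fst e" by blast
    then have "h v = snd e" using h[of v "snd e"] by simp
    then show ?thesis using e by simp
  qed
  have set_p: "set p = (\<lambda>v. (v, h v)) ` {..<n}"
  proof
    show "set p \<subseteq> (\<lambda>v. (v, h v)) ` {..<n}"
    proof
      fix e assume e: "e \<in> set p"
      then have "fst e \<in> {..<n}" unfolding fst_p[symmetric] by simp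
      moreover have "e = (fst e, h (fst e))" using h[of "fst e" "snd e"] e by simp
      ultimately show "e \<in> (\<lambda>v. (v, h v)) ` {..<n}" by (rule rev_image_eqI)
    qed
  qed (use hp in auto)
  have "h ` {..<n} = snd ` set p" by (simp add: set_p image_image)
  then have img: "h ` {..<n} = {..<n}" using sets fst_p by simp
  have step: "h (fst (p ! i)) = fst (p ! (Suc i mod ?k))" if "i < ?k" for i
  proof -
    have "h (fst (p ! i)) = snd (p ! i)" using h[of "fst (p ! i)" "snd (p ! i)"] that by simp
    also have "\<dots> = fst (p ! (Suc i mod ?k))"
    proof (cases "Suc i < ?k")
      case True
      then show ?thesis using p(3) pcas_iff_nth[OF p(1)] by simp
    next
      case False
      then have "Suc i = ?k" using that by simp
      moreover from this have "i = ?k - 1" by simp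
      ultimately show ?thesis using p(3) pcas_iff_nth[OF p(1), of u u] by simp
    qed
    finally show ?thesis .
  qed
  have steps: "(h ^^ j) (fst (p ! i)) = fst (p ! ((i + j) mod ?k))" if "i < ?k" for i j
  proof (induction j)
    case (Suc j)
    then show ?case using step[of "(i + j) mod ?k"] k by (simp add: mod_Suc_eq)
  qed (use that in simp)
  have orb: "\<exists>j. (h ^^ j) 0 = v" if "v < n" for v
  proof -
    have ex: "\<exists>i<?k. fst (p ! i) = v" if "v < n" for v
    proof -
      have "v \<in> fst ` set p" using that fst_p by simp
      then obtain e where "e \<in> set p" "fst e = v" by blast
      then show ?thesis by (auto simp: in_set_conv_nth)
    qed
    obtain a where a: "a < ?k" "fst (p ! a) = 0" using ex[OF n] by blast
    obtain b where b: "b < ?k" "fst (p ! b) = v" using ex[OF \<open>v < n\<close>] by blast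
    note ab = a b
    \<comment> \<open>The cyclic distance from position \<open>a\<close> to position
      \<open>b\<close>; adding the length keeps the truncated subtraction exact.\<close>
    have "(a + (b + ?k - a)) mod ?k = b" using ab by simp
    then have "(h ^^ (b + ?k - a)) 0 = v" using steps[OF ab(1), of "b + ?k - a"] ab by simp
    then show ?thesis ..
  qed
  have "bij_betw h {..<n} {..<n}" using img by (simp add: bij_betw_def eq_card_imp_inj_on)
  moreover have "h \<in> {..<n} \<rightarrow>\<^sub>E {..<n}" using img by (auto simp: h_def)
  moreover have "(v, h v) \<in> parcs G" if "v < n" for v using hp[OF that] p(2) by blast
  ultimately have "h \<in> ham_maps n (\<lambda>u v. of_bool ((u, v) \<in> parcs G))"
    using orb by (simp add: ham_maps_def)
  then show ?thesis
    unfolding p(5) set_p by (rule imageI)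
qed

lemma card_ham_cycles:
  "card (ham_cycles G) = card (ham_maps n (\<lambda>u v. of_bool ((u, v) \<in> parcs G)))"
proof -
  let ?H = "ham_maps n (\<lambda>u v. of_bool ((u, v) \<in> parcs G))"
  have "inj_on (\<lambda>h. (\<lambda>v. (v, h v)) ` {..<n}) ?H"
  proof (rule inj_onI)
    fix h h' assume "h \<in> ?H" "h' \<in> ?H" and eq: "(\<lambda>v. (v, h v)) ` {..<n} = (\<lambda>v. (v, h' v)) ` {..<n}"
    then have ext: "h \<in> extensional {..<n}" "h' \<in> extensional {..<n}"
      by (auto simp: ham_maps_def PiE_def)
    have "h v = h' v" if "v \<in> {..<n}" for v
    proof -
      have "(v, h v) \<in> (\<lambda>v. (v, h' v)) ` {..<n}" using that eq by blast
      then show ?thesis by auto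
    qed
    then show "h = h'" using ext by (intro extensionalityI)
  qed
  moreover have "(\<lambda>h. (\<lambda>v. (v, h v)) ` {..<n}) ` ?H = ham_cycles G"
    by (intro equalityI subsetI cycle_imp_ham_map image_subsetI ham_map_imp_cycle)
  ultimately show ?thesis using card_image by fastforce
qed

end

text \<open>The successor map sends each class injectively into the other. Hence unequal classes
  mean parity 0, and otherwise one class has only n/2 vertices.\<close>

lemma ham_map_imp_balanced:
  assumes "h \<in> ham_maps n M" and AB: "A \<union> B = {..<n}" "A \<inter> B = {}"
    and bip: "\<And>u v. M u v = 1 \<Longrightarrow> u \<in> A \<and> v \<in> B \<or> u \<in> B \<and> v \<in> A"
  shows "card A = card B"
proof -
  have h: "inj_on h {..<n}" "\<And>v. v < n \<Longrightarrow> M v (h v) = 1"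
    using assms(1) by (auto simp: ham_maps_def bij_betw_def)
  have sub: "A \<subseteq> {..<n}" "B \<subseteq> {..<n}" using AB by auto
  then have fin: "finite A" "finite B" by (auto intro: finite_subset)
  have "h v \<in> B" if "v \<in> A" for v
    using bip[OF h(2)[of v]] that AB(2) sub(1) by auto
  then have "card A \<le> card B"
    using fin(2) inj_on_subset[OF h(1) sub(1)] by (intro card_inj_on_le[of h]) auto
  moreover have "h v \<in> A" if "v \<in> B" for v
    using bip[OF h(2)[of v]] that AB(2) sub(2) by auto
  then have "card B \<le> card A"
    using fin(1) inj_on_subset[OF h(1) sub(2)] by (intro card_inj_on_le[of h]) auto
  ultimately show ?thesis by simp
qed

section \<open>Loop programs and their resources\<close>

lemma run_add: "run c s \<omega> (a + b) = (case run c s \<omega> a of (c', s') \<Rightarrow> run c' s' (sdrop a \<omega>) b)"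
  by (induction b) (auto simp: case_prod_beta sdrop_snth)

lemma run_Skip: "run Skip s \<omega> t = (Skip, s)"
  by (induction t) auto

text \<open>\<open>k\<close> is the exact halting time and not just an upper bound: composition
  needs to know which tosses remain, and the cost is a sum over the first \<open>k\<close>
  steps.\<close>

definition exec :: "com \<Rightarrow> store \<Rightarrow> bool stream \<Rightarrow> nat \<Rightarrow> store \<Rightarrow> bool" where
  "exec c s \<omega> k s' \<longleftrightarrow> run c s \<omega> k = (Skip, s') \<and> (\<forall>t<k. fst (run c s \<omega> t) \<noteq> Skip)"

lemma exec_Skip: "exec Skip s \<omega> 0 s"
  by (simp add: exec_def)

lemma exec_step:
  assumes "c \<noteq> Skip" "step (shd \<omega>) c s = (c', s')" "exec c' s' (stl \<omega>) k s''"
  shows "exec c s \<omega> (Suc k) s''"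
proof -
  have *: "run c s \<omega> (Suc t) = run c' s' (stl \<omega>) t" for t
    using run_add[of c s \<omega> 1 t] assms(2) by simp
  show ?thesis
    unfolding exec_def
  proof (intro conjI allI impI)
    show "run c s \<omega> (Suc k) = (Skip, s'')" using assms(3) by (simp only: * exec_def)
    fix t assume "t < Suc k"
    then show "fst (run c s \<omega> t) \<noteq> Skip"
      using assms(1,3) by (cases t) (simp_all only: * exec_def, simp_all)
  qed
qed

lemma run_Seq_prefix:
  "\<forall>t<k. fst (run c s \<omega> t) \<noteq> Skip \<Longrightarrow> t \<le> k \<Longrightarrow>
     run (Seq c d) s \<omega> t = (Seq (fst (run c s \<omega> t)) d, snd (run c s \<omega> t))"
  by (induction t) (auto simp: case_prod_beta)

text \<open>Discarding the finished first component is a step of its own and uses up one toss, hence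
  \<open>Suc k\<close>.\<close>

lemma exec_Seq:
  assumes c: "exec c s \<omega> k s1" and d: "exec d s1 (sdrop (Suc k) \<omega>) l s2"
  shows "exec (Seq c d) s \<omega> (k + 1 + l) s2"
proof -
  have pre: "run (Seq c d) s \<omega> t = (Seq (fst (run c s \<omega> t)) d, snd (run c s \<omega> t))" if "t \<le> k" for t
    using c that by (intro run_Seq_prefix) (auto simp: exec_def)
  then have "run (Seq c d) s \<omega> k = (Seq Skip d, s1)" using c by (simp add: exec_def)
  then have suc: "run (Seq c d) s \<omega> (Suc k) = (d, s1)" by simp
  have post: "run (Seq c d) s \<omega> (Suc k + t) = run d s1 (sdrop (Suc k) \<omega>) t" for t
    unfolding run_add suc by simp
  show ?thesis
    unfolding exec_def
  proof (intro conjI allI impI)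
    show "run (Seq c d) s \<omega> (k + 1 + l) = (Skip, s2)"
      using post[of l] d by (simp add: exec_def)
    fix t assume t: "t < k + 1 + l"
    show "fst (run (Seq c d) s \<omega> t) \<noteq> Skip"
    proof (cases "t \<le> k")
      case True
      then show ?thesis using pre by simp
    next
      case False
      then obtain t' where t': "t = Suc k + t'" by (metis Suc_leI add.commute le_Suc_ex not_le)
      then have "t' < l" using t by simp
      then show ?thesis using d post[of t'] t' by (simp add: exec_def)
    qed
  qed
qed

lemma run_after_exec:
  assumes "exec c s \<omega> k s'" "k \<le> t"
  shows "run c s \<omega> t = (Skip, s')"
  using assms run_add[of c s \<omega> k "t - k"] by (simp add: exec_def run_Skip)

section \<open>Deterministic programs with bounded loops\<close>

datatype prog =
    PAssign string aexp aexp
  | PSeq prog prog  (infixr ";;" 60)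
  | PIf aexp prog prog
  | PFor string string prog
  | PSkip

abbreviation var :: "string \<Rightarrow> aexp" where
  "var x \<equiv> Cell x (N 0)"

text \<open>
  The increment is capped by the loop bound, so that the new value can be bounded without
  knowing that the loop condition holds.
\<close>

definition incr :: "string \<Rightarrow> string \<Rightarrow> aexp" where
  "incr x b = Minus (Plus (var x) (N 1)) (Minus (Plus (var x) (N 1)) (var b))"

primrec compile :: "prog \<Rightarrow> com" where
  "compile (PAssign x i a) = Assign x i a"
| "compile (p ;; q) = Seq (compile p) (compile q)"
| "compile (PIf a p q) = If a (compile p) (compile q)"
| "compile (PFor x b p) = Seq (Assign x (N 0) (N 0))
     (While (Minus (var b) (var x)) (Seq (compile p) (Assign x (N 0) (incr x b))))"
| "compile PSkip = Skip"

text \<open>Without coin tosses and unbounded loops every program denotes a function on stores. The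
  number of rounds of a loop is read off once, on entry.\<close>

primrec den :: "prog \<Rightarrow> store \<Rightarrow> store" where
  "den (PAssign x i a) s = write_cell x (aval i s) (aval a s) s"
| "den (p ;; q) s = den q (den p s)"
| "den (PIf a p q) s = (if aval a s \<noteq> 0 then den p s else den q s)"
| "den (PFor x b p) s =
     ((\<lambda>t. write_cell x 0 (Suc (t x 0)) (den p t)) ^^ s b 0) (write_cell x 0 0 s)"
| "den PSkip s = s"

abbreviation for_state :: "string \<Rightarrow> prog \<Rightarrow> store \<Rightarrow> nat \<Rightarrow> store" where
  "for_state x p s k \<equiv> ((\<lambda>t. write_cell x 0 (Suc (t x 0)) (den p t)) ^^ k) (write_cell x 0 0 s)"

text \<open>In a loop, 3 stands for the initial assignment, its discard and the failing test; 4
  stands for the successful test, the increment and two discards of \<open>Skip\<close>.\<close>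

primrec steps :: "prog \<Rightarrow> store \<Rightarrow> nat" where
  "steps (PAssign x i a) s = 1"
| "steps (p ;; q) s = steps p s + 1 + steps q (den p s)"
| "steps (PIf a p q) s = 1 + (if aval a s \<noteq> 0 then steps p s else steps q s)"
| "steps (PFor x b p) s = 3 + (\<Sum>i<s b 0. 4 +
     steps p (for_state x p s i))"
| "steps PSkip s = 0"

primrec writes :: "prog \<Rightarrow> string set" where
  "writes (PAssign x i a) = {x}"
| "writes (p ;; q) = writes p \<union> writes q"
| "writes (PIf a p q) = writes p \<union> writes q"
| "writes (PFor x b p) = insert x (writes p)"
| "writes PSkip = {}"

text \<open>If the body leaves counter and bound alone, the test of the compiled loop agrees with
  the number of rounds fixed on entry, and the cap in \<open>incr\<close> never takes
  effect.\<close>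

primrec wf_prog :: "prog \<Rightarrow> bool" where
  "wf_prog (PAssign x i a) = True"
| "wf_prog (p ;; q) = (wf_prog p \<and> wf_prog q)"
| "wf_prog (PIf a p q) = (wf_prog p \<and> wf_prog q)"
| "wf_prog (PFor x b p) = (x \<noteq> b \<and> x \<notin> writes p \<and> b \<notin> writes p \<and> wf_prog p)"
| "wf_prog PSkip = True"

lemma write_cell_apply: "write_cell x i v s y = (if y = x then (s x)(i := v) else s y)"
  by (simp add: write_cell_def)

lemma den_frame: "y \<notin> writes p \<Longrightarrow> den p s y = s y"
proof (induction p arbitrary: s)
  case (PFor x b p)
  have "for_state x p s k y = s y" for k
    by (induction k) (use PFor in \<open>auto simp: write_cell_apply\<close>)
  then show ?case by simp
qed (auto simp: write_cell_apply)

lemma for_iter: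
  assumes "x \<notin> writes p"
  shows "for_state x p s k x 0 = k"
    and "y \<notin> insert x (writes p) \<Longrightarrow>
      for_state x p s k y = s y"
  by (induction k) (auto simp: write_cell_apply den_frame)

lemma exec_compile: "wf_prog p \<Longrightarrow> exec (compile p) s \<omega> (steps p s) (den p s)"
proof (induction p arbitrary: s \<omega>)
  case (PAssign x i a)
  then show ?case by (auto intro!: exec_step[OF _ _ exec_Skip])
next
  case (PSeq p q)
  then have "wf_prog p" "wf_prog q" by simp_all
  from exec_Seq[OF PSeq.IH(1)[OF this(1)] PSeq.IH(2)[OF this(2)]]
  show ?case by (simp only: compile.simps steps.simps den.simps)
next
  case (PIf a p q)
  then show ?case by (auto intro!: exec_step)
next
  case (PFor x b p)
  let ?f = "\<lambda>t. write_cell x 0 (Suc (t x 0)) (den p t)"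
  let ?it = "\<lambda>i. (?f ^^ i) (write_cell x 0 0 s)"
  let ?body = "Seq (compile p) (Assign x (N 0) (incr x b))"
  let ?W = "While (Minus (var b) (var x)) ?body"
  let ?m = "s b 0"
  have x: "x \<notin> writes p" and b: "b \<notin> insert x (writes p)" and wf: "wf_prog p"
    using PFor.prems by auto
  note it = for_iter[OF x]
  have body: "exec ?body (?it i) \<omega> (steps p (?it i) + 2) (?it (Suc i))" if "i < ?m" for i \<omega>
  proof -
    have "exec (Assign x (N 0) (incr x b)) (den p (?it i)) \<omega>' 1 (?it (Suc i))" for \<omega>'
      using that it(1)[of i s] it(2)[OF b, of i s] x b
      by (auto intro!: exec_step[OF _ _ exec_Skip, simplified] simp: incr_def den_frame)
    from exec_Seq[OF PFor.IH[OF wf, of "?it i" \<omega>] this] show ?thesis by simp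
  qed
  \<comment> \<open>\<open>j\<close> counts the remaining rounds: the execution is assembled from
    its end backwards.\<close>
  have W: "exec ?W (?it (?m - j)) \<omega> (1 + (\<Sum>i\<in>{?m - j..<?m}. 4 + steps p (?it i))) (?it ?m)"
    if "j \<le> ?m" for j \<omega>
    using that
  proof (induction j arbitrary: \<omega>)
    case 0
    then show ?case using it(1)[of ?m s] it(2)[OF b, of ?m s]
      by (auto intro!: exec_step[OF _ _ exec_Skip])
  next
    case (Suc j)
    define i where "i = ?m - Suc j"
    have i: "i < ?m" "?m - j = Suc i" using Suc.prems by (auto simp: i_def)
    define K where "K = 1 + (\<Sum>i\<in>{Suc i..<?m}. 4 + steps p (?it i))"
    have "exec (Seq ?body ?W) (?it i) \<omega>' (steps p (?it i) + 2 + 1 + K) (?it ?m)" for \<omega>'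
      using Suc.IH Suc.prems unfolding i(2) K_def by (intro exec_Seq[OF body[OF i(1)]]) simp
    moreover have "step (shd \<omega>) ?W (?it i) = (Seq ?body ?W, ?it i)"
      using i(1) it(1)[of i s] it(2)[OF b, of i s] by simp
    ultimately have "exec ?W (?it i) \<omega> (Suc (steps p (?it i) + 2 + 1 + K)) (?it ?m)"
      by (intro exec_step) auto
    moreover
    have "(\<Sum>i\<in>{i..<?m}. 4 + steps p (?it i)) = 4 + steps p (?it i) + (K - 1)"
      using i(1) by (simp add: sum.atLeast_Suc_lessThan K_def)
    then have "Suc (steps p (?it i) + 2 + 1 + K) = 1 + (\<Sum>i\<in>{i..<?m}. 4 + steps p (?it i))"
      by (simp add: K_def)
    ultimately show ?case unfolding i_def[symmetric] by metis
  qed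
  have init: "exec (Assign x (N 0) (N 0)) s \<omega> 1 (?it 0)"
    by (auto intro!: exec_step[OF _ _ exec_Skip, simplified])
  have "exec ?W (?it 0) \<omega> (1 + (\<Sum>i<?m. 4 + steps p (?it i))) (?it ?m)" for \<omega>
    using W[of ?m \<omega>] by (simp add: atLeast0LessThan)
  from exec_Seq[OF init this]
  have "exec (compile (PFor x b p)) s \<omega> (1 + 1 + (1 + (\<Sum>i<?m. 4 + steps p (?it i)))) (?it ?m)"
    by (simp only: compile.simps)
  moreover have "1 + 1 + (1 + (\<Sum>i<?m. 4 + steps p (?it i))) = steps (PFor x b p) s" by simp
  ultimately show ?case by (simp only: den.simps)
next
  case PSkip
  then show ?case by (simp add: exec_Skip)
qed

lemma for_iter_inv:
  fixes I :: "nat \<Rightarrow> store \<Rightarrow> bool"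
  assumes "x \<notin> writes p" "I 0 (write_cell x 0 0 s)"
    and "\<And>i t. i < s b 0 \<Longrightarrow> t x 0 = i \<Longrightarrow> (\<And>y. y \<notin> insert x (writes p) \<Longrightarrow> t y = s y) \<Longrightarrow> I i t
      \<Longrightarrow> I (Suc i) (write_cell x 0 (Suc i) (den p t))"
    and "i \<le> s b 0"
  shows "I i (for_state x p s i)"
  using assms(4)
proof (induction i)
  case (Suc i)
  let ?it = "for_state x p s i"
  have "I (Suc i) (write_cell x 0 (Suc i) (den p ?it))"
    using Suc for_iter[OF assms(1)] by (intro assms(3)) auto
  then show ?case using for_iter(1)[OF assms(1), of i s] by simp
qed (use assms(2) in simp)

text \<open>The invariant rule for loops. Within a round the counter value and all memories not
  written by the loop are known, so an invariant has to mention only what changes.\<close>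

lemma den_For:
  assumes "x \<notin> writes p" "I 0 (write_cell x 0 0 s)"
    and "\<And>i t. i < s b 0 \<Longrightarrow> t x 0 = i \<Longrightarrow> (\<And>y. y \<notin> insert x (writes p) \<Longrightarrow> t y = s y) \<Longrightarrow> I i t
      \<Longrightarrow> I (Suc i) (write_cell x 0 (Suc i) (den p t))"
  shows "I (s b 0) (den (PFor x b p) s)"
proof -
  have "I (s b 0) (for_state x p s (s b 0))"
  proof (rule for_iter_inv[where I = I and b = b])
    show "I (Suc i) (write_cell x 0 (Suc i) (den p t))"
      if "i < s b 0" "t x 0 = i" "\<And>y. y \<notin> insert x (writes p) \<Longrightarrow> t y = s y" "I i t" for i t
      by (rule assms(3)[OF that])
  qed (use assms(1,2) in simp_all)
  then show ?thesis by simp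
qed

text \<open>The bound \<open>K i\<close> may vary from round to round. The search needs this, as the
  cost of a round depends on how many solutions it finds.\<close>

lemma steps_For_le:
  assumes "x \<notin> writes p" "I 0 (write_cell x 0 0 s)"
    and "\<And>i t. i < s b 0 \<Longrightarrow> t x 0 = i \<Longrightarrow> (\<And>y. y \<notin> insert x (writes p) \<Longrightarrow> t y = s y) \<Longrightarrow> I i t
      \<Longrightarrow> I (Suc i) (write_cell x 0 (Suc i) (den p t))"
    and "\<And>i t. i < s b 0 \<Longrightarrow> t x 0 = i \<Longrightarrow> (\<And>y. y \<notin> insert x (writes p) \<Longrightarrow> t y = s y) \<Longrightarrow> I i t
      \<Longrightarrow> steps p t \<le> K i"
  shows "steps (PFor x b p) s \<le> 3 + (\<Sum>i<s b 0. 4 + K i)"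
proof -
  let ?it = "for_state x p s"
  have "steps p (?it i) \<le> K i" if "i < s b 0" for i
  proof (rule assms(4))
    show "I i (?it i)"
      using that by (intro for_iter_inv[where I = I and b = b, OF assms(1-3)]) simp_all
  qed (use that for_iter[OF assms(1)] in simp_all)
  then have "(\<Sum>i<s b 0. 4 + steps p (?it i)) \<le> (\<Sum>i<s b 0. 4 + K i)"
    by (intro sum_mono) simp
  then show ?thesis by simp
qed

section \<open>Step counts polynomial in the loop bounds\<close>

primrec loop_bounds :: "prog \<Rightarrow> string set" where
  "loop_bounds (PAssign x i a) = {}"
| "loop_bounds (p ;; q) = loop_bounds p \<union> loop_bounds q"
| "loop_bounds (PIf a p q) = loop_bounds p \<union> loop_bounds q"
| "loop_bounds (PFor x b p) = insert b (loop_bounds p)"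
| "loop_bounds PSkip = {}"

primrec steps_poly :: "prog \<Rightarrow> nat poly" where
  "steps_poly (PAssign x i a) = 1"
| "steps_poly (p ;; q) = steps_poly p + 1 + steps_poly q"
| "steps_poly (PIf a p q) = 1 + steps_poly p + steps_poly q"
| "steps_poly (PFor x b p) = 3 + [:0, 1:] * (4 + steps_poly p)"
| "steps_poly PSkip = 0"

text \<open>Loop bounds that are never written keep their initial value, so each loop contributes a
  factor of at most \<open>m\<close>. Loops with exponentially many rounds are handled by
  \<open>steps_For_le\<close> instead.\<close>

lemma steps_le_poly:
  assumes "loop_bounds p \<inter> writes p = {}" "\<And>b. b \<in> loop_bounds p \<Longrightarrow> s b 0 \<le> m" "wf_prog p"
  shows "steps p s \<le> poly (steps_poly p) m"
  using assms
proof (induction p arbitrary: s)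
  case (PSeq p q)
  have "steps p s \<le> poly (steps_poly p) m" using PSeq.prems by (intro PSeq.IH) auto
  moreover have "steps q (den p s) \<le> poly (steps_poly q) m"
  proof (rule PSeq.IH)
    fix b assume "b \<in> loop_bounds q"
    then show "den p s b 0 \<le> m" using PSeq.prems by (subst den_frame) auto
  qed (use PSeq.prems in auto)
  ultimately show ?case by simp
next
  case (PIf a p q)
  have "steps p s \<le> poly (steps_poly p) m" "steps q s \<le> poly (steps_poly q) m"
    using PIf.prems by (auto intro!: PIf.IH)
  then show ?case by simp
next
  case (PFor x b p)
  let ?it = "for_state x p s"
  have x: "x \<notin> writes p" using PFor.prems by auto
  have "steps p (?it i) \<le> poly (steps_poly p) m" for i
  proof (rule PFor.IH)
    fix b' assume b': "b' \<in> loop_bounds p"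
    then have "b' \<notin> insert x (writes p)" using PFor.prems(1) by auto
    then have "?it i b' 0 = s b' 0" using for_iter(2)[OF x, of b' i s] by simp
    then show "?it i b' 0 \<le> m" using PFor.prems(2) b' by simp
  qed (use PFor.prems in auto)
  then have "(\<Sum>i<s b 0. 4 + steps p (?it i)) \<le> (\<Sum>i<s b 0. 4 + poly (steps_poly p) m)"
    by (intro sum_mono) simp
  also have "\<dots> \<le> m * (4 + poly (steps_poly p) m)"
    using PFor.prems(2)[of b] by simp
  finally show ?case by simp
qed auto

section \<open>Bounds on values, on the cost of a step and on space\<close>

definition bounded_by :: "(string \<Rightarrow> nat \<Rightarrow> nat) \<Rightarrow> store \<Rightarrow> bool" where
  "bounded_by B s \<longleftrightarrow> (\<forall>x i. s x i \<le> B x i)"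

text \<open>
  The condition ignores the control flow, so it is inherited by the residual programs, and the
  bounds hold in every reachable store.
\<close>

primrec safe :: "(string \<Rightarrow> nat \<Rightarrow> nat) \<Rightarrow> com \<Rightarrow> bool" where
  "safe B Skip = True"
| "safe B (Assign x i a) = (\<forall>s. bounded_by B s \<longrightarrow> aval a s \<le> B x (aval i s))"
| "safe B (Flip x i) = (\<forall>s. bounded_by B s \<longrightarrow> 1 \<le> B x (aval i s))"
| "safe B (Seq c d) = (safe B c \<and> safe B d)"
| "safe B (If a c d) = (safe B c \<and> safe B d)"
| "safe B (While a c) = safe B c"

lemma safe_step:
  "safe B c \<Longrightarrow> bounded_by B s \<Longrightarrow>
     safe B (fst (step b c s)) \<and> bounded_by B (snd (step b c s))"
  by (induction c) (auto simp: bounded_by_def write_cell_apply case_prod_beta)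

lemma safe_run:
  "safe B c \<Longrightarrow> bounded_by B s \<Longrightarrow>
     safe B (fst (run c s \<omega> t)) \<and> bounded_by B (snd (run c s \<omega> t))"
  by (induction t) (auto simp: case_prod_beta safe_step)

lemma safe_compile_For:
  assumes "B b 0 \<le> B x 0" "safe B (compile p)"
  shows "safe B (compile (PFor x b p))"
proof -
  have "aval (incr x b) s \<le> B x 0" if "bounded_by B s" for s
  proof -
    have "aval (incr x b) s \<le> s b 0" by (simp add: incr_def)
    also have "\<dots> \<le> B b 0" using that by (simp add: bounded_by_def)
    also note assms(1)
    finally show ?thesis .
  qed
  then show ?thesis using assms(2) by simp
qed

lemma bits_le: "k < 2 ^ p \<Longrightarrow> 1 \<le> p \<Longrightarrow> bits k \<le> p"
  by (simp add: bits_def floorlog_leI)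

text \<open>Bounds the binary length of a value if all cells are at most \<open>2 ^ w\<close>.
  Lengths add for a product and, generously, also for a sum, since u + v \<le> u * v for u, v \<ge>
  2; subtraction and division do not lengthen the left operand.\<close>

primrec len_poly :: "aexp \<Rightarrow> nat poly" where
  "len_poly (N k) = [:Suc k:]"
| "len_poly (Cell x a) = [:1, 1:]"
| "len_poly (Plus a b) = len_poly a + len_poly b"
| "len_poly (Minus a b) = len_poly a"
| "len_poly (Times a b) = len_poly a + len_poly b"
| "len_poly (Div a b) = len_poly a"

primrec acost_poly :: "aexp \<Rightarrow> nat poly" where
  "acost_poly (N k) = len_poly (N k)"
| "acost_poly (Cell x a) = acost_poly a + len_poly (Cell x a)"
| "acost_poly (Plus a b) = acost_poly a + acost_poly b + len_poly (Plus a b)"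
| "acost_poly (Minus a b) = acost_poly a + acost_poly b + len_poly (Minus a b)"
| "acost_poly (Times a b) = acost_poly a + acost_poly b + len_poly (Times a b)"
| "acost_poly (Div a b) = acost_poly a + acost_poly b + len_poly (Div a b)"

lemma len_poly_pos: "1 \<le> poly (len_poly a) w"
  by (induction a) auto

lemma aval_less:
  assumes "\<And>x i. s x i \<le> 2 ^ w"
  shows "aval a s < 2 ^ poly (len_poly a) w"
proof (induction a)
  case (N k)
  have "k < 2 ^ k" by simp
  also have "\<dots> \<le> 2 ^ Suc k" by simp
  finally show ?case by simp
next
  case (Cell x a)
  have "s x (aval a s) \<le> 2 ^ w" by (rule assms)
  also have "\<dots> < 2 ^ Suc w" by simp
  finally show ?case by simp
next
  case (Plus a b)
  have "(u::nat) + v \<le> u * v" if "2 \<le> u" "2 \<le> v" for u v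
  proof -
    from that obtain c d where "u = c + 2" "v = d + 2" by (metis le_Suc_ex add.commute)
    then show ?thesis by (simp add: algebra_simps)
  qed
  moreover have "(2::nat) \<le> 2 ^ poly (len_poly e) w" for e
    using power_increasing[OF len_poly_pos, of "2::nat" e w] by simp
  ultimately have "(2::nat) ^ poly (len_poly a) w + 2 ^ poly (len_poly b) w
      \<le> 2 ^ poly (len_poly a) w * 2 ^ poly (len_poly b) w" by blast
  then show ?case
    using add_strict_mono[OF Plus.IH] by (simp add: power_add)
next
  case (Times a b)
  then show ?case by (simp add: power_add mult_strict_mono')
next
  case (Div a b)
  then show ?case by (auto intro: le_less_trans[OF div_le_dividend])
qed auto

lemma acost_le:
  assumes "\<And>x i. s x i \<le> 2 ^ w"
  shows "acost a s \<le> poly (acost_poly a) w"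
proof -
  have b: "bits (aval a s) \<le> poly (len_poly a) w" for a
    using aval_less[OF assms] len_poly_pos by (rule bits_le)
  have bN: "bits k \<le> poly (len_poly (N k)) w" for k
    using b[of "N k"] by (simp only: aval.simps)
  show ?thesis
    by (induction a) (auto intro!: add_mono b bN simp del: aval.simps len_poly.simps)
qed

text \<open>One bound for each step that can occur. A residual program only rearranges parts of the
  original, so the set never grows along a run. The constant 1 pays for discarding a finished
  component; for \<open>While\<close> this arises from unfolding into \<open>Seq\<close>.\<close>

primrec cost_polys :: "com \<Rightarrow> nat poly set" where
  "cost_polys Skip = {}"
| "cost_polys (Assign x i a) = {1 + acost_poly i + acost_poly a}"
| "cost_polys (Flip x i) = {1 + acost_poly i}"
| "cost_polys (Seq c d) = {1} \<union> cost_polys c \<union> cost_polys d"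
| "cost_polys (If a c d) = {1 + acost_poly a} \<union> cost_polys c \<union> cost_polys d"
| "cost_polys (While a c) = {1, 1 + acost_poly a} \<union> cost_polys c"

lemma finite_cost_polys: "finite (cost_polys c)"
  by (induction c) auto

lemma cost_polys_step: "cost_polys (fst (step b c s)) \<subseteq> cost_polys c"
  by (induction c) (auto simp: case_prod_beta)

lemma cost_polys_run: "cost_polys (fst (run c s \<omega> t)) \<subseteq> cost_polys c"
  by (induction t) (use cost_polys_step in \<open>fastforce simp: case_prod_beta\<close>)+

lemma step_cost_le:
  assumes "\<And>x i. s x i \<le> 2 ^ w"
  shows "c = Skip \<or> (\<exists>p\<in>cost_polys c. step_cost c s \<le> poly p w)"
  by (induction c) (auto intro!: add_mono acost_le[OF assms])

definition step_poly :: "com \<Rightarrow> nat poly" where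
  "step_poly c = (\<Sum>p\<in>cost_polys c. p)"

lemma step_cost_run_le:
  assumes "safe B c" "bounded_by B s" "\<And>x i. B x i \<le> 2 ^ w"
  shows "step_cost (fst (run c s \<omega> t)) (snd (run c s \<omega> t)) \<le> poly (step_poly c) w"
proof -
  let ?c = "fst (run c s \<omega> t)" and ?s = "snd (run c s \<omega> t)"
  have "bounded_by B ?s" using safe_run[OF assms(1,2)] by blast
  then have "?s x i \<le> 2 ^ w" for x i using assms(3)[of x i] by (auto simp: bounded_by_def intro: order_trans)
  from step_cost_le[OF this, of ?c] show ?thesis
  proof
    assume "\<exists>p\<in>cost_polys ?c. step_cost ?c ?s \<le> poly p w"
    then obtain p where p: "p \<in> cost_polys ?c" "step_cost ?c ?s \<le> poly p w" by blast
    have "poly p w \<le> (\<Sum>p\<in>cost_polys c. poly p w)"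
      using cost_polys_run[of c s \<omega> t] p(1) by (intro member_le_sum finite_cost_polys) auto
    then show ?thesis using p(2) by (simp add: step_poly_def poly_sum)
  qed auto
qed

lemma run_time_le:
  assumes "exec c s \<omega> k s'" "safe B c" "bounded_by B s" "\<And>x i. B x i \<le> 2 ^ w"
  shows "run_time c s \<omega> \<le> of_nat (k * poly (step_poly c) w)"
proof -
  let ?f = "\<lambda>t. step_cost (fst (run c s \<omega> t)) (snd (run c s \<omega> t))"
  have "run_time c s \<omega> = (\<Sum>t. of_nat (?f t))"
    by (simp add: run_time_def case_prod_beta)
  also have "\<dots> = (\<Sum>t<k. of_nat (?f t))"
    by (rule suminf_finite) (use run_after_exec[OF assms(1)] in auto)
  also have "\<dots> = of_nat (\<Sum>t<k. ?f t)" by simp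
  also have "\<dots> \<le> of_nat (k * poly (step_poly c) w)"
    using sum_bounded_above[of "{..<k}" ?f] step_cost_run_le[OF assms(2-4)]
    by (intro of_nat_mono) simp
  finally show ?thesis .
qed

text \<open>At most \<open>card X * (a + 1)\<close> cells are nonzero, each with at most
  \<open>a + 1\<close> digits for the address and \<open>w + 1\<close> for the content.\<close>

lemma store_size_le:
  assumes "bounded_by B s" "\<And>x i. B x i \<le> 2 ^ w" "finite X"
    and "\<And>x i. B x i \<noteq> 0 \<Longrightarrow> x \<in> X \<and> i \<le> a"
  shows "store_size s \<le> card X * (a + 1) * (a + w + 2)"
proof -
  have sub: "support s \<subseteq> X \<times> {..a}"
  proof
    fix z assume "z \<in> support s"
    then obtain x i where z: "z = (x, i)" "s x i \<noteq> 0" by (auto simp: support_def)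
    then have "B x i \<noteq> 0" using assms(1) by (metis bounded_by_def le_zero_eq)
    then show "z \<in> X \<times> {..a}" using assms(4) z by simp
  qed
  then have fin: "finite (support s)" using assms(3) by (auto intro: finite_subset)
  have "store_size s \<le> card (support s) * (a + w + 2)"
    unfolding store_size_def
  proof (rule order_trans[OF sum_bounded_above[where K = "a + w + 2"]])
    fix z assume "z \<in> support s"
    then obtain x i where z: "z = (x, i)" "i \<le> a" using sub by auto
    have "i < 2 ^ i" by (rule less_exp)
    also have "(2::nat) ^ i \<le> 2 ^ (a + 1)" using z(2) by (intro power_increasing) auto
    finally have "i < 2 ^ (a + 1)" .
    then have "bits i \<le> a + 1" by (rule bits_le) simp
    moreover have "s x i \<le> 2 ^ w"
      using assms(1) assms(2)[of x i] by (auto simp: bounded_by_def intro: order_trans)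
    then have "s x i < 2 ^ (w + 1)" by (simp add: le_less_trans)
    then have "bits (s x i) \<le> w + 1" by (rule bits_le) simp
    ultimately show "(case z of (x, i) \<Rightarrow> bits i + bits (s x i)) \<le> a + w + 2"
      by (simp add: z)
  qed simp
  also have "\<dots> \<le> card X * (a + 1) * (a + w + 2)"
    using card_mono[OF _ sub] assms(3) by (intro mult_right_mono) (simp_all add: card_cartesian_product)
  finally show ?thesis .
qed

section \<open>Gaussian elimination over GF(2)\<close>

definition sat :: "nat \<Rightarrow> nat \<Rightarrow> (nat \<Rightarrow> nat \<Rightarrow> bit) \<Rightarrow> (nat \<Rightarrow> bit) \<Rightarrow> (nat \<Rightarrow> bit) \<Rightarrow> bool" where
  "sat m n R b x \<longleftrightarrow> (\<forall>r<m. (\<Sum>w<n. R r w * x w) = b r)"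

lemma sat_cong:
  assumes "\<And>r w. r < m \<Longrightarrow> w < n \<Longrightarrow> R r w = R' r w" "\<And>r. r < m \<Longrightarrow> b r = b' r" "\<And>w. w < n \<Longrightarrow> x w = x' w"
  shows "sat m n R b x \<longleftrightarrow> sat m n R' b' x'"
  unfolding sat_def using assms by (auto intro!: all_cong arg_cong2[where f = "(=)"] sum.cong)

text \<open>
  \<open>V j\<close> is 0 for a column without pivot and otherwise one more than the index of its pivot row,
  and \<open>U\<close> is the set of pivot rows.
\<close>

definition row_reduced :: "nat \<Rightarrow> nat \<Rightarrow> (nat \<Rightarrow> nat \<Rightarrow> bit) \<Rightarrow> (nat \<Rightarrow> bool) \<Rightarrow> (nat \<Rightarrow> nat) \<Rightarrow> bool" where
  "row_reduced m k R U V \<longleftrightarrow>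
     (\<forall>j<k. V j \<noteq> 0 \<longrightarrow> V j \<le> m \<and> U (V j - 1) \<and> (\<forall>r<m. R r j = of_bool (r = V j - 1))) \<and>
     (\<forall>i<k. \<forall>j<k. V i \<noteq> 0 \<and> V i = V j \<longrightarrow> i = j) \<and>
     (\<forall>r<m. \<not> U r \<longrightarrow> (\<forall>j<k. R r j = 0)) \<and>
     (\<forall>r<m. U r \<longrightarrow> (\<exists>j<k. V j = Suc r))"

lemma row_reducedI:
  assumes "\<And>j. j < k \<Longrightarrow> V j \<noteq> 0 \<Longrightarrow> V j \<le> m \<and> U (V j - 1) \<and> (\<forall>r<m. R r j = of_bool (r = V j - 1))"
    and "\<And>i j. i < k \<Longrightarrow> j < k \<Longrightarrow> V i \<noteq> 0 \<Longrightarrow> V i = V j \<Longrightarrow> i = j"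
    and "\<And>r j. r < m \<Longrightarrow> \<not> U r \<Longrightarrow> j < k \<Longrightarrow> R r j = 0"
    and "\<And>r. r < m \<Longrightarrow> U r \<Longrightarrow> \<exists>j<k. V j = Suc r"
  shows "row_reduced m k R U V"
  unfolding row_reduced_def using assms by blast

lemma
  assumes "row_reduced m k R U V"
  shows row_reduced_pivotD: "j < k \<Longrightarrow> V j \<noteq> 0 \<Longrightarrow> V j \<le> m"
      "j < k \<Longrightarrow> V j \<noteq> 0 \<Longrightarrow> U (V j - 1)"
      "j < k \<Longrightarrow> V j \<noteq> 0 \<Longrightarrow> r < m \<Longrightarrow> R r j = of_bool (r = V j - 1)"
    and row_reduced_inj: "i < k \<Longrightarrow> j < k \<Longrightarrow> V i \<noteq> 0 \<Longrightarrow> V i = V j \<Longrightarrow> i = j"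
    and row_reduced_unused: "r < m \<Longrightarrow> \<not> U r \<Longrightarrow> j < k \<Longrightarrow> R r j = 0"
    and row_reduced_used: "r < m \<Longrightarrow> U r \<Longrightarrow> \<exists>j<k. V j = Suc r"
  using assms unfolding row_reduced_def by blast+

lemma row_reduced_cong:
  assumes "row_reduced m k R U V" "\<And>r j. r < m \<Longrightarrow> j < k \<Longrightarrow> R' r j = R r j"
  shows "row_reduced m k R' U V"
  by (rule row_reducedI) (use row_reduced_pivotD[OF assms(1)] row_reduced_inj[OF assms(1)]
    row_reduced_unused[OF assms(1)] row_reduced_used[OF assms(1)] assms(2) in \<open>simp_all\<close>)

lemma row_reduced_0: "(\<And>r. r < m \<Longrightarrow> \<not> U r) \<Longrightarrow> row_reduced m 0 R U V"
  by (rule row_reducedI) auto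

lemma row_reduced_no_pivot:
  assumes red: "row_reduced m k R U V" and zero: "\<And>r. r < m \<Longrightarrow> \<not> U r \<Longrightarrow> R r k = 0"
  shows "row_reduced m (Suc k) R U (V(k := 0))"
proof (rule row_reducedI)
  fix j assume "j < Suc k" "(V(k := 0)) j \<noteq> 0"
  then have "j < k" "V j \<noteq> 0" "(V(k := 0)) j = V j" by (auto simp: less_Suc_eq split: if_splits)
  then show "(V(k := 0)) j \<le> m \<and> U ((V(k := 0)) j - 1) \<and> (\<forall>r<m. R r j = of_bool (r = (V(k := 0)) j - 1))"
    using row_reduced_pivotD[OF red] by simp
next
  fix i j assume ij: "i < Suc k" "j < Suc k" "(V(k := 0)) i \<noteq> 0" "(V(k := 0)) i = (V(k := 0)) j"
  have "i \<noteq> k" using ij(3) by auto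
  moreover have "j \<noteq> k" using ij(3,4) by auto
  ultimately show "i = j" using ij row_reduced_inj[OF red, of i j] by simp
next
  fix r j assume "r < m" "\<not> U r" "j < Suc k"
  then show "R r j = 0" using zero row_reduced_unused[OF red] by (auto simp: less_Suc_eq)
next
  fix r assume "r < m" "U r"
  then obtain j where "j < k" "V j = Suc r" using row_reduced_used[OF red] by blast
  then show "\<exists>j<Suc k. (V(k := 0)) j = Suc r" by (intro exI[of _ j]) auto
qed

text \<open>One step serves both a column of the matrix and the right-hand side, each given as a
  family \<open>M\<close> over the rows.\<close>

definition add_row :: "nat \<Rightarrow> nat \<Rightarrow> (nat \<Rightarrow> nat \<Rightarrow> bit) \<Rightarrow> (nat \<Rightarrow> 'a::plus) \<Rightarrow> nat \<Rightarrow> 'a" where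
  "add_row p k R M r = (if r \<noteq> p \<and> R r k = 1 then M r + M p else M r)"

text \<open>Row \<open>p\<close> itself stays as it is, so its equation can be cancelled again from
  every row it was added to.\<close>

lemma sat_add_row:
  assumes "p < m"
  shows "sat m n (\<lambda>r w. add_row p k R (\<lambda>r. R r w) r) (add_row p k R b) x \<longleftrightarrow> sat m n R b x"
proof
  assume R: "sat m n R b x"
  show "sat m n (\<lambda>r w. add_row p k R (\<lambda>r. R r w) r) (add_row p k R b) x"
    unfolding sat_def
  proof (intro allI impI)
    fix r assume "r < m"
    then have "(\<Sum>w<n. R r w * x w) = b r" "(\<Sum>w<n. R p w * x w) = b p"
      using R assms unfolding sat_def by blast+
    then show "(\<Sum>w<n. add_row p k R (\<lambda>r. R r w) r * x w) = add_row p k R b r"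
      by (simp add: add_row_def distrib_right sum.distrib)
  qed
next
  assume S: "sat m n (\<lambda>r w. add_row p k R (\<lambda>r. R r w) r) (add_row p k R b) x"
  have p: "(\<Sum>w<n. R p w * x w) = b p"
    using S assms by (auto simp: sat_def add_row_def)
  show "sat m n R b x"
    unfolding sat_def
  proof (intro allI impI)
    fix r assume r: "r < m"
    show "(\<Sum>w<n. R r w * x w) = b r"
    proof (cases "r \<noteq> p \<and> R r k = 1")
      case True
      have "(\<Sum>w<n. add_row p k R (\<lambda>r. R r w) r * x w) = add_row p k R b r"
        using S r by (simp add: sat_def)
      then have "(\<Sum>w<n. R r w * x w) + (\<Sum>w<n. R p w * x w) = b r + b p"
        using True by (simp add: add_row_def distrib_right sum.distrib)
      then show ?thesis unfolding p by (rule add_right_imp_eq)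
    next
      case False
      then have eq: "add_row p k R f r = f r" for f :: "nat \<Rightarrow> bit" by (auto simp: add_row_def)
      have "(\<Sum>w<n. add_row p k R (\<lambda>r. R r w) r * x w) = add_row p k R b r"
        using S r unfolding sat_def by blast
      then show ?thesis unfolding eq .
    qed
  qed
qed

text \<open>A row not yet used is zero in all earlier columns, so adding it to other rows disturbs
  none of them.\<close>

lemma row_reduced_pivot:
  assumes red: "row_reduced m k R U V" and p: "p < m" "\<not> U p" "R p k = 1"
  shows "row_reduced m (Suc k) (\<lambda>r w. add_row p k R (\<lambda>r. R r w) r) (U(p := True)) (V(k := Suc p))"
proof -
  let ?R = "\<lambda>r w. add_row p k R (\<lambda>r. R r w) r"
  let ?V = "V(k := Suc p)" and ?U = "U(p := True)"
  have Rp: "R p j = 0" if "j < k" for j using row_reduced_unused[OF red p(1,2) that] .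
  have R_old: "?R r j = R r j" if "j < k" for r j
    using Rp that by (simp add: add_row_def)
  have R_k: "?R r k = of_bool (r = p)" for r
    using p(3) by (cases "R r k") (auto simp: add_row_def)
  have V_ne: "V j \<noteq> Suc p" if "j < k" for j
    using row_reduced_pivotD(2)[OF red that] p(2) by auto
  show ?thesis
  proof (rule row_reducedI)
    fix j assume j: "j < Suc k" "?V j \<noteq> 0"
    show "?V j \<le> m \<and> ?U (?V j - 1) \<and> (\<forall>r<m. ?R r j = of_bool (r = ?V j - 1))"
    proof (cases "j = k")
      case True
      then show ?thesis using p R_k by simp
    next
      case False
      then have "j < k" using j by simp
      then show ?thesis using row_reduced_pivotD[OF red, of j] R_old j(2) False by simp
    qed
  next
    fix i j assume ij: "i < Suc k" "j < Suc k" "?V i \<noteq> 0" "?V i = ?V j"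
    show "i = j"
    proof (cases "i = k \<or> j = k")
      case True
      then show ?thesis using ij V_ne[of i] V_ne[of j] by (cases "i = k"; cases "j = k") simp_all
    next
      case False
      then show ?thesis using ij row_reduced_inj[OF red, of i j] by simp
    qed
  next
    fix r j assume rj: "r < m" "\<not> ?U r" "j < Suc k"
    then have "r \<noteq> p" "\<not> U r" by (auto split: if_splits)
    then show "?R r j = 0"
      using rj R_old R_k row_reduced_unused[OF red] by (cases "j = k") (simp_all add: less_Suc_eq)
  next
    fix r assume r: "r < m" "?U r"
    show "\<exists>j<Suc k. ?V j = Suc r"
    proof (cases "r = p")
      case False
      then obtain j where "j < k" "V j = Suc r" using r row_reduced_used[OF red] by auto
      then show ?thesis by (intro exI[of _ j]) auto
    qed auto
  qed
qed

text \<open>Free columns take their value from \<open>y\<close>; the pivot row then yields the value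
  of its pivot column. The factor \<open>of_bool (V w = 0)\<close> hides the entries of
  \<open>y\<close> at pivot columns.\<close>

definition solution :: "nat \<Rightarrow> (nat \<Rightarrow> nat \<Rightarrow> bit) \<Rightarrow> (nat \<Rightarrow> bit) \<Rightarrow> (nat \<Rightarrow> nat) \<Rightarrow> (nat \<Rightarrow> bit) \<Rightarrow> nat \<Rightarrow> bit" where
  "solution n R b V y j = (if V j = 0 then y j else b (V j - 1) + (\<Sum>w<n. R (V j - 1) w * (of_bool (V w = 0) * y w)))"

text \<open>In a pivot row all other pivot columns are zero, so the equation expresses the pivot
  variable by the free ones. A row without pivot is entirely zero and only demands
  \<open>b r = 0\<close>.\<close>

lemma sat_row_reduced_iff:
  assumes red: "row_reduced m n R U V"
  shows "sat m n R b x \<longleftrightarrow> (\<forall>r<m. \<not> U r \<longrightarrow> b r = 0) \<and> (\<forall>j<n. x j = solution n R b V x j)"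
proof -
  have row0: "(\<Sum>w<n. R r w * x w) = 0" if "r < m" "\<not> U r" for r
    using row_reduced_unused[OF red that] by (intro sum.neutral) auto
  have row: "(\<Sum>w<n. R (V j - 1) w * x w) = x j + (\<Sum>w<n. R (V j - 1) w * (of_bool (V w = 0) * x w))"
    if j: "j < n" "V j \<noteq> 0" for j
  proof -
    have Vj: "V j - 1 < m" using row_reduced_pivotD(1)[OF red j] j by linarith
    have "R (V j - 1) w * x w = (if w = j then x j else 0) + R (V j - 1) w * (of_bool (V w = 0) * x w)"
      if w: "w < n" for w
    proof (cases "V w = 0")
      case True
      then show ?thesis using j by auto
    next
      case False
      have "R (V j - 1) w = of_bool (V j - 1 = V w - 1)"
        using row_reduced_pivotD(3)[OF red w False Vj] .
      also have "V j - 1 = V w - 1 \<longleftrightarrow> V w = V j" using False j(2) by arith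
      also have "V w = V j \<longleftrightarrow> w = j"
        using row_reduced_inj[OF red w j(1) False] by auto
      finally show ?thesis using False by auto
    qed
    then have "(\<Sum>w<n. R (V j - 1) w * x w) =
      (\<Sum>w<n. (if w = j then x j else 0) + R (V j - 1) w * (of_bool (V w = 0) * x w))"
      by (intro sum.cong) auto
    then show ?thesis using j(1) by (simp only: sum.distrib sum.delta' sum.delta finite_lessThan lessThan_iff if_True)
  qed
  have bit_eq: "a + c = d \<longleftrightarrow> a = d + c" for a c d :: bit by (cases a; cases c; cases d) auto
  show ?thesis
  proof
    assume S: "sat m n R b x"
    have "b r = 0" if "r < m" "\<not> U r" for r using S row0 that by (simp add: sat_def)
    moreover have "x j = solution n R b V x j" if "j < n" for j
    proof (cases "V j = 0")
      case False
      have "V j - 1 < m" using row_reduced_pivotD(1)[OF red that False] False by linarith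
      then have "x j + (\<Sum>w<n. R (V j - 1) w * (of_bool (V w = 0) * x w)) = b (V j - 1)"
        using S row[OF that False] by (simp only: sat_def)
      then show ?thesis using False unfolding solution_def bit_eq by (simp only: if_False)
    qed (simp add: solution_def)
    ultimately show "(\<forall>r<m. \<not> U r \<longrightarrow> b r = 0) \<and> (\<forall>j<n. x j = solution n R b V x j)" by blast
  next
    assume S: "(\<forall>r<m. \<not> U r \<longrightarrow> b r = 0) \<and> (\<forall>j<n. x j = solution n R b V x j)"
    show "sat m n R b x"
      unfolding sat_def
    proof (intro allI impI)
      fix r assume r: "r < m"
      show "(\<Sum>w<n. R r w * x w) = b r"
      proof (cases "U r")
        case True
        then obtain j where j: "j < n" "V j = Suc r" using row_reduced_used[OF red r] by blast
        have "x j = b (V j - 1) + (\<Sum>w<n. R (V j - 1) w * (of_bool (V w = 0) * x w))"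
          using S j unfolding solution_def by (metis nat.distinct(1))
        then have "x j + (\<Sum>w<n. R (V j - 1) w * (of_bool (V w = 0) * x w)) = b (V j - 1)"
          unfolding bit_eq .
        then show ?thesis using row[OF j(1)] j(2) by (simp only: diff_Suc_1 nat.distinct not_False_eq_True)
      next
        case False
        then show ?thesis using S r row0 by simp
      qed
    qed
  qed
qed

lemma sat_solution:
  assumes red: "row_reduced m n R U V" and cons: "\<And>r. r < m \<Longrightarrow> \<not> U r \<Longrightarrow> b r = 0"
  shows "sat m n R b (solution n R b V y)"
proof -
  have "(\<Sum>w<n. R r w * (of_bool (V w = 0) * solution n R b V y w)) =
      (\<Sum>w<n. R r w * (of_bool (V w = 0) * y w))" for r
    by (intro sum.cong refl) (auto simp: solution_def)
  then show ?thesis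
    unfolding sat_row_reduced_iff[OF red] using cons by (auto simp: solution_def[of n R b V])
qed

abbreviation ind :: "nat set \<Rightarrow> nat \<Rightarrow> bit" where
  "ind T \<equiv> \<lambda>v. of_bool (v \<in> T)"

text \<open>A solution is determined by its free part, and every free part extends to one. This
  gives direct access to the solution with a given number, hence the enumeration.\<close>

lemma bij_betw_solution:
  assumes red: "row_reduced m n R U V" and cons: "\<And>r. r < m \<Longrightarrow> \<not> U r \<Longrightarrow> b r = 0"
  shows "bij_betw (\<lambda>Y. {j. j < n \<and> solution n R b V (ind Y) j = 1}) (Pow {j. j < n \<and> V j = 0})
    {X \<in> Pow {..<n}. sat m n R b (ind X)}"
proof (rule bij_betwI[where g = "\<lambda>X. {j \<in> X. V j = 0}"])
  let ?f = "\<lambda>Y. {j. j < n \<and> solution n R b V (ind Y) j = 1}"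
  have f: "ind (?f Y) j = solution n R b V (ind Y) j" if "j < n" for j Y
    using that by (cases "solution n R b V (ind Y) j") auto
  show "?f \<in> Pow {j. j < n \<and> V j = 0} \<rightarrow> {X \<in> Pow {..<n}. sat m n R b (ind X)}"
  proof
    fix Y
    have "sat m n R b (solution n R b V (ind Y))" using red cons by (rule sat_solution)
    then have "sat m n R b (ind (?f Y))" using f by (subst sat_cong) auto
    then show "?f Y \<in> {X \<in> Pow {..<n}. sat m n R b (ind X)}" by auto
  qed
  show "(\<lambda>X. {j \<in> X. V j = 0}) \<in> {X \<in> Pow {..<n}. sat m n R b (ind X)} \<rightarrow> Pow {j. j < n \<and> V j = 0}"
    by auto
  show "{j \<in> ?f Y. V j = 0} = Y" if "Y \<in> Pow {j. j < n \<and> V j = 0}" for Y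
    using that by (auto simp: solution_def)
  show "?f {j \<in> X. V j = 0} = X" if "X \<in> {X \<in> Pow {..<n}. sat m n R b (ind X)}" for X
  proof -
    have X: "X \<subseteq> {..<n}" "\<forall>j<n. ind X j = solution n R b V (ind X) j"
      using that unfolding sat_row_reduced_iff[OF red] by auto
    have "(\<Sum>w<n. R r w * (of_bool (V w = 0) * ind X w)) =
        (\<Sum>w<n. R r w * (of_bool (V w = 0) * ind {j \<in> X. V j = 0} w))" for r
      by (intro sum.cong refl) auto
    then have "solution n R b V (ind {j \<in> X. V j = 0}) j = solution n R b V (ind X) j" for j
      by (simp add: solution_def)
    then have "?f {j \<in> X. V j = 0} = {j. j < n \<and> ind X j = 1}" using X(2) by auto
    then show ?thesis using X(1) by auto
  qed
qed

lemma card_solutions: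
  assumes red: "row_reduced m n R U V"
  shows "card {X \<in> Pow {..<n}. sat m n R b (ind X)} =
     (if \<forall>r<m. \<not> U r \<longrightarrow> b r = 0 then 2 ^ card {j. j < n \<and> V j = 0} else 0)"
proof (cases "\<forall>r<m. \<not> U r \<longrightarrow> b r = 0")
  case True
  then show ?thesis
    using bij_betw_same_card[OF bij_betw_solution[OF red, of b]] by (simp add: card_Pow)
next
  case False
  then have "\<not> sat m n R b (ind X)" for X unfolding sat_row_reduced_iff[OF red] by blast
  then show ?thesis using False by simp
qed

text \<open>The determinant is 1 iff the kernel is trivial iff no column is free; a free column
  yields a kernel vector with value 1 there. The reduced system only has to have the same solutions
  as \<open>M\<close>, so its number of rows may differ from \<open>n\<close>.\<close>

lemma perm_sum_row_reduced:
  assumes red: "row_reduced m n R U V" and eq: "\<And>x. sat m n R (\<lambda>_. 0) x \<longleftrightarrow> sat n n M (\<lambda>_. 0) x"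
  shows "perm_sum n M = of_bool (\<forall>j<n. V j \<noteq> 0)"
proof -
  have "perm_sum n M = 0 \<longleftrightarrow> (\<exists>x. (\<exists>w<n. x w \<noteq> 0) \<and> sat m n R (\<lambda>_. 0) x)"
    unfolding perm_sum_eq_0_iff eq by (simp add: sat_def)
  also have "\<dots> \<longleftrightarrow> (\<exists>j<n. V j = 0)"
  proof
    assume "\<exists>x. (\<exists>w<n. x w \<noteq> 0) \<and> sat m n R (\<lambda>_. 0) x"
    then obtain x w where x: "w < n" "x w \<noteq> 0" "\<And>j. j < n \<Longrightarrow> x j = solution n R (\<lambda>_. 0) V x j"
      unfolding sat_row_reduced_iff[OF red] by blast
    show "\<exists>j<n. V j = 0"
    proof (rule ccontr)
      assume "\<not> (\<exists>j<n. V j = 0)"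
      then have "solution n R (\<lambda>_. 0) V x w = 0"
        using x(1) by (auto simp: solution_def intro!: sum.neutral)
      then show False using x by metis
    qed
  next
    assume "\<exists>j<n. V j = 0"
    then obtain j where j: "j < n" "V j = 0" by blast
    then have "solution n R (\<lambda>_. 0) V (\<lambda>_. 1) j = 1" by (simp add: solution_def)
    moreover have "sat m n R (\<lambda>_. 0) (solution n R (\<lambda>_. 0) V (\<lambda>_. 1))"
      using sat_solution[OF red, of "\<lambda>_. 0"] by simp
    ultimately show "\<exists>x. (\<exists>w<n. x w \<noteq> 0) \<and> sat m n R (\<lambda>_. 0) x"
      using j(1) by (intro exI[of _ "solution n R (\<lambda>_. 0) V (\<lambda>_. 1)"]) auto
  qed
  finally show ?thesis by (cases "perm_sum n M") auto
qed

section \<open>Subsets as binary counters\<close>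

definition count_below :: "(nat \<Rightarrow> bool) \<Rightarrow> nat \<Rightarrow> nat" where
  "count_below P v = card {u. u < v \<and> P u}"

lemma count_below_Suc: "count_below P (Suc v) = count_below P v + of_bool (P v)"
proof -
  have "{u. u < Suc v \<and> P u} = {u. u < v \<and> P u} \<union> (if P v then {v} else {})"
    by (auto simp: less_Suc_eq)
  then show ?thesis by (simp add: count_below_def)
qed

lemma count_below_0 [simp]: "count_below P 0 = 0"
  by (simp add: count_below_def)

lemma count_below_less: "P v \<Longrightarrow> v < n \<Longrightarrow> count_below P v < count_below P n"
  unfolding count_below_def by (rule psubset_card_mono) auto

lemma bij_betw_count_below: "bij_betw (count_below P) {v. v < n \<and> P v} {..<count_below P n}"
proof -
  have "inj_on (count_below P) {v. v < n \<and> P v}"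
  proof (rule inj_onI)
    fix u v assume "u \<in> {v. v < n \<and> P v}" "v \<in> {v. v < n \<and> P v}" "count_below P u = count_below P v"
    then show "u = v" using count_below_less[of P u v] count_below_less[of P v u] by (metis less_irrefl linorder_neqE_nat mem_Collect_eq)
  qed
  moreover have "count_below P ` {v. v < n \<and> P v} \<subseteq> {..<count_below P n}" using count_below_less by auto
  moreover have "card {v. v < n \<and> P v} = count_below P n" by (simp add: count_below_def)
  ultimately show ?thesis
    unfolding bij_betw_def using card_image[of "count_below P" "{v. v < n \<and> P v}"]
    by (intro conjI card_subset_eq) simp_all
qed

text \<open>\<open>count_below P v\<close> is the rank of \<open>v\<close> among the elements with
  \<open>P\<close> and serves as the position of its bit in \<open>c\<close>. Injectivity is
  equality of binary digits; surjectivity follows by counting.\<close>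

lemma bij_betw_decode:
  "bij_betw (\<lambda>c :: nat. {v. v < n \<and> P v \<and> odd (c div 2 ^ count_below P v)}) {..<2 ^ count_below P n} (Pow {v. v < n \<and> P v})"
proof -
  let ?d = "\<lambda>c. {v. v < n \<and> P v \<and> odd (c div 2 ^ count_below P v)}" and ?S = "{..<(2::nat) ^ count_below P n}"
  have "inj_on ?d ?S"
  proof (rule inj_onI)
    fix c c' assume c: "c \<in> ?S" "c' \<in> ?S" and eq: "?d c = ?d c'"
    have "bit c r \<longleftrightarrow> bit c' r" for r
    proof (cases "r < count_below P n")
      case True
      then have "r \<in> count_below P ` {v. v < n \<and> P v}"
        using bij_betw_count_below[of P n] by (simp add: bij_betw_def)
      then obtain v where v: "v < n" "P v" "count_below P v = r" by blast
      then have "v \<in> ?d c \<longleftrightarrow> v \<in> ?d c'" using eq by simp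
      then show ?thesis using v by (simp add: bit_iff_odd)
    next
      case False
      have "a div 2 ^ r = 0" if "a < 2 ^ count_below P n" for a :: nat
        using that False by (intro div_less order_less_le_trans[OF that] power_increasing) auto
      then show ?thesis using c by (simp add: bit_iff_odd)
    qed
    then show "c = c'" by (rule bit_eqI)
  qed
  then have "card (?d ` ?S) = card ?S" by (rule card_image)
  also have "\<dots> = card (Pow {v. v < n \<and> P v})" by (simp add: card_Pow count_below_def)
  finally have "?d ` ?S = Pow {v. v < n \<and> P v}" by (intro card_subset_eq) auto
  with \<open>inj_on ?d ?S\<close> show ?thesis by (rule bij_betw_imageI)
qed

section \<open>The program and its bounds\<close>

text \<open>Expressions offer no remainder, negation or equality; truncated subtraction and division
  supply them, with truth values 0 and 1.\<close>

definition mod2 :: "aexp \<Rightarrow> aexp" where "mod2 a = Minus a (Times (N 2) (Div a (N 2)))"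
definition neg :: "aexp \<Rightarrow> aexp" where "neg a = Minus (N 1) a"
definition eqe :: "aexp \<Rightarrow> aexp \<Rightarrow> aexp" where "eqe a b = Minus (N 1) (Plus (Minus a b) (Minus b a))"
definition idx :: "aexp \<Rightarrow> aexp \<Rightarrow> aexp" where "idx a b = Plus (Times a (var ''n'')) b"

lemma aval_mod2 [simp]: "aval (mod2 a) s = aval a s mod 2"
  by (simp only: mod2_def aval.simps minus_mult_div_eq_mod)

lemma aval_neg [simp]: "aval (neg a) s = of_bool (aval a s = 0)"
  by (simp add: neg_def)

lemma aval_eqe [simp]: "aval (eqe a b) s = of_bool (aval a s = aval b s)"
  by (auto simp: eqe_def)

lemma aval_idx [simp]: "aval (idx a b) s = aval a s * s ''n'' 0 + aval b s"
  by (simp add: idx_def)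

text \<open>
  The memory \<open>t\<close> holds the part of the vector in the first colour class, \<open>h r\<close> the diagonal entry
  of row \<open>r\<close> for it. Row \<open>r\<close> of the system fixes entry \<open>r\<close> of the solution: to \<open>t r\<close> in the first
  class, and to 1 in the second class if \<open>h r = 0\<close> (otherwise the row is zero). Row \<open>n + r\<close> says that
  the diagonal entry is 1 if \<open>r\<close> is in the first class and \<open>t r = 0\<close>.
\<close>

definition dot :: "string \<Rightarrow> prog" where
  "dot z = PFor ''r'' ''n'' (
     PAssign ''s'' (N 0) (Cell ''g'' (var ''r'')) ;;
     PFor ''w'' ''n''
       (PAssign ''s'' (N 0) (mod2 (Plus (var ''s'')
          (Times (Cell ''adj'' (idx (var ''r'') (var ''w''))) (Cell z (var ''w'')))))) ;;
     PAssign ''h'' (var ''r'') (var ''s''))"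

definition build_system :: prog where
  "build_system = dot ''t'' ;;
     PFor ''r'' ''n'' (
       PFor ''w'' ''n'' (
         PAssign ''R'' (idx (var ''r'') (var ''w'')) (Times (eqe (var ''r'') (var ''w''))
           (neg (Times (neg (mod2 (Cell ''col'' (var ''r'')))) (Cell ''h'' (var ''r''))))) ;;
         PAssign ''R'' (idx (Plus (var ''n'') (var ''r'')) (var ''w''))
           (Times (Cell ''adj'' (idx (var ''r'') (var ''w'')))
             (Times (mod2 (Cell ''col'' (var ''r''))) (neg (Cell ''t'' (var ''r'')))))) ;;
       PAssign ''b'' (var ''r'') (Plus (Times (mod2 (Cell ''col'' (var ''r''))) (Cell ''t'' (var ''r'')))
           (Times (neg (mod2 (Cell ''col'' (var ''r'')))) (neg (Cell ''h'' (var ''r''))))) ;;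
       PAssign ''b'' (Plus (var ''n'') (var ''r'')) (Times (mod2 (Cell ''col'' (var ''r'')))
           (Times (neg (Cell ''t'' (var ''r''))) (neg (Cell ''g'' (var ''r''))))))"

text \<open>The \<open>n\<close> lower rows are zero. They pad the matrix to the 2n rows of the
  other system, so that \<open>eliminate\<close> serves both. The double negation of
  \<open>w\<close> tests that the column is not 0.\<close>

definition build_laplacian :: prog where
  "build_laplacian = dot ''x'' ;;
     PFor ''r'' ''n'' (
       PFor ''w'' ''n'' (
         PAssign ''R'' (idx (var ''r'') (var ''w'')) (mod2 (Plus
           (Times (Times (Cell ''adj'' (idx (var ''r'') (var ''w''))) (Cell ''x'' (var ''w'')))
             (Times (neg (eqe (var ''r'') (var ''w''))) (neg (neg (var ''w'')))))
           (Times (eqe (var ''r'') (var ''w'')) (Cell ''h'' (var ''r''))))) ;;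
         PAssign ''R'' (idx (Plus (var ''n'') (var ''r'')) (var ''w'')) (N 0)) ;;
       PAssign ''b'' (var ''r'') (N 0) ;;
       PAssign ''b'' (Plus (var ''n'') (var ''r'')) (N 0))"

text \<open>\<open>p\<close> holds the row plus one, with 0 for no pivot. A loop cannot be left
  early; the factor \<open>neg (var ''p'')\<close> keeps the first hit instead.\<close>

definition find_pivot :: prog where
  "find_pivot = PAssign ''p'' (N 0) (N 0) ;;
     PFor ''r'' ''m'' (
       PIf (Times (Cell ''R'' (idx (var ''r'') (var ''j''))) (Times (neg (Cell ''U'' (var ''r''))) (neg (var ''p''))))
         (PAssign ''p'' (N 0) (Plus (var ''r'') (N 1))) PSkip)"

definition pivot_row :: aexp where "pivot_row = Minus (var ''p'') (N 1)"

definition clear_column :: prog where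
  "clear_column = PFor ''r'' ''m'' (
     PIf (Times (Cell ''R'' (idx (var ''r'') (var ''j''))) (neg (eqe (var ''r'') pivot_row)))
       (PFor ''w'' ''n'' (PAssign ''R'' (idx (var ''r'') (var ''w''))
          (mod2 (Plus (Cell ''R'' (idx (var ''r'') (var ''w''))) (Cell ''R'' (idx pivot_row (var ''w'')))))) ;;
        PAssign ''b'' (var ''r'') (mod2 (Plus (Cell ''b'' (var ''r'')) (Cell ''b'' pivot_row))))
       PSkip)"

definition eliminate :: prog where
  "eliminate = PFor ''r'' ''m'' (PAssign ''U'' (var ''r'') (N 0)) ;;
     PFor ''j'' ''n'' (
       find_pivot ;;
       PAssign ''V'' (var ''j'') (var ''p'') ;;
       PIf (var ''p'') (PAssign ''U'' pivot_row (N 1) ;; clear_column) PSkip)"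

text \<open>\<open>Q\<close> doubles after each free column, so its last cell counts the free parts
  and cell \<open>j\<close> is the divisor that extracts the bit of column \<open>j\<close> from a
  counter. The second loop sets the count to 0 if a row without pivot has right-hand side 1.\<close>

definition count_solutions :: prog where
  "count_solutions = PAssign ''Q'' (N 0) (N 1) ;;
     PFor ''j'' ''n'' (PAssign ''Q'' (Plus (var ''j'') (N 1))
       (Times (Cell ''Q'' (var ''j'')) (Plus (N 1) (neg (Cell ''V'' (var ''j'')))))) ;;
     PAssign ''q'' (N 0) (Cell ''Q'' (var ''n'')) ;;
     PFor ''r'' ''m'' (PAssign ''q'' (N 0) (Times (var ''q'')
       (neg (Times (neg (Cell ''U'' (var ''r''))) (Cell ''b'' (var ''r''))))))"

text \<open>The eliminations of the Laplacians overwrite the reduced system while its solutions are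
  still being enumerated, hence the copy.\<close>

definition save_system :: prog where
  "save_system =
     PFor ''r'' ''m'' (
       PFor ''w'' ''n'' (PAssign ''R2'' (idx (var ''r'') (var ''w'')) (Cell ''R'' (idx (var ''r'') (var ''w'')))) ;;
       PAssign ''b2'' (var ''r'') (Cell ''b'' (var ''r''))) ;;
     PFor ''j'' ''n'' (PAssign ''V2'' (var ''j'') (Cell ''V'' (var ''j'')))"

definition row2 :: aexp where "row2 = Minus (Cell ''V2'' (var ''j'')) (N 1)"

definition compute_solution :: prog where
  "compute_solution =
     PFor ''j'' ''n'' (PAssign ''y'' (var ''j'')
       (Times (mod2 (Div (var ''e'') (Cell ''Q'' (var ''j'')))) (neg (Cell ''V2'' (var ''j''))))) ;;
     PFor ''j'' ''n'' (
       PIf (Cell ''V2'' (var ''j''))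
         (PAssign ''s'' (N 0) (Cell ''b2'' row2) ;;
          PFor ''w'' ''n'' (PAssign ''s'' (N 0) (mod2 (Plus (var ''s'')
            (Times (Cell ''R2'' (idx row2 (var ''w''))) (Cell ''y'' (var ''w'')))))) ;;
          PAssign ''x'' (var ''j'') (var ''s''))
         (PAssign ''x'' (var ''j'') (Cell ''y'' (var ''j''))))"

definition add_determinant :: prog where
  "add_determinant = PAssign ''d'' (N 0) (N 1) ;;
     PFor ''j'' ''n'' (PAssign ''d'' (N 0) (Times (var ''d'') (neg (neg (Cell ''V'' (var ''j'')))))) ;;
     PAssign ''out'' (N 0) (mod2 (Plus (var ''out'') (var ''d'')))"

definition process_solution :: prog where
  "process_solution = compute_solution ;; build_laplacian ;; eliminate ;; add_determinant"

definition decode_assignment :: prog where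
  "decode_assignment = PFor ''v'' ''n'' (PAssign ''t'' (var ''v'')
     (Times (mod2 (Div (var ''c'') (Cell ''P'' (var ''v'')))) (mod2 (Cell ''col'' (var ''v'')))))"

definition solve_system :: prog where
  "solve_system = decode_assignment ;; build_system ;; eliminate ;; count_solutions ;; save_system"

text \<open>Colours 1 and 2 are exchanged by subtraction from 3, and 0 marks a vertex not reached.
  Colours travel along arcs from vertex 0; \<open>n\<close> rounds reach every vertex if there is a
  Hamiltonian cycle.\<close>

definition colour :: prog where
  "colour = PAssign ''col'' (N 0) (N 1) ;;
     PFor ''k'' ''n'' (PFor ''u'' ''n'' (PFor ''v'' ''n'' (
       PIf (Times (Cell ''adj'' (idx (var ''u'') (var ''v''))) (Cell ''col'' (var ''u'')))
         (PAssign ''col'' (var ''v'') (Minus (N 3) (Cell ''col'' (var ''u'')))) PSkip)))"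

text \<open>Among the colours 0, 1, 2 the remainder modulo 2 detects 1 and the quotient by 2 detects
  2. \<open>P\<close> provides the powers of two that later extract the bits of the counter
  \<open>c\<close>.\<close>

definition count_colours :: prog where
  "count_colours = PAssign ''P'' (N 0) (N 1) ;;
     PFor ''v'' ''n'' (
       PAssign ''P'' (Plus (var ''v'') (N 1))
         (Times (Cell ''P'' (var ''v'')) (Plus (N 1) (mod2 (Cell ''col'' (var ''v''))))) ;;
       PAssign ''c1'' (Plus (var ''v'') (N 1)) (Plus (Cell ''c1'' (var ''v'')) (mod2 (Cell ''col'' (var ''v'')))) ;;
       PAssign ''c2'' (Plus (var ''v'') (N 1)) (Plus (Cell ''c2'' (var ''v'')) (Div (Cell ''col'' (var ''v'')) (N 2))))"

text \<open>True also for the empty graph and if some vertex has kept colour 0. In each of these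
  cases a bipartite graph has no Hamiltonian cycle, and the output stays 0.\<close>

definition unbalanced :: aexp where
  "unbalanced = Plus (neg (var ''n'')) (Plus (neg (eqe (Cell ''c1'' (var ''n'')) (Cell ''c2'' (var ''n''))))
     (neg (eqe (Plus (Cell ''c1'' (var ''n'')) (Cell ''c2'' (var ''n''))) (var ''n''))))"

text \<open>\<open>out\<close>, the colours other than that of vertex 0 and the first cells of
  \<open>c1\<close> and \<open>c2\<close> are not initialised; they rely on these memories being 0
  in the input.\<close>

definition main_prog :: prog where
  "main_prog = PAssign ''m'' (N 0) (Plus (var ''n'') (var ''n'')) ;; colour ;; count_colours ;;
     PIf unbalanced PSkip (
       PAssign ''pw'' (N 0) (Cell ''P'' (var ''n'')) ;;
       PFor ''c'' ''pw'' (solve_system ;; PFor ''e'' ''q'' process_solution))"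

definition flips :: com where
  "flips = Seq (Assign ''i'' (N 0) (N 0)) (While (Minus (var ''n'') (var ''i''))
     (Seq (Flip ''g'' (var ''i'')) (Assign ''i'' (N 0) (incr ''i'' ''n''))))"

definition ham_alg :: com where
  "ham_alg = Seq flips (compile main_prog)"

lemmas prog_defs = dot_def build_system_def build_laplacian_def find_pivot_def pivot_row_def
  clear_column_def eliminate_def count_solutions_def save_system_def row2_def compute_solution_def
  add_determinant_def process_solution_def decode_assignment_def solve_system_def colour_def
  count_colours_def unbalanced_def main_prog_def

lemma wf_main_prog: "wf_prog main_prog"
  by (simp add: prog_defs)

text \<open>The matrices take 2n rows of \<open>n\<close> cells. The larger constant is due to
  \<open>safe\<close>, which knows the counters only by their bounds, so that \<open>n + r\<close>
  may be 3n there.\<close>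

definition amax :: "nat \<Rightarrow> nat" where "amax n = 4 * n * n + 4 * n + 4"

text \<open>
  The scan memories \<open>c1\<close>, \<open>c2\<close>, \<open>P\<close>, \<open>Q\<close> count by prefixes, so that their bounds depend on the address and
  not on the moment.
\<close>

definition val_bound :: "nat \<Rightarrow> string \<Rightarrow> nat \<Rightarrow> nat" where
  "val_bound n x i =
    (if x \<in> {''n'', ''i'', ''k'', ''u'', ''v'', ''w'', ''j''} then n
     else if x \<in> {''m'', ''r''} then 2 * n
     else if x \<in> {''p'', ''V'', ''V2''} then 2 * n + 1
     else if x \<in> {''adj'', ''g'', ''h'', ''s'', ''t'', ''R'', ''b'', ''U'', ''R2'', ''b2'', ''y'', ''x'', ''d'', ''out''} then 1
     else if x = ''col'' then 3
     else if x \<in> {''c1'', ''c2''} then i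
     else if x \<in> {''P'', ''Q''} then 2 ^ i
     else if x \<in> {''pw'', ''c'', ''q'', ''e''} then 2 ^ n
     else 0)"

definition bound :: "nat \<Rightarrow> string \<Rightarrow> nat \<Rightarrow> nat" where
  "bound n x i = (if i \<le> amax n then val_bound n x i else 0)"

lemma amax_idx: "a \<le> 4 * n \<Longrightarrow> k \<le> n \<Longrightarrow> b \<le> n \<Longrightarrow> a * k + b \<le> amax n"
  using mult_le_mono[of a "4 * n" k n] by (simp add: amax_def)

lemma bounded_byD:
  assumes "bounded_by (bound n) s"
  shows "s x i \<le> val_bound n x i"
proof -
  have "s x i \<le> bound n x i" using assms by (simp add: bounded_by_def)
  also have "\<dots> \<le> val_bound n x i" by (simp add: bound_def)
  finally show ?thesis .
qed

lemma val_bound_simps: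
  "val_bound n ''n'' i = n" "val_bound n ''i'' i = n" "val_bound n ''k'' i = n" "val_bound n ''u'' i = n"
  "val_bound n ''v'' i = n" "val_bound n ''w'' i = n" "val_bound n ''j'' i = n"
  "val_bound n ''m'' i = 2 * n" "val_bound n ''r'' i = 2 * n"
  "val_bound n ''p'' i = 2 * n + 1" "val_bound n ''V'' i = 2 * n + 1" "val_bound n ''V2'' i = 2 * n + 1"
  "val_bound n ''adj'' i = 1" "val_bound n ''g'' i = 1" "val_bound n ''h'' i = 1" "val_bound n ''s'' i = 1"
  "val_bound n ''t'' i = 1" "val_bound n ''R'' i = 1" "val_bound n ''b'' i = 1" "val_bound n ''U'' i = 1"
  "val_bound n ''R2'' i = 1" "val_bound n ''b2'' i = 1" "val_bound n ''y'' i = 1" "val_bound n ''x'' i = 1"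
  "val_bound n ''d'' i = 1" "val_bound n ''out'' i = 1" "val_bound n ''col'' i = 3"
  "val_bound n ''c1'' i = i" "val_bound n ''c2'' i = i" "val_bound n ''P'' i = 2 ^ i" "val_bound n ''Q'' i = 2 ^ i"
  "val_bound n ''pw'' i = 2 ^ n" "val_bound n ''c'' i = 2 ^ n" "val_bound n ''q'' i = 2 ^ n" "val_bound n ''e'' i = 2 ^ n"
  by (simp_all add: val_bound_def)

lemma safe_compile_Assign:
  assumes "\<And>s. bounded_by (bound n) s \<Longrightarrow> aval i s \<le> amax n \<and> aval a s \<le> val_bound n x (aval i s)"
  shows "safe (bound n) (compile (PAssign x i a))"
  using assms by (simp add: bound_def)

lemma safe_compile_For':
  assumes "val_bound n b 0 \<le> val_bound n x 0" "safe (bound n) (compile p)"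
  shows "safe (bound n) (compile (PFor x b p))"
  using assms by (intro safe_compile_For) (auto simp: bound_def)

lemma safe_compile_Seq: "safe B (compile p) \<Longrightarrow> safe B (compile q) \<Longrightarrow> safe B (compile (p ;; q))"
  by simp

lemma safe_compile_If: "safe B (compile p) \<Longrightarrow> safe B (compile q) \<Longrightarrow> safe B (compile (PIf a p q))"
  by simp

lemma safe_compile_Skip: "safe B (compile PSkip)"
  by simp

lemmas safe_intros = safe_compile_Skip safe_compile_Assign safe_compile_Seq safe_compile_If safe_compile_For'

lemma bounded_cells:
  assumes "bounded_by (bound n) s"
  shows "s ''n'' i \<le> n" "s ''u'' i \<le> n" "s ''v'' i \<le> n" "s ''w'' i \<le> n" "s ''j'' i \<le> n"
    "s ''r'' i \<le> 2 * n" "s ''p'' i \<le> 2 * n + 1" "s ''V2'' i \<le> 2 * n + 1"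
    "s ''adj'' i \<le> 1" "s ''g'' i \<le> 1" "s ''h'' i \<le> 1" "s ''t'' i \<le> 1" "s ''R'' i \<le> 1"
    "s ''b'' i \<le> 1" "s ''R2'' i \<le> 1" "s ''b2'' i \<le> 1" "s ''y'' i \<le> 1" "s ''x'' i \<le> 1"
    "s ''s'' i \<le> 1" "s ''d'' i \<le> 1" "s ''col'' i \<le> 3" "s ''c1'' i \<le> i" "s ''c2'' i \<le> i"
    "s ''P'' i \<le> 2 ^ i" "s ''Q'' i \<le> 2 ^ i" "s ''q'' i \<le> 2 ^ n" "s ''V'' i \<le> 2 * n + 1"
  by (rule order_trans[OF bounded_byD[OF assms]], simp only: val_bound_simps order_refl)+

lemma mult_le_one_nat: "(a :: nat) \<le> 1 \<Longrightarrow> b \<le> 1 \<Longrightarrow> a * b \<le> 1"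
  using mult_le_mono[of a 1 b 1] by simp

lemma mod2_le_one: "(a :: nat) mod 2 \<le> 1"
  by simp

lemma of_bool_le_one: "of_bool P \<le> (1 :: nat)"
  by simp

lemma select_le_one: "(b :: nat) \<le> 1 \<Longrightarrow> c \<le> 1 \<Longrightarrow> a mod 2 * b + of_bool (a mod 2 = 0) * c \<le> 1"
  by (cases "even a") (simp_all add: even_iff_mod_2_eq_zero odd_iff_mod_2_eq_one)

lemma double_le_power: "(a :: nat) \<le> 2 ^ i \<Longrightarrow> b \<le> 1 \<Longrightarrow> a * (1 + b) \<le> 2 ^ (i + 1)"
  using mult_le_mono[of a "2 ^ i" "1 + b" 2] by simp

lemma amax_n: "a \<le> n \<Longrightarrow> a \<le> amax n" "a \<le> n \<Longrightarrow> a + 1 \<le> amax n" "a \<le> 2 * n \<Longrightarrow> a \<le> amax n"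
    "a \<le> n \<Longrightarrow> b \<le> 2 * n \<Longrightarrow> a + b \<le> amax n" "a \<le> 2 * n + 1 \<Longrightarrow> a - 1 \<le> amax n" "0 \<le> amax n"
  by (simp_all add: amax_def)

lemma amax_matrix: "a \<le> 2 * n \<Longrightarrow> k \<le> n \<Longrightarrow> b \<le> n \<Longrightarrow> a * k + b \<le> amax n"
  "a \<le> n \<Longrightarrow> k \<le> n \<Longrightarrow> b \<le> n \<Longrightarrow> a * k + b \<le> amax n"
  "c \<le> n \<Longrightarrow> a \<le> 2 * n \<Longrightarrow> k \<le> n \<Longrightarrow> b \<le> n \<Longrightarrow> (c + a) * k + b \<le> amax n"
  by (rule amax_idx; simp)+

lemma power_le_exp: "(a :: nat) \<le> 2 ^ i \<Longrightarrow> i \<le> n \<Longrightarrow> a \<le> 2 ^ n"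
  by (meson order_trans power_increasing one_le_numeral)

lemma bounded_cells_n:
  assumes "bounded_by (bound n) s"
  shows "s ''P'' (s ''n'' 0) \<le> 2 ^ n" "s ''Q'' (s ''n'' 0) \<le> 2 ^ n" "s ''n'' i + s ''n'' i \<le> 2 * n"
    "s ''p'' i - 1 \<le> amax n" "s ''col'' i div 2 \<le> 1"
proof -
  note c = bounded_cells[OF assms]
  show "s ''P'' (s ''n'' 0) \<le> 2 ^ n" using c(24,1) by (rule power_le_exp)
  show "s ''Q'' (s ''n'' 0) \<le> 2 ^ n" using c(25,1) by (rule power_le_exp)
  show "s ''n'' i + s ''n'' i \<le> 2 * n" using c(1)[of i] by simp
  show "s ''p'' i - 1 \<le> amax n" using c(7) by (rule amax_n)
  show "s ''col'' i div 2 \<le> 1" using c(21)[of i] by simp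
qed

text \<open>The bound of the written cell depends on its address here: if cell \<open>j\<close> of
  \<open>Q\<close> is at most 2 ^ j, then cell j + 1 gets at most 2 ^ (j + 1), whatever
  \<open>j\<close> currently is.\<close>

lemma safe_scan:
  "safe (bound n) (compile (PAssign ''Q'' (Plus (var ''j'') (N 1))
     (Times (Cell ''Q'' (var ''j'')) (Plus (N 1) (neg (Cell ''V'' (var ''j'')))))))"
  "safe (bound n) (compile (PAssign ''P'' (Plus (var ''v'') (N 1))
     (Times (Cell ''P'' (var ''v'')) (Plus (N 1) (mod2 (Cell ''col'' (var ''v'')))))))"
  "safe (bound n) (compile (PAssign ''c1'' (Plus (var ''v'') (N 1))
     (Plus (Cell ''c1'' (var ''v'')) (mod2 (Cell ''col'' (var ''v''))))))"
  "safe (bound n) (compile (PAssign ''c2'' (Plus (var ''v'') (N 1))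
     (Plus (Cell ''c2'' (var ''v'')) (Div (Cell ''col'' (var ''v'')) (N 2)))))"
proof -
  have suc: "s ''j'' 0 + 1 \<le> amax n" "s ''v'' 0 + 1 \<le> amax n" if "bounded_by (bound n) s" for s
    using amax_n(2)[OF bounded_cells(5)[OF that]] amax_n(2)[OF bounded_cells(3)[OF that]] by simp_all
  show "safe (bound n) (compile (PAssign ''Q'' (Plus (var ''j'') (N 1))
     (Times (Cell ''Q'' (var ''j'')) (Plus (N 1) (neg (Cell ''V'' (var ''j'')))))))"
    using suc double_le_power[OF bounded_cells(25) of_bool_le_one]
    by (intro safe_compile_Assign) (simp only: val_bound_simps aval.simps aval_neg)
  show "safe (bound n) (compile (PAssign ''P'' (Plus (var ''v'') (N 1))
     (Times (Cell ''P'' (var ''v'')) (Plus (N 1) (mod2 (Cell ''col'' (var ''v'')))))))"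
    using suc double_le_power[OF bounded_cells(24) mod2_le_one]
    by (intro safe_compile_Assign) (simp only: val_bound_simps aval.simps aval_mod2)
  show "safe (bound n) (compile (PAssign ''c1'' (Plus (var ''v'') (N 1))
     (Plus (Cell ''c1'' (var ''v'')) (mod2 (Cell ''col'' (var ''v''))))))"
    using suc add_mono[OF bounded_cells(22) mod2_le_one]
    by (intro safe_compile_Assign) (simp only: val_bound_simps aval.simps aval_mod2)
  show "safe (bound n) (compile (PAssign ''c2'' (Plus (var ''v'') (N 1))
     (Plus (Cell ''c2'' (var ''v'')) (Div (Cell ''col'' (var ''v'')) (N 2)))))"
    using suc add_mono[OF bounded_cells(23) bounded_cells_n(5)]
    by (intro safe_compile_Assign) (simp only: val_bound_simps aval.simps)
qed

lemmas le_simps = mod2_le_one amax_matrix amax_n mult_le_one_nat of_bool_le_one select_le_one double_le_power add_mono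

lemma safe_dot: "z \<in> {''t'', ''x''} \<Longrightarrow> safe (bound n) (compile (dot z))"
  unfolding dot_def
  by (intro safe_intros; (elim insertE emptyE)?; simp add: val_bound_simps bounded_cells bounded_cells_n le_simps del: One_nat_def)

lemma safe_build_system: "safe (bound n) (compile build_system)"
  unfolding build_system_def pivot_row_def row2_def
  by (intro safe_intros safe_dot; simp add: val_bound_simps bounded_cells bounded_cells_n le_simps del: One_nat_def)

lemma safe_build_laplacian: "safe (bound n) (compile build_laplacian)"
  unfolding build_laplacian_def pivot_row_def row2_def
  by (intro safe_intros safe_dot safe_build_system; simp add: val_bound_simps bounded_cells bounded_cells_n le_simps del: One_nat_def)

lemma safe_find_pivot: "safe (bound n) (compile find_pivot)"
  unfolding find_pivot_def pivot_row_def row2_def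
  by (intro safe_intros safe_dot safe_build_system safe_build_laplacian; simp add: val_bound_simps bounded_cells bounded_cells_n le_simps del: One_nat_def)

lemma safe_clear_column: "safe (bound n) (compile clear_column)"
  unfolding clear_column_def pivot_row_def row2_def
  by (intro safe_intros safe_dot safe_build_system safe_build_laplacian safe_find_pivot; simp add: val_bound_simps bounded_cells bounded_cells_n le_simps del: One_nat_def)

lemma safe_eliminate: "safe (bound n) (compile eliminate)"
  unfolding eliminate_def pivot_row_def row2_def
  by (intro safe_intros safe_dot safe_build_system safe_build_laplacian safe_find_pivot safe_clear_column; simp add: val_bound_simps bounded_cells bounded_cells_n le_simps del: One_nat_def)

lemma safe_count_solutions: "safe (bound n) (compile count_solutions)"
  unfolding count_solutions_def
  by (intro safe_compile_Seq safe_compile_For' safe_scan; (rule safe_compile_Assign)?;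
    simp add: val_bound_simps bounded_cells bounded_cells_n le_simps del: One_nat_def)

lemma safe_save_system: "safe (bound n) (compile save_system)"
  unfolding save_system_def pivot_row_def row2_def
  by (intro safe_intros safe_dot safe_build_system safe_build_laplacian safe_find_pivot safe_clear_column safe_eliminate safe_count_solutions; simp add: val_bound_simps bounded_cells bounded_cells_n le_simps del: One_nat_def)

lemma safe_compute_solution: "safe (bound n) (compile compute_solution)"
  unfolding compute_solution_def pivot_row_def row2_def
  by (intro safe_intros safe_dot safe_build_system safe_build_laplacian safe_find_pivot safe_clear_column safe_eliminate safe_count_solutions safe_save_system; simp add: val_bound_simps bounded_cells bounded_cells_n le_simps del: One_nat_def)

lemma safe_add_determinant: "safe (bound n) (compile add_determinant)"
  unfolding add_determinant_def pivot_row_def row2_def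
  by (intro safe_intros safe_dot safe_build_system safe_build_laplacian safe_find_pivot safe_clear_column safe_eliminate safe_count_solutions safe_save_system safe_compute_solution; simp add: val_bound_simps bounded_cells bounded_cells_n le_simps del: One_nat_def)

lemma safe_process_solution: "safe (bound n) (compile process_solution)"
  unfolding process_solution_def pivot_row_def row2_def
  by (intro safe_intros safe_dot safe_build_system safe_build_laplacian safe_find_pivot safe_clear_column safe_eliminate safe_count_solutions safe_save_system safe_compute_solution safe_add_determinant; simp add: val_bound_simps bounded_cells bounded_cells_n le_simps del: One_nat_def)

lemma safe_decode_assignment: "safe (bound n) (compile decode_assignment)"
  unfolding decode_assignment_def pivot_row_def row2_def
  by (intro safe_intros safe_dot safe_build_system safe_build_laplacian safe_find_pivot safe_clear_column safe_eliminate safe_count_solutions safe_save_system safe_compute_solution safe_add_determinant safe_process_solution; simp add: val_bound_simps bounded_cells bounded_cells_n le_simps del: One_nat_def)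

lemma safe_solve_system: "safe (bound n) (compile solve_system)"
  unfolding solve_system_def pivot_row_def row2_def
  by (intro safe_intros safe_dot safe_build_system safe_build_laplacian safe_find_pivot safe_clear_column safe_eliminate safe_count_solutions safe_save_system safe_compute_solution safe_add_determinant safe_process_solution safe_decode_assignment; simp add: val_bound_simps bounded_cells bounded_cells_n le_simps del: One_nat_def)

lemma safe_colour: "safe (bound n) (compile colour)"
  unfolding colour_def pivot_row_def row2_def
  by (intro safe_intros safe_dot safe_build_system safe_build_laplacian safe_find_pivot safe_clear_column safe_eliminate safe_count_solutions safe_save_system safe_compute_solution safe_add_determinant safe_process_solution safe_decode_assignment safe_solve_system; simp add: val_bound_simps bounded_cells bounded_cells_n le_simps del: One_nat_def)

lemma safe_count_colours: "safe (bound n) (compile count_colours)"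
  unfolding count_colours_def
  by (intro safe_compile_Seq safe_compile_For' safe_scan; (rule safe_compile_Assign)?;
    simp add: val_bound_simps bounded_cells bounded_cells_n le_simps del: One_nat_def)

lemma safe_main_prog: "safe (bound n) (compile main_prog)"
  unfolding main_prog_def pivot_row_def row2_def
  by (intro safe_intros safe_dot safe_build_system safe_build_laplacian safe_find_pivot safe_clear_column safe_eliminate safe_count_solutions safe_save_system safe_compute_solution safe_add_determinant safe_process_solution safe_decode_assignment safe_solve_system safe_colour safe_count_colours; simp add: val_bound_simps bounded_cells bounded_cells_n le_simps del: One_nat_def)

section \<open>Correctness of the program\<close>

text \<open>From here on loops are opened by \<open>den_For\<close>, and memories that a program
  does not write are simplified away.\<close>

declare den.simps(4) [simp del] den_frame [simp] write_cell_apply [simp]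

lemma idx_inj: "w < n \<Longrightarrow> w' < n \<Longrightarrow> r * n + w = r' * n + w' \<longleftrightarrow> r = r' \<and> w = (w' :: nat)"
proof
  assume w: "w < n" "w' < n" and eq: "r * n + w = r' * n + w'"
  have "(r * n + w) div n = r" "(r' * n + w') div n = r'" using w by simp_all
  moreover have "(r * n + w) mod n = w" "(r' * n + w') mod n = w'" using w by simp_all
  ultimately show "r = r' \<and> w = w'" using eq by metis
qed simp

text \<open>The accumulator is reduced modulo 2 in every round; with no rounds this requires a
  reduced start.\<close>

lemma den_sum_loop:
  assumes "\<And>t. (\<And>y. y \<notin> {''w'', ''s''} \<Longrightarrow> t y = s y) \<Longrightarrow> t ''w'' 0 < s ''n'' 0 \<Longrightarrow> aval F t = f (t ''w'' 0)"
    and "s ''s'' 0 < 2"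
  shows "den (PFor ''w'' ''n'' (PAssign ''s'' (N 0) (mod2 (Plus (var ''s'') F)))) s ''s'' 0 =
    (s ''s'' 0 + (\<Sum>w<s ''n'' 0. f w)) mod 2"
proof (rule den_For[where I = "\<lambda>i t. t ''s'' 0 = (s ''s'' 0 + (\<Sum>w<i. f w)) mod 2"])
  fix i and t :: store
  assume "i < s ''n'' 0" "t ''w'' 0 = i"
    "\<And>y. y \<notin> insert ''w'' (writes (PAssign ''s'' (N 0) (mod2 (Plus (var ''s'') F)))) \<Longrightarrow> t y = s y"
    and I: "t ''s'' 0 = (s ''s'' 0 + (\<Sum>w<i. f w)) mod 2"
  then have "aval F t = f i" using assms(1)[of t] by simp
  then show "write_cell ''w'' 0 (Suc i) (den (PAssign ''s'' (N 0) (mod2 (Plus (var ''s'') F))) t) ''s'' 0 =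
      (s ''s'' 0 + (\<Sum>w<Suc i. f w)) mod 2"
    using I by (simp add: mod_simps add.assoc)
qed (use assms(2) in simp_all)

lemma den_dot:
  assumes z: "z \<notin> {''r'', ''w'', ''s'', ''h''}" and g: "\<And>r. r < s ''n'' 0 \<Longrightarrow> s ''g'' r < 2"
  shows "\<forall>r<s ''n'' 0. den (dot z) s ''h'' r =
    (s ''g'' r + (\<Sum>w<s ''n'' 0. s ''adj'' (r * s ''n'' 0 + w) * s z w)) mod 2"
  unfolding dot_def
proof (rule den_For[where I = "\<lambda>i t. \<forall>r<i. t ''h'' r =
    (s ''g'' r + (\<Sum>w<s ''n'' 0. s ''adj'' (r * s ''n'' 0 + w) * s z w)) mod 2"], goal_cases)
  case (3 i t)
  have fr: "t ''n'' = s ''n''" "t ''adj'' = s ''adj''" "t ''g'' = s ''g''" "t z = s z"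
    using 3(3) z by auto
  let ?t = "write_cell ''s'' 0 (t ''g'' i) t"
  let ?F = "Times (Cell ''adj'' (idx (var ''r'') (var ''w''))) (Cell z (var ''w''))"
  have "den (PFor ''w'' ''n'' (PAssign ''s'' (N 0) (mod2 (Plus (var ''s'') ?F)))) ?t ''s'' 0 =
     (?t ''s'' 0 + (\<Sum>w<?t ''n'' 0. s ''adj'' (i * s ''n'' 0 + w) * s z w)) mod 2"
    using 3(1,2) fr z g by (intro den_sum_loop) auto
  moreover have "den (PFor ''w'' ''n'' (PAssign ''s'' (N 0) (mod2 (Plus (var ''s'') ?F)))) ?t ''r'' 0 = i"
    using 3(2) by simp
  moreover have frame: "den (PFor ''w'' ''n'' (PAssign ''s'' (N 0) (mod2 (Plus (var ''s'') ?F)))) ?t ''h'' = t ''h''"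
    by simp
  ultimately have step: "den (PAssign ''s'' (N 0) (Cell ''g'' (var ''r'')) ;;
     PFor ''w'' ''n'' (PAssign ''s'' (N 0) (mod2 (Plus (var ''s'') ?F))) ;;
     PAssign ''h'' (var ''r'') (var ''s'')) t ''h'' =
     (t ''h'')(i := (s ''g'' i + (\<Sum>w<s ''n'' 0. s ''adj'' (i * s ''n'' 0 + w) * s z w)) mod 2)"
    using fr 3(2)
    by (simp only: den.simps(1,2) aval.simps write_cell_apply refl if_True frame) simp
  show ?case unfolding write_cell_apply step using 3(4) by (simp add: less_Suc_eq)
next
  case 1
  show ?case by simp
next
  case 2
  show ?case by simp
qed

lemma den_find_pivot:
  fixes s :: store and m n j :: nat
  assumes "s ''m'' 0 = m" "s ''n'' 0 = n" "s ''j'' 0 = j"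
  defines "cand \<equiv> \<lambda>r. s ''R'' (r * n + j) \<noteq> 0 \<and> s ''U'' r = 0"
  shows "den find_pivot s ''p'' 0 = 0 \<and> (\<forall>r<m. \<not> cand r) \<or> (\<exists>r<m. den find_pivot s ''p'' 0 = Suc r \<and> cand r)"
proof -
  let ?b = "PIf (Times (Cell ''R'' (idx (var ''r'') (var ''j''))) (Times (neg (Cell ''U'' (var ''r''))) (neg (var ''p''))))
         (PAssign ''p'' (N 0) (Plus (var ''r'') (N 1))) PSkip"
  let ?s = "write_cell ''p'' 0 0 s"
  let ?I = "\<lambda>i (t :: store). t ''p'' 0 = 0 \<and> (\<forall>r<i. \<not> cand r) \<or> (\<exists>r<i. t ''p'' 0 = Suc r \<and> cand r)"
  have "?I (?s ''m'' 0) (den (PFor ''r'' ''m'' ?b) ?s)"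
  proof (rule den_For[where I = ?I], goal_cases)
    case (3 i t)
    have "t ''R'' = s ''R''" "t ''U'' = s ''U''" "t ''n'' = s ''n''" "t ''j'' = s ''j''"
      using 3(3) by auto
    then show ?case using 3(2,4) assms(2,3) by (auto simp: less_Suc_eq cand_def)
  qed auto
  then show ?thesis using assms(1) by (simp add: find_pivot_def)
qed

text \<open>The program updates in place, yet \<open>new\<close> refers to the old matrix only: the
  pivot row is skipped, and the test for a row reads its entry before that row is changed.\<close>

lemma den_clear_column:
  fixes s :: store and m n j p :: nat
  assumes "s ''m'' 0 = m" "s ''n'' 0 = n" "s ''j'' 0 = j" "s ''p'' 0 = Suc p" and p: "p < m" and j: "j < n"
  defines "new \<equiv> \<lambda>r (old :: nat) piv. if r \<noteq> p \<and> s ''R'' (r * n + j) \<noteq> 0 then (old + piv) mod 2 else old"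
  shows "(\<forall>r<m. \<forall>w<n. den clear_column s ''R'' (r * n + w) = new r (s ''R'' (r * n + w)) (s ''R'' (p * n + w))) \<and>
    (\<forall>r<m. den clear_column s ''b'' r = new r (s ''b'' r) (s ''b'' p))"
proof -
  let ?R = "\<lambda>i r w. if r < i then new r (s ''R'' (r * n + w)) (s ''R'' (p * n + w)) else s ''R'' (r * n + w)"
  let ?I = "\<lambda>i (t :: store). (\<forall>r<m. \<forall>w<n. t ''R'' (r * n + w) = ?R i r w) \<and>
     (\<forall>r<m. t ''b'' r = (if r < i then new r (s ''b'' r) (s ''b'' p) else s ''b'' r))"
  let ?l = "PFor ''w'' ''n'' (PAssign ''R'' (idx (var ''r'') (var ''w''))
          (mod2 (Plus (Cell ''R'' (idx (var ''r'') (var ''w''))) (Cell ''R'' (idx pivot_row (var ''w''))))))"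
  have "?I (s ''m'' 0) (den clear_column s)"
    unfolding clear_column_def
  proof (rule den_For[where I = ?I], goal_cases)
    case (3 i t)
    have fr: "t ''n'' = s ''n''" "t ''j'' = s ''j''" "t ''p'' = s ''p''"
      using 3(3) by auto
    have i: "i < m" using 3(1) assms(1) by simp
    have Rij: "t ''R'' (i * n + j) = s ''R'' (i * n + j)" using 3(4) i j by auto
    have Rp: "t ''R'' (p * n + w) = s ''R'' (p * n + w)" if "w < n" for w
      using 3(4) p that by (auto simp: new_def)
    show ?case
    proof (cases "i \<noteq> p \<and> s ''R'' (i * n + j) \<noteq> 0")
      case False
      then have "aval (Times (Cell ''R'' (idx (var ''r'') (var ''j''))) (neg (eqe (var ''r'') pivot_row))) t = 0"
        using fr 3(2) assms(2-4) Rij by (auto simp: pivot_row_def)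
      then show ?thesis using 3(4) False by (auto simp: less_Suc_eq new_def)
    next
      case True
      then have cond: "aval (Times (Cell ''R'' (idx (var ''r'') (var ''j''))) (neg (eqe (var ''r'') pivot_row))) t \<noteq> 0"
        using fr 3(2) assms(2-4) Rij by (auto simp: pivot_row_def)
      let ?J = "\<lambda>k (t' :: store). \<forall>r<m. \<forall>w<n. t' ''R'' (r * n + w) = (if r = i then (if w < k then
         new r (s ''R'' (r * n + w)) (s ''R'' (p * n + w)) else s ''R'' (r * n + w)) else ?R i r w)"
      have J: "?J (t ''n'' 0) (den ?l t)"
      proof (rule den_For[where I = ?J], goal_cases)
        case (3 k t')
        have fr': "t' ''n'' = t ''n''" "t' ''r'' = t ''r''" "t' ''p'' = t ''p''" using 3(3) by auto
        have k: "k < n" using 3(1) fr assms(2) by simp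
        have "t' ''R'' (p * n + k) = s ''R'' (p * n + k)" "t' ''R'' (i * n + k) = s ''R'' (i * n + k)"
          using 3(4) p k i True by (auto simp: new_def)
        then have "den (PAssign ''R'' (idx (var ''r'') (var ''w''))
          (mod2 (Plus (Cell ''R'' (idx (var ''r'') (var ''w''))) (Cell ''R'' (idx pivot_row (var ''w'')))))) t' =
          write_cell ''R'' (i * n + k) (new i (s ''R'' (i * n + k)) (s ''R'' (p * n + k))) t'"
          using fr fr' \<open>t' ''w'' 0 = k\<close> \<open>t ''r'' 0 = i\<close> assms(2-4) True
          by (simp add: pivot_row_def new_def)
        then show ?case using 3(4) k by (auto simp: idx_inj less_Suc_eq)
      qed (use 3(4) i in auto)
      have "t ''n'' 0 = n" using fr assms(2) by simp
      have b: "t ''b'' p = s ''b'' p" "t ''b'' i = s ''b'' i" using 3(4) p i by (auto simp: new_def)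
      have "den (PIf (Times (Cell ''R'' (idx (var ''r'') (var ''j''))) (neg (eqe (var ''r'') pivot_row)))
         (?l ;; PAssign ''b'' (var ''r'') (mod2 (Plus (Cell ''b'' (var ''r'')) (Cell ''b'' pivot_row)))) PSkip) t =
         write_cell ''b'' i (new i (s ''b'' i) (s ''b'' p)) (den ?l t)" (is "den ?body t = _")
        unfolding den.simps(3) if_P[OF cond] using 3(2) fr assms(4) b True by (simp add: pivot_row_def new_def)
      then have "den ?body t ''R'' = den ?l t ''R''" "den ?body t ''b'' = (t ''b'')(i := new i (s ''b'' i) (s ''b'' p))"
        by simp_all
      then show ?thesis
        using J 3(4) unfolding \<open>t ''n'' 0 = n\<close> write_cell_apply by (simp add: less_Suc_eq)
    qed
  qed auto
  then show ?thesis using assms(1) by auto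
qed

section \<open>Elimination in the store\<close>

definition matrix_of :: "nat \<Rightarrow> store \<Rightarrow> string \<Rightarrow> nat \<Rightarrow> nat \<Rightarrow> bit" where
  "matrix_of n s x r w = of_nat (s x (r * n + w))"

definition vector_of :: "store \<Rightarrow> string \<Rightarrow> nat \<Rightarrow> bit" where
  "vector_of s x i = of_nat (s x i)"

text \<open>With entries 0 and 1 the program's test for a nonzero entry is a test for 1 in
  GF(2).\<close>

definition binary :: "nat \<Rightarrow> nat \<Rightarrow> store \<Rightarrow> bool" where
  "binary m n s \<longleftrightarrow> (\<forall>r<m. \<forall>w<n. s ''R'' (r * n + w) < 2) \<and> (\<forall>r<m. s ''b'' r < 2)"

lemma of_nat_mod_2_bit [simp]: "(of_nat (k mod 2) :: bit) = of_nat k"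
  by (simp add: of_nat_bit)

lemma of_nat_bit_eq_1: "k < 2 \<Longrightarrow> (of_nat k :: bit) = 1 \<longleftrightarrow> k \<noteq> 0"
  by (auto simp: less_2_cases_iff)

lemma of_nat_bit_eq_0: "k < 2 \<Longrightarrow> (of_nat k :: bit) = 0 \<longleftrightarrow> k = 0"
  by (auto simp: less_2_cases_iff)

text \<open>Invariant after \<open>k\<close> columns: reduced up to \<open>k\<close>, same solutions
  as at the start, entries still bits. If no pivot is found, column \<open>k\<close> becomes free;
  otherwise \<open>add_row\<close> clears it.\<close>

lemma den_eliminate:
  fixes s :: store and m n :: nat
  assumes "s ''m'' 0 = m" "s ''n'' 0 = n" and bin: "binary m n s"
  defines "t \<equiv> den eliminate s"
  shows "row_reduced m n (matrix_of n t ''R'') (\<lambda>r. t ''U'' r \<noteq> 0) (t ''V'')"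
    and "sat m n (matrix_of n t ''R'') (vector_of t ''b'') x \<longleftrightarrow> sat m n (matrix_of n s ''R'') (vector_of s ''b'') x"
    and "binary m n t"
proof -
  let ?e = "find_pivot ;; PAssign ''V'' (var ''j'') (var ''p'') ;;
     PIf (var ''p'') (PAssign ''U'' pivot_row (N 1) ;; clear_column) PSkip"
  let ?u = "PFor ''r'' ''m'' (PAssign ''U'' (var ''r'') (N 0))"
  let ?I = "\<lambda>k (t :: store). row_reduced m k (matrix_of n t ''R'') (\<lambda>r. t ''U'' r \<noteq> 0) (t ''V'') \<and> binary m n t \<and>
    (\<forall>x. sat m n (matrix_of n t ''R'') (vector_of t ''b'') x \<longleftrightarrow> sat m n (matrix_of n s ''R'') (vector_of s ''b'') x)"
  have "\<forall>r<s ''m'' 0. den ?u s ''U'' r = 0"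
    by (rule den_For[where I = "\<lambda>i t. \<forall>r<i. t ''U'' r = 0"]) (auto simp: less_Suc_eq)
  then have U0: "\<And>r. r < m \<Longrightarrow> den ?u s ''U'' r = 0" using assms(1) by auto
  have Rb: "den ?u s ''R'' = s ''R''" "den ?u s ''b'' = s ''b''" by simp_all
  have w: "writes ?e = {''p'', ''r'', ''V'', ''U'', ''w'', ''R'', ''b''}"
    by (auto simp: find_pivot_def clear_column_def)
  have "?I (den ?u s ''n'' 0) (den (PFor ''j'' ''n'' ?e) (den ?u s))"
  proof (rule den_For[where I = ?I], goal_cases)
    case 1
    show ?case unfolding w by simp
  next
    case 2
    show ?case
      using bin U0 by (simp add: row_reduced_0 binary_def matrix_of_def[abs_def] vector_of_def[abs_def] Rb)
  next
    case (3 k t)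
    have fr: "t ''n'' = s ''n''" "t ''m'' = s ''m''" using 3(3)[unfolded w] by simp_all
    have k: "k < n" using 3(1) assms(2) by simp
    have tm: "t ''m'' 0 = m" "t ''n'' 0 = n" using fr assms by simp_all
    define t1 where "t1 = den find_pivot t"
    have t1: "t1 y = t y" if "y \<notin> {''p'', ''r''}" for y
      using that unfolding t1_def by (simp add: find_pivot_def)
    have bin: "binary m n t" and red: "row_reduced m k (matrix_of n t ''R'') (\<lambda>r. t ''U'' r \<noteq> 0) (t ''V'')"
      and sat: "\<And>x. sat m n (matrix_of n t ''R'') (vector_of t ''b'') x \<longleftrightarrow> sat m n (matrix_of n s ''R'') (vector_of s ''b'') x"
      using 3(4) by auto
    have R2: "t ''R'' (r * n + w) < 2" if "r < m" "w < n" for r w using bin that by (simp add: binary_def)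
    define t2 where "t2 = write_cell ''V'' k (t1 ''p'' 0) t1"
    have den: "den ?e t = (if t1 ''p'' 0 \<noteq> 0 then den clear_column (write_cell ''U'' (t1 ''p'' 0 - 1) 1 t2) else t2)"
      using 3(2) by (simp add: t1_def[symmetric] t2_def pivot_row_def t1)
    consider (none) "t1 ''p'' 0 = 0" "\<forall>r<m. \<not> (t ''R'' (r * n + k) \<noteq> 0 \<and> t ''U'' r = 0)"
      | (piv) p where "p < m" "t1 ''p'' 0 = Suc p" "t ''R'' (p * n + k) \<noteq> 0" "t ''U'' p = 0"
      using den_find_pivot[of t m n k] tm 3(2) unfolding t1_def by auto
    then show ?case
    proof cases
      case none
      have mats: "matrix_of n t2 ''R'' = matrix_of n t ''R''" "vector_of t2 ''b'' = vector_of t ''b''"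
        "t2 ''U'' = t ''U''" "t2 ''V'' = (t ''V'')(k := 0)" "t2 ''R'' = t ''R''" "t2 ''b'' = t ''b''"
        using none(1) by (auto simp: t2_def matrix_of_def[abs_def] vector_of_def[abs_def] t1)
      have "row_reduced m (Suc k) (matrix_of n t ''R'') (\<lambda>r. t ''U'' r \<noteq> 0) ((t ''V'')(k := 0))"
        using none(2) by (intro row_reduced_no_pivot[OF red]) (auto simp: matrix_of_def)
      then show ?thesis
        using none(1) bin sat mats unfolding den
        by (simp add: binary_def matrix_of_def[abs_def] vector_of_def[abs_def])
    next
      case piv
      define t3 where "t3 = write_cell ''U'' p 1 t2"
      define t4 where "t4 = den clear_column t3"
      have den': "den ?e t = t4" using piv(2) unfolding den t4_def t3_def by simp
      have t3: "t3 y = t y" if "y \<notin> {''p'', ''r'', ''V'', ''U''}" for y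
        using that by (simp add: t3_def t2_def t1)
      have t3p: "t3 ''p'' 0 = Suc p" "t3 ''V'' = (t ''V'')(k := Suc p)" "t3 ''U'' = (t ''U'')(p := 1)"
        using piv(2) by (simp_all add: t3_def t2_def t1)
      have t4UV: "t4 ''V'' = (t ''V'')(k := Suc p)" "t4 ''U'' = (t ''U'')(p := 1)"
        using t3p by (simp_all add: t4_def clear_column_def fun_eq_iff)
      have cl: "\<forall>r<m. \<forall>w<n. t4 ''R'' (r * n + w) = (if r \<noteq> p \<and> t ''R'' (r * n + k) \<noteq> 0
            then (t ''R'' (r * n + w) + t ''R'' (p * n + w)) mod 2 else t ''R'' (r * n + w))"
         "\<forall>r<m. t4 ''b'' r = (if r \<noteq> p \<and> t ''R'' (r * n + k) \<noteq> 0 then (t ''b'' r + t ''b'' p) mod 2 else t ''b'' r)"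
        using den_clear_column[of t3 m n k p] tm 3(2) t3p(1) piv(1) k unfolding t4_def by (simp_all add: t3)
      have one: "matrix_of n t ''R'' r k = 1 \<longleftrightarrow> t ''R'' (r * n + k) \<noteq> 0" if "r < m" for r
        using R2[OF that k] by (simp add: matrix_of_def of_nat_bit_eq_1)
      have R4: "matrix_of n t4 ''R'' r w = add_row p k (matrix_of n t ''R'') (\<lambda>r. matrix_of n t ''R'' r w) r"
        if "r < m" "w < n" for r w
        using cl(1) that one[of r] by (auto simp: add_row_def matrix_of_def)
      have b4: "vector_of t4 ''b'' r = add_row p k (matrix_of n t ''R'') (vector_of t ''b'') r" if "r < m" for r
        using cl(2) that one[of r] by (auto simp: add_row_def vector_of_def)
      have "row_reduced m (Suc k) (\<lambda>r w. add_row p k (matrix_of n t ''R'') (\<lambda>r. matrix_of n t ''R'' r w) r)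
          ((\<lambda>r. t ''U'' r \<noteq> 0)(p := True)) ((t ''V'')(k := Suc p))"
        using piv one by (intro row_reduced_pivot[OF red]) auto
      moreover have "(\<lambda>r. t ''U'' r \<noteq> 0)(p := True) = (\<lambda>r. t4 ''U'' r \<noteq> 0)"
        unfolding t4UV by auto
      ultimately have "row_reduced m (Suc k) (\<lambda>r w. add_row p k (matrix_of n t ''R'') (\<lambda>r. matrix_of n t ''R'' r w) r)
          (\<lambda>r. t4 ''U'' r \<noteq> 0) (t4 ''V'')" unfolding t4UV by metis
      then have "row_reduced m (Suc k) (matrix_of n t4 ''R'') (\<lambda>r. t4 ''U'' r \<noteq> 0) (t4 ''V'')"
        by (rule row_reduced_cong) (use R4 k in simp)
      moreover have "sat m n (matrix_of n t4 ''R'') (vector_of t4 ''b'') x \<longleftrightarrow>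
          sat m n (matrix_of n t ''R'') (vector_of t ''b'') x" for x
        unfolding sat_add_row[OF piv(1), of n k "matrix_of n t ''R''" "vector_of t ''b''" x, symmetric]
        using R4 b4 by (intro sat_cong) auto
      moreover have "binary m n t4"
        using cl bin by (auto simp: binary_def)
      moreover have "matrix_of n (write_cell ''j'' 0 (Suc k) t4) ''R'' = matrix_of n t4 ''R''"
        "vector_of (write_cell ''j'' 0 (Suc k) t4) ''b'' = vector_of t4 ''b''"
        "binary m n (write_cell ''j'' 0 (Suc k) t4) = binary m n t4"
        by (simp_all add: matrix_of_def[abs_def] vector_of_def[abs_def] binary_def)
      ultimately show ?thesis using sat unfolding den' by simp
    qed
  qed
  then have "?I n t" using assms(2) unfolding t_def eliminate_def by simp
  then show "row_reduced m n (matrix_of n t ''R'') (\<lambda>r. t ''U'' r \<noteq> 0) (t ''V'')"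
    "sat m n (matrix_of n t ''R'') (vector_of t ''b'') x \<longleftrightarrow> sat m n (matrix_of n s ''R'') (vector_of s ''b'') x"
    "binary m n t" by blast+
qed

text \<open>Common to both systems. The values of the expressions may depend only on the counters
  and on memories that are not being filled.\<close>

lemma den_fill_rows:
  fixes s :: store and n :: nat and f1 f2 :: "nat \<Rightarrow> nat \<Rightarrow> nat" and f3 f4 :: "nat \<Rightarrow> nat"
  assumes n: "s ''n'' 0 = n"
    and F12: "\<And>t. (\<And>y. y \<notin> {''r'', ''w'', ''R'', ''b''} \<Longrightarrow> t y = s y) \<Longrightarrow> t ''r'' 0 < n \<Longrightarrow> t ''w'' 0 < n \<Longrightarrow>
      aval F1 t = f1 (t ''r'' 0) (t ''w'' 0) \<and> aval F2 t = f2 (t ''r'' 0) (t ''w'' 0)"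
    and F34: "\<And>t. (\<And>y. y \<notin> {''r'', ''w'', ''R'', ''b''} \<Longrightarrow> t y = s y) \<Longrightarrow> t ''r'' 0 < n \<Longrightarrow>
      aval F3 t = f3 (t ''r'' 0) \<and> aval F4 t = f4 (t ''r'' 0)"
  defines "t \<equiv> den (PFor ''r'' ''n'' (
       PFor ''w'' ''n'' (PAssign ''R'' (idx (var ''r'') (var ''w'')) F1 ;;
         PAssign ''R'' (idx (Plus (var ''n'') (var ''r'')) (var ''w'')) F2) ;;
       PAssign ''b'' (var ''r'') F3 ;;
       PAssign ''b'' (Plus (var ''n'') (var ''r'')) F4)) s"
  shows "\<forall>r<n. (\<forall>w<n. t ''R'' (r * n + w) = f1 r w \<and> t ''R'' ((n + r) * n + w) = f2 r w) \<and>
    t ''b'' r = f3 r \<and> t ''b'' (n + r) = f4 r"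
proof -
  let ?inner = "PAssign ''R'' (idx (var ''r'') (var ''w'')) F1 ;;
         PAssign ''R'' (idx (Plus (var ''n'') (var ''r'')) (var ''w'')) F2"
  let ?l = "PFor ''w'' ''n'' ?inner"
  let ?I = "\<lambda>i (t :: store). \<forall>r<i. (\<forall>w<n. t ''R'' (r * n + w) = f1 r w \<and> t ''R'' ((n + r) * n + w) = f2 r w) \<and>
    t ''b'' r = f3 r \<and> t ''b'' (n + r) = f4 r"
  have "?I (s ''n'' 0) t"
    unfolding t_def
  proof (rule den_For[where I = ?I], goal_cases)
    case (3 i t)
    have fr: "t y = s y" if "y \<notin> {''r'', ''w'', ''R'', ''b''}" for y using 3(3) that by simp
    have i: "i < n" "t ''r'' 0 = i" "t ''n'' 0 = n" using 3(1,2) n fr by simp_all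
    let ?J = "\<lambda>k (t' :: store). (\<forall>r<i. \<forall>w<n. t' ''R'' (r * n + w) = f1 r w \<and> t' ''R'' ((n + r) * n + w) = f2 r w) \<and>
      (\<forall>w<k. t' ''R'' (i * n + w) = f1 i w \<and> t' ''R'' ((n + i) * n + w) = f2 i w)"
    have J: "?J (t ''n'' 0) (den ?l t)"
    proof (rule den_For[where I = ?J], goal_cases)
      case (3 k t')
      have fr': "t' y = s y" if "y \<notin> {''r'', ''w'', ''R'', ''b''}" for y using 3(3) that fr by simp
      have k: "k < n" "t' ''w'' 0 = k" "t' ''r'' 0 = i" "t' ''n'' 0 = n"
        using 3(1-3) i fr' n by simp_all
      have "aval F1 t' = f1 i k" using F12[of t'] fr' k i by simp
      moreover have "aval F2 (write_cell ''R'' (i * n + k) (f1 i k) t') = f2 i k"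
        using F12[of "write_cell ''R'' (i * n + k) (f1 i k) t'"] fr' k i by simp
      ultimately have "den ?inner t' ''R'' = (t' ''R'')(i * n + k := f1 i k, (n + i) * n + k := f2 i k)"
        using k by simp
      then show ?case using 3(4) k i by (auto simp: idx_inj less_Suc_eq)
    qed (use 3(4) in simp_all)
    let ?t1 = "den ?l t"
    have fr1: "?t1 y = s y" if "y \<notin> {''r'', ''w'', ''R'', ''b''}" for y using that fr by simp
    have i1: "?t1 ''r'' 0 = i" "?t1 ''n'' 0 = n" "?t1 ''b'' = t ''b''" using i by simp_all
    have a3: "aval F3 ?t1 = f3 i" using F34[of ?t1] fr1 i1 i by simp
    have a4: "aval F4 (write_cell ''b'' i (f3 i) ?t1) = f4 i"
      using F34[of "write_cell ''b'' i (f3 i) ?t1"] fr1 i1 i by simp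
    have "den (?l ;; PAssign ''b'' (var ''r'') F3 ;; PAssign ''b'' (Plus (var ''n'') (var ''r'')) F4) t =
       write_cell ''b'' (n + i) (f4 i) (write_cell ''b'' i (f3 i) ?t1)" (is "den ?body t = _")
      using i1 a3 a4 by simp
    then have "den ?body t ''R'' = ?t1 ''R''" "den ?body t ''b'' = (t ''b'')(i := f3 i, n + i := f4 i)"
      using i1(3) by simp_all
    then show ?case using J 3(4) i unfolding write_cell_apply by (auto simp: less_Suc_eq)
  qed simp_all
  then show ?thesis using n by simp
qed

lemma den_build_system:
  fixes s :: store and n :: nat
  assumes n: "s ''n'' 0 = n" and g: "\<And>r. r < n \<Longrightarrow> s ''g'' r < 2"
  defines "t \<equiv> den build_system s"
  defines "h \<equiv> \<lambda>r. (s ''g'' r + (\<Sum>w<n. s ''adj'' (r * n + w) * s ''t'' w)) mod 2"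
  shows "\<forall>r<n. (\<forall>w<n. t ''R'' (r * n + w) = of_bool (r = w \<and> (odd (s ''col'' r) \<or> h r = 0)) \<and>
      t ''R'' ((n + r) * n + w) = s ''adj'' (r * n + w) * (s ''col'' r mod 2 * of_bool (s ''t'' r = 0))) \<and>
    t ''b'' r = s ''col'' r mod 2 * s ''t'' r + of_bool (even (s ''col'' r)) * of_bool (h r = 0) \<and>
    t ''b'' (n + r) = s ''col'' r mod 2 * (of_bool (s ''t'' r = 0) * of_bool (s ''g'' r = 0))"
proof -
  let ?s = "den (dot ''t'') s"
  have h: "?s ''h'' r = h r" if "r < n" for r
    using den_dot[of "''t''" s] n g that by (simp add: h_def)
  have fr: "?s y = s y" if "y \<notin> {''r'', ''w'', ''s'', ''h''}" for y
    using that by (simp add: dot_def)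
  show ?thesis
    unfolding t_def build_system_def den.simps(2)
  proof (rule den_fill_rows, goal_cases)
    case (2 t)
    then have "t ''col'' = s ''col''" "t ''h'' = ?s ''h''" "t ''t'' = s ''t''" "t ''adj'' = s ''adj''" "t ''n'' 0 = n"
      using fr n by simp_all
    then show ?case using h[OF 2(2)] by (auto simp: mod_2_eq_odd)
  next
    case (3 t)
    then have "t ''col'' = s ''col''" "t ''h'' = ?s ''h''" "t ''t'' = s ''t''" "t ''g'' = s ''g''"
      using fr by simp_all
    then show ?case using h[OF 3(2)] by (simp add: mod_2_eq_odd)
  qed (use fr n in simp)
qed

lemma den_build_laplacian:
  fixes s :: store and n :: nat
  assumes n: "s ''n'' 0 = n" and g: "\<And>r. r < n \<Longrightarrow> s ''g'' r < 2"
  defines "t \<equiv> den build_laplacian s"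
  defines "h \<equiv> \<lambda>r. (s ''g'' r + (\<Sum>w<n. s ''adj'' (r * n + w) * s ''x'' w)) mod 2"
  shows "\<forall>r<n. (\<forall>w<n. t ''R'' (r * n + w) = (s ''adj'' (r * n + w) * s ''x'' w * of_bool (r \<noteq> w \<and> w \<noteq> 0) +
        of_bool (r = w) * h r) mod 2 \<and> t ''R'' ((n + r) * n + w) = 0) \<and>
    t ''b'' r = 0 \<and> t ''b'' (n + r) = 0"
proof -
  let ?s = "den (dot ''x'') s"
  have h: "?s ''h'' r = h r" if "r < n" for r
    using den_dot[of "''x''" s] n g that by (simp add: h_def)
  have fr: "?s y = s y" if "y \<notin> {''r'', ''w'', ''s'', ''h''}" for y
    using that by (simp add: dot_def)
  show ?thesis
    unfolding t_def build_laplacian_def den.simps(2)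
    by (rule den_fill_rows) (use n fr h in auto)
qed

lemma den_count_solutions:
  fixes s :: store and m n :: nat
  assumes "s ''m'' 0 = m" "s ''n'' 0 = n" "\<And>r. r < m \<Longrightarrow> s ''b'' r < 2"
  defines "t \<equiv> den count_solutions s" and "k \<equiv> count_below (\<lambda>j. s ''V'' j = 0)"
  shows "\<forall>j\<le>n. t ''Q'' j = 2 ^ k j"
    and "t ''q'' 0 = 2 ^ k n * of_bool (\<forall>r<m. s ''U'' r = 0 \<longrightarrow> s ''b'' r = 0)"
proof -
  let ?s0 = "write_cell ''Q'' 0 1 s"
  let ?l1 = "PFor ''j'' ''n'' (PAssign ''Q'' (Plus (var ''j'') (N 1))
       (Times (Cell ''Q'' (var ''j'')) (Plus (N 1) (neg (Cell ''V'' (var ''j''))))))"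
  let ?s1 = "den ?l1 ?s0"
  let ?s2 = "write_cell ''q'' 0 (?s1 ''Q'' n) ?s1"
  let ?l2 = "PFor ''r'' ''m'' (PAssign ''q'' (N 0) (Times (var ''q'')
       (neg (Times (neg (Cell ''U'' (var ''r''))) (Cell ''b'' (var ''r''))))))"
  let ?I = "\<lambda>i (t :: store). \<forall>j\<le>i. t ''Q'' j = 2 ^ k j"
  have "?I (?s0 ''n'' 0) ?s1"
  proof (rule den_For[where I = ?I], goal_cases)
    case (3 i t)
    have "t ''V'' = s ''V''" using 3(3) by simp
    then show ?case using 3(2,4) by (auto simp: le_Suc_eq k_def count_below_Suc)
  qed (simp_all add: k_def)
  then have Q: "\<forall>j\<le>n. ?s1 ''Q'' j = 2 ^ k j" using assms(2) by simp
  let ?I2 = "\<lambda>i (t :: store). t ''q'' 0 = 2 ^ k n * of_bool (\<forall>r<i. s ''U'' r = 0 \<longrightarrow> s ''b'' r = 0)"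
  have "?I2 (?s2 ''m'' 0) (den ?l2 ?s2)"
  proof (rule den_For[where I = ?I2], goal_cases)
    case (3 i t)
    have "t ''U'' = s ''U''" "t ''b'' = s ''b''" using 3(3) by simp_all
    then show ?case using 3(2,4) by (simp add: less_Suc_eq) auto
  qed (use Q in simp_all)
  moreover have "t = den ?l2 ?s2"
    using assms(2) by (simp add: t_def count_solutions_def)
  ultimately show "t ''q'' 0 = 2 ^ k n * of_bool (\<forall>r<m. s ''U'' r = 0 \<longrightarrow> s ''b'' r = 0)"
    "\<forall>j\<le>n. t ''Q'' j = 2 ^ k j"
    using Q assms(1) by simp_all
qed

lemma den_copy_vector:
  fixes s :: store
  assumes "x \<noteq> y" "i \<noteq> x" "i \<noteq> y" "y \<noteq> b"
  shows "\<forall>k<s b 0. den (PFor i b (PAssign x (var i) (Cell y (var i)))) s x k = s y k"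
proof (rule den_For[where I = "\<lambda>j (t :: store). \<forall>k<j. t x k = s y k"], goal_cases)
  case (3 j t)
  have "t y = s y" using 3(3) assms by simp
  then show ?case using 3(2,4) assms by (simp add: less_Suc_eq)
qed (use assms in simp_all)

lemma den_save_system:
  fixes s :: store and m n :: nat
  assumes m: "s ''m'' 0 = m" and n: "s ''n'' 0 = n"
  defines "t \<equiv> den save_system s"
  shows "\<forall>r<m. (\<forall>w<n. t ''R2'' (r * n + w) = s ''R'' (r * n + w)) \<and> t ''b2'' r = s ''b'' r"
    and "\<forall>j<n. t ''V2'' j = s ''V'' j"
proof -
  let ?inner = "PAssign ''R2'' (idx (var ''r'') (var ''w'')) (Cell ''R'' (idx (var ''r'') (var ''w'')))"
  let ?l = "PFor ''w'' ''n'' ?inner"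
  let ?r = "PFor ''r'' ''m'' (?l ;; PAssign ''b2'' (var ''r'') (Cell ''b'' (var ''r'')))"
  let ?I = "\<lambda>i (t :: store). \<forall>r<i. (\<forall>w<n. t ''R2'' (r * n + w) = s ''R'' (r * n + w)) \<and> t ''b2'' r = s ''b'' r"
  have "?I (s ''m'' 0) (den ?r s)"
  proof (rule den_For[where I = ?I], goal_cases)
    case (3 i t)
    have fr: "t ''R'' = s ''R''" "t ''b'' = s ''b''" "t ''n'' = s ''n''" using 3(3) by simp_all
    let ?J = "\<lambda>k (t' :: store). (\<forall>r<i. \<forall>w<n. t' ''R2'' (r * n + w) = s ''R'' (r * n + w)) \<and>
      (\<forall>w<k. t' ''R2'' (i * n + w) = s ''R'' (i * n + w))"
    have J: "?J (t ''n'' 0) (den ?l t)"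
    proof (rule den_For[where I = ?J], goal_cases)
      case (3 k t')
      have k: "k < n" "t' ''w'' 0 = k" "t' ''r'' 0 = i" "t' ''n'' 0 = n" "t' ''R'' = s ''R''"
        using 3(1-3) \<open>t ''r'' 0 = i\<close> fr n by simp_all
      then have "den ?inner t' ''R2'' = (t' ''R2'')(i * n + k := s ''R'' (i * n + k))" by simp
      then show ?case using 3(4) k by (auto simp: idx_inj less_Suc_eq)
    qed (use 3(4) in simp_all)
    moreover have "den (?l ;; PAssign ''b2'' (var ''r'') (Cell ''b'' (var ''r''))) t ''b2'' = (t ''b2'')(i := s ''b'' i)"
      "den (?l ;; PAssign ''b2'' (var ''r'') (Cell ''b'' (var ''r''))) t ''R2'' = den ?l t ''R2''"
      using 3(2) fr by simp_all
    ultimately show ?case using 3(4) fr n unfolding write_cell_apply by (simp add: less_Suc_eq)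
  qed simp_all
  then have rows: "\<forall>r<m. (\<forall>w<n. den ?r s ''R2'' (r * n + w) = s ''R'' (r * n + w)) \<and> den ?r s ''b2'' r = s ''b'' r"
    unfolding m .
  have R2: "t ''R2'' = den ?r s ''R2''"
    unfolding t_def save_system_def den.simps(2) by (rule den_frame) simp
  have b2: "t ''b2'' = den ?r s ''b2''"
    unfolding t_def save_system_def den.simps(2) by (rule den_frame) simp
  show "\<forall>r<m. (\<forall>w<n. t ''R2'' (r * n + w) = s ''R'' (r * n + w)) \<and> t ''b2'' r = s ''b'' r"
    unfolding R2 b2 by (rule rows)
  have "\<forall>k<den ?r s ''n'' 0. t ''V2'' k = den ?r s ''V'' k"
    unfolding t_def save_system_def den.simps(2)
    by (rule den_copy_vector[where s = "den ?r s" and x = "''V2''" and y = "''V''" and i = "''j''" and b = "''n''"]) simp_all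
  moreover have "den ?r s ''n'' = s ''n''" "den ?r s ''V'' = s ''V''"
    by (rule den_frame, simp)+
  ultimately show "\<forall>j<n. t ''V2'' j = s ''V'' j" unfolding n by (simp only: n)
qed

lemma den_compute_solution:
  fixes s :: store and n :: nat
  assumes n: "s ''n'' 0 = n" and b2: "\<And>j. j < n \<Longrightarrow> s ''V2'' j \<noteq> 0 \<Longrightarrow> s ''b2'' (s ''V2'' j - 1) < 2"
  defines "t \<equiv> den compute_solution s"
  defines "y \<equiv> \<lambda>j. s ''e'' 0 div s ''Q'' j mod 2 * of_bool (s ''V2'' j = 0)"
  shows "\<forall>j<n. t ''x'' j = (if s ''V2'' j = 0 then y j else
    (s ''b2'' (s ''V2'' j - 1) + (\<Sum>w<n. s ''R2'' ((s ''V2'' j - 1) * n + w) * y w)) mod 2)"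
proof -
  let ?l1 = "PFor ''j'' ''n'' (PAssign ''y'' (var ''j'')
       (Times (mod2 (Div (var ''e'') (Cell ''Q'' (var ''j'')))) (neg (Cell ''V2'' (var ''j'')))))"
  let ?s1 = "den ?l1 s"
  let ?I = "\<lambda>i (t :: store). \<forall>j<i. t ''y'' j = y j"
  have "?I (s ''n'' 0) ?s1"
  proof (rule den_For[where I = ?I], goal_cases)
    case (3 i t)
    have "t ''V2'' = s ''V2''" "t ''e'' = s ''e''" "t ''Q'' = s ''Q''" using 3(3) by simp_all
    then show ?case using 3(2,4) by (simp add: less_Suc_eq y_def)
  qed simp_all
  then have y: "\<And>j. j < n \<Longrightarrow> ?s1 ''y'' j = y j" using n by simp
  let ?F = "Times (Cell ''R2'' (idx row2 (var ''w''))) (Cell ''y'' (var ''w''))"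
  let ?sum = "PFor ''w'' ''n'' (PAssign ''s'' (N 0) (mod2 (Plus (var ''s'') ?F)))"
  let ?x = "\<lambda>j. if s ''V2'' j = 0 then y j else
    (s ''b2'' (s ''V2'' j - 1) + (\<Sum>w<n. s ''R2'' ((s ''V2'' j - 1) * n + w) * y w)) mod 2"
  let ?I2 = "\<lambda>i (t :: store). \<forall>j<i. t ''x'' j = ?x j"
  let ?body = "PIf (Cell ''V2'' (var ''j''))
         (PAssign ''s'' (N 0) (Cell ''b2'' row2) ;; ?sum ;; PAssign ''x'' (var ''j'') (var ''s''))
         (PAssign ''x'' (var ''j'') (Cell ''y'' (var ''j'')))"
  have "?I2 (?s1 ''n'' 0) (den (PFor ''j'' ''n'' ?body) ?s1)"
  proof (rule den_For[where I = ?I2], goal_cases)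
    case (3 j t)
    have fr: "t ''n'' = s ''n''" "t ''V2'' = s ''V2''" "t ''R2'' = s ''R2''" "t ''b2'' = s ''b2''" "t ''y'' = ?s1 ''y''"
      using 3(3) by simp_all
    have j: "j < n" using 3(1) n by simp
    have "den ?body t ''x'' = (t ''x'')(j := ?x j)"
    proof (cases "s ''V2'' j = 0")
      case True
      then show ?thesis using fr 3(2) y[OF j] by simp
    next
      case False
      let ?t1 = "write_cell ''s'' 0 (s ''b2'' (s ''V2'' j - 1)) t"
      have "den ?sum ?t1 ''s'' 0 = (?t1 ''s'' 0 + (\<Sum>w<?t1 ''n'' 0. s ''R2'' ((s ''V2'' j - 1) * n + w) * y w)) mod 2"
        using fr 3(2) y n b2[OF j False] by (intro den_sum_loop) (simp_all add: row2_def)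
      then have sum: "den ?sum ?t1 ''s'' 0 = ?x j" using fr n False by simp
      have "den ?body t = write_cell ''x'' (den ?sum ?t1 ''j'' 0) (den ?sum ?t1 ''s'' 0) (den ?sum ?t1)"
        using False fr 3(2) by (simp add: row2_def)
      also have "den ?sum ?t1 ''j'' 0 = j" using 3(2) by simp
      finally show ?thesis unfolding sum by simp
    qed
    then show ?case using 3(4) unfolding write_cell_apply by (simp add: less_Suc_eq)
  qed simp_all
  then show ?thesis using n unfolding t_def compute_solution_def by simp
qed

lemma den_add_determinant:
  fixes s :: store and n :: nat
  assumes n: "s ''n'' 0 = n"
  shows "den add_determinant s ''out'' 0 = (s ''out'' 0 + of_bool (\<forall>j<n. s ''V'' j \<noteq> 0)) mod 2"
proof -
  let ?l = "PFor ''j'' ''n'' (PAssign ''d'' (N 0) (Times (var ''d'') (neg (neg (Cell ''V'' (var ''j''))))))"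
  let ?s = "write_cell ''d'' 0 1 s"
  let ?I = "\<lambda>i (t :: store). t ''d'' 0 = of_bool (\<forall>j<i. s ''V'' j \<noteq> 0)"
  have "?I (?s ''n'' 0) (den ?l ?s)"
  proof (rule den_For[where I = ?I], goal_cases)
    case (3 i t)
    have "t ''V'' = s ''V''" using 3(3) by simp
    then show ?case using 3(2,4) by (simp add: less_Suc_eq) auto
  qed simp_all
  then show ?thesis using n by (simp add: add_determinant_def)
qed

lemma den_decode_assignment:
  fixes s :: store and n :: nat
  assumes n: "s ''n'' 0 = n" and P: "\<forall>v<n. s ''P'' v = 2 ^ count_below (\<lambda>v. odd (s ''col'' v)) v"
  shows "\<forall>v<n. den decode_assignment s ''t'' v =
    of_bool (odd (s ''col'' v) \<and> odd (s ''c'' 0 div 2 ^ count_below (\<lambda>v. odd (s ''col'' v)) v))"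
proof -
  let ?I = "\<lambda>i (t :: store). \<forall>v<i. t ''t'' v =
    of_bool (odd (s ''col'' v) \<and> odd (s ''c'' 0 div 2 ^ count_below (\<lambda>v. odd (s ''col'' v)) v))"
  have "?I (s ''n'' 0) (den decode_assignment s)"
    unfolding decode_assignment_def
  proof (rule den_For[where I = ?I], goal_cases)
    case (3 i t)
    have "t ''P'' = s ''P''" "t ''c'' = s ''c''" "t ''col'' = s ''col''" using 3(3) by simp_all
    then show ?case using 3(1,2,4) P n by (simp add: less_Suc_eq mod_2_eq_odd)
  qed simp_all
  then show ?thesis using n by simp
qed

lemma den_count_colours:
  fixes s :: store and n :: nat
  assumes n: "s ''n'' 0 = n" and c: "s ''c1'' 0 = 0" "s ''c2'' 0 = 0"
  defines "t \<equiv> den count_colours s" and "k \<equiv> count_below (\<lambda>v. odd (s ''col'' v))"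
  shows "\<forall>v\<le>n. t ''P'' v = 2 ^ k v \<and> t ''c1'' v = k v \<and> t ''c2'' v = (\<Sum>u<v. s ''col'' u div 2)"
proof -
  let ?s = "write_cell ''P'' 0 1 s"
  let ?I = "\<lambda>i (t :: store). \<forall>v\<le>i. t ''P'' v = 2 ^ k v \<and> t ''c1'' v = k v \<and> t ''c2'' v = (\<Sum>u<v. s ''col'' u div 2)"
  let ?l = "PFor ''v'' ''n'' (
       PAssign ''P'' (Plus (var ''v'') (N 1))
         (Times (Cell ''P'' (var ''v'')) (Plus (N 1) (mod2 (Cell ''col'' (var ''v''))))) ;;
       PAssign ''c1'' (Plus (var ''v'') (N 1)) (Plus (Cell ''c1'' (var ''v'')) (mod2 (Cell ''col'' (var ''v'')))) ;;
       PAssign ''c2'' (Plus (var ''v'') (N 1)) (Plus (Cell ''c2'' (var ''v'')) (Div (Cell ''col'' (var ''v'')) (N 2))))"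
  have "?I (?s ''n'' 0) (den ?l ?s)"
  proof (rule den_For[where I = ?I], goal_cases)
    case (3 i t)
    have "t ''col'' = s ''col''" using 3(3) by simp
    then show ?case using 3(2,4) by (simp add: le_Suc_eq k_def count_below_Suc mod_2_eq_odd)
  qed (use c in \<open>simp_all add: k_def\<close>)
  then show ?thesis using n by (simp add: t_def count_colours_def)
qed

section \<open>Alive sets as solutions of a linear system\<close>

lemma all_less_double: "(\<forall>r<2 * n. P r) \<longleftrightarrow> (\<forall>r<n. P r \<and> P (n + r))" for n :: nat
proof
  assume L: "\<forall>r<n. P r \<and> P (n + r)"
  show "\<forall>r<2 * n. P r"
  proof (intro allI impI)
    fix r assume "r < 2 * n"
    then show "P r" using L by (cases "r < n") (auto dest: spec[of _ "r - n"])
  qed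
qed auto

lemma bit_eq_1_add_iff: "a = 1 + b \<longleftrightarrow> b + a = (1 :: bit)"
  by (cases a; cases b) auto

text \<open>\<open>indep\<close> makes the condition linear: a row outside \<open>M\<close> has arcs
  into \<open>M\<close> only, so its diagonal entry is the known bit \<open>h r\<close>, and the
  condition at \<open>r\<close> is either void or forces \<open>r\<close> into \<open>X\<close>. At
  a vertex of \<open>M\<close> outside \<open>T\<close> the entry has to be 1, which is a linear
  equation for \<open>X\<close>.\<close>

lemma sat_system_iff:
  fixes A :: "nat \<Rightarrow> nat \<Rightarrow> bit" and g :: "nat \<Rightarrow> bit"
  assumes MT: "M \<subseteq> {..<n}" "T \<subseteq> M" and X: "X \<subseteq> {..<n}"
    and indep: "\<And>u v. u < n \<Longrightarrow> v < n \<Longrightarrow> u \<notin> M \<Longrightarrow> A u v = 1 \<Longrightarrow> v \<in> M"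
    and R1: "\<And>r w. r < n \<Longrightarrow> w < n \<Longrightarrow> R r w = of_bool (r = w \<and> (r \<in> M \<or> h r = 0))"
    and R2: "\<And>r w. r < n \<Longrightarrow> w < n \<Longrightarrow> R (n + r) w = A r w * of_bool (r \<in> M \<and> r \<notin> T)"
    and b1: "\<And>r. r < n \<Longrightarrow> b r = of_bool (if r \<in> M then r \<in> T else h r = 0)"
    and b2: "\<And>r. r < n \<Longrightarrow> b (n + r) = of_bool (r \<in> M \<and> r \<notin> T) * (1 + g r)"
    and h: "\<And>r. r < n \<Longrightarrow> h r = g r + (\<Sum>w<n. A r w * ind T w)"
  shows "sat (2 * n) n R b (ind X) \<longleftrightarrow> X \<in> alive n A g \<and> X \<inter> M = T"
proof -
  have row1: "(\<Sum>w<n. R r w * ind X w) = b r \<longleftrightarrow> (if r \<in> M then r \<in> X \<longleftrightarrow> r \<in> T else h r = 0 \<longrightarrow> r \<in> X)"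
    if r: "r < n" for r
  proof -
    have "(\<Sum>w<n. R r w * ind X w) = (\<Sum>w<n. if w = r then of_bool (r \<in> M \<or> h r = 0) * ind X r else 0)"
      using R1[OF r] by (intro sum.cong) auto
    also have "\<dots> = of_bool (r \<in> M \<or> h r = 0) * ind X r" using r by simp
    finally show ?thesis using b1[OF r] by auto
  qed
  have row2: "(\<Sum>w<n. R (n + r) w * ind X w) = b (n + r) \<longleftrightarrow>
      (r \<in> M \<and> r \<notin> T \<longrightarrow> g r + (\<Sum>w<n. A r w * ind X w) = 1)" if r: "r < n" for r
  proof (cases "r \<in> M \<and> r \<notin> T")
    case True
    then have "(\<Sum>w<n. R (n + r) w * ind X w) = (\<Sum>w<n. A r w * ind X w)"
      using R2[OF r] by (intro sum.cong) auto
    moreover have "b (n + r) = 1 + g r" using b2[OF r] True by (cases "g r") simp_all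
    ultimately show ?thesis using True bit_eq_1_add_iff by metis
  next
    case False
    then have "(\<Sum>w<n. R (n + r) w * ind X w) = 0"
      using R2[OF r] by (intro sum.neutral) auto
    then show ?thesis using b2[OF r] False by auto
  qed
  have hX: "g r + (\<Sum>w<n. A r w * ind X w) = h r" if r: "r < n" "r \<notin> M" "X \<inter> M = T" for r
  proof -
    have "(\<Sum>w<n. A r w * ind X w) = (\<Sum>w<n. A r w * ind T w)"
    proof (intro sum.cong refl)
      fix w assume "w \<in> {..<n}"
      then show "A r w * ind X w = A r w * ind T w"
        using indep[of r w] r by (cases "A r w") auto
    qed
    then show ?thesis using h[OF r(1)] by simp
  qed
  have "sat (2 * n) n R b (ind X) \<longleftrightarrow>
      (\<forall>r<n. (if r \<in> M then r \<in> X \<longleftrightarrow> r \<in> T else h r = 0 \<longrightarrow> r \<in> X) \<and>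
        (r \<in> M \<and> r \<notin> T \<longrightarrow> g r + (\<Sum>w<n. A r w * ind X w) = 1))" (is "_ \<longleftrightarrow> ?Q")
    unfolding sat_def all_less_double using row1 row2 by simp
  also have "?Q \<longleftrightarrow> X \<in> alive n A g \<and> X \<inter> M = T"
  proof
    assume Q: ?Q
    then have XM: "X \<inter> M = T" using MT X by (auto split: if_splits)
    have "g v + (\<Sum>w<n. A v w * ind X w) = 1" if v: "v < n" "v \<notin> X" for v
    proof (cases "v \<in> M")
      case True
      then show ?thesis using Q v XM by auto
    next
      case False
      then have "h v \<noteq> 0" using Q v by auto
      then show ?thesis using hX[OF v(1) False XM] by simp
    qed
    then show "X \<in> alive n A g \<and> X \<inter> M = T" using X XM by (simp add: alive_def)
  next
    assume L: "X \<in> alive n A g \<and> X \<inter> M = T"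
    then have XM: "X \<inter> M = T" and al: "\<And>v. v < n \<Longrightarrow> v \<notin> X \<Longrightarrow> g v + (\<Sum>w<n. A v w * ind X w) = 1"
      by (auto simp: alive_def)
    show ?Q
    proof (intro allI impI conjI)
      fix r assume r: "r < n"
      show "if r \<in> M then r \<in> X \<longleftrightarrow> r \<in> T else h r = 0 \<longrightarrow> r \<in> X"
      proof (cases "r \<in> M")
        case False
        have "r \<in> X" if "h r = 0" using al[OF r] hX[OF r False XM] that by (metis zero_neq_one)
        then show ?thesis using False by simp
      qed (use XM in auto)
      assume "r \<in> M \<and> r \<notin> T"
      then show "g r + (\<Sum>w<n. A r w * ind X w) = 1" using al[OF r] XM by blast
    qed
  qed
  finally show ?thesis .
qed

definition input_ok :: "nat \<Rightarrow> (nat \<Rightarrow> nat \<Rightarrow> bool) \<Rightarrow> (nat \<Rightarrow> bool) \<Rightarrow> store \<Rightarrow> bool" where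
  "input_ok n E g s \<longleftrightarrow> s ''n'' 0 = n \<and> s ''m'' 0 = 2 * n \<and>
     (\<forall>u<n. \<forall>v<n. s ''adj'' (u * n + v) = of_bool (E u v)) \<and> (\<forall>v<n. s ''g'' v = of_bool (g v))"

lemma input_ok_cong:
  assumes "\<And>y. y \<in> {''n'', ''m'', ''adj'', ''g''} \<Longrightarrow> t y = s y"
  shows "input_ok n E g t \<longleftrightarrow> input_ok n E g s"
  using assms by (simp add: input_ok_def)

lemma of_bool_of_nat [simp]: "of_nat (of_bool P) = of_bool P"
  by (simp add: of_bool_def)

definition colour_class :: "nat \<Rightarrow> store \<Rightarrow> nat set" where
  "colour_class n s = {v. v < n \<and> odd (s ''col'' v)}"

definition chosen :: "nat \<Rightarrow> store \<Rightarrow> nat set" where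
  "chosen n s = {v. v < n \<and> odd (s ''col'' v) \<and> odd (s ''c'' 0 div 2 ^ count_below (\<lambda>v. odd (s ''col'' v)) v)}"

abbreviation adj_bit :: "(nat \<Rightarrow> nat \<Rightarrow> bool) \<Rightarrow> nat \<Rightarrow> nat \<Rightarrow> bit" where
  "adj_bit E \<equiv> \<lambda>u v. of_bool (E u v)"

abbreviation mask_bit :: "(nat \<Rightarrow> bool) \<Rightarrow> nat \<Rightarrow> bit" where
  "mask_bit g \<equiv> \<lambda>v. of_bool (g v)"

text \<open>What the enumeration relies on, stated for memories that \<open>process_solution\<close>
  does not write. The set \<open>U\<close> of pivot rows is quantified because its memory is
  overwritten by the next elimination.\<close>

definition solved :: "nat \<Rightarrow> nat set set \<Rightarrow> store \<Rightarrow> bool" where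
  "solved n S t \<longleftrightarrow> (\<exists>U. row_reduced (2 * n) n (matrix_of n t ''R2'') U (t ''V2'') \<and>
     (\<forall>X\<subseteq>{..<n}. sat (2 * n) n (matrix_of n t ''R2'') (vector_of t ''b2'') (ind X) \<longleftrightarrow> X \<in> S)) \<and>
     (\<forall>r<2 * n. t ''b2'' r < 2) \<and>
     (\<forall>j<n. t ''Q'' j = 2 ^ count_below (\<lambda>j. t ''V2'' j = 0) j)"

lemma count_below_cong: "(\<And>u. u < v \<Longrightarrow> P u = Q u) \<Longrightarrow> count_below P v = count_below Q v"
  unfolding count_below_def by (rule arg_cong[where f = card]) auto

lemma row_reduced_cong_V:
  assumes "row_reduced m n R U V" "\<And>j. j < n \<Longrightarrow> V' j = V j"
  shows "row_reduced m n R U V'"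
proof (rule row_reducedI)
  note V = assms(2)
  show "V' j \<le> m \<and> U (V' j - 1) \<and> (\<forall>r<m. R r j = of_bool (r = V' j - 1))" if "j < n" "V' j \<noteq> 0" for j
    using row_reduced_pivotD[OF assms(1) that(1)] that(2) unfolding V[OF that(1)] by blast
  show "i = j" if "i < n" "j < n" "V' i \<noteq> 0" "V' i = V' j" for i j
    using row_reduced_inj[OF assms(1) that(1,2)] that(3,4) unfolding V[OF that(1)] V[OF that(2)] by blast
  show "R r j = 0" if "r < m" "\<not> U r" "j < n" for r j
    by (rule row_reduced_unused[OF assms(1) that])
  show "\<exists>j<n. V' j = Suc r" if "r < m" "U r" for r
    using row_reduced_used[OF assms(1) that] V by auto
qed

lemma den_solve_system:
  fixes s :: store and n :: nat
  assumes inp: "input_ok n E g s"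
    and P: "\<forall>v<n. s ''P'' v = 2 ^ count_below (\<lambda>v. odd (s ''col'' v)) v"
    and indep: "\<And>u v. u < n \<Longrightarrow> v < n \<Longrightarrow> E u v \<Longrightarrow> u \<notin> colour_class n s \<Longrightarrow> v \<in> colour_class n s"
  defines "S \<equiv> {X \<in> alive n (adj_bit E) (mask_bit g). X \<inter> colour_class n s = chosen n s}"
  defines "t \<equiv> den solve_system s"
  shows "solved n S t" and "t ''q'' 0 = card S"
proof -
  define s1 where "s1 = den decode_assignment s"
  define s2 where "s2 = den build_system s1"
  define s3 where "s3 = den eliminate s2"
  define s4 where "s4 = den count_solutions s3"
  have t: "t = den save_system s4"
    by (simp add: t_def solve_system_def s1_def s2_def s3_def s4_def)
  have n: "s ''n'' 0 = n" and m: "s ''m'' 0 = 2 * n" using inp by (auto simp: input_ok_def)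
  have w1: "writes decode_assignment = {''v'', ''t''}" by (simp add: decode_assignment_def)
  have w2: "writes build_system = {''r'', ''s'', ''w'', ''h'', ''R'', ''b''}"
    by (auto simp: build_system_def dot_def)
  have w3: "writes eliminate = {''r'', ''U'', ''j'', ''p'', ''V'', ''w'', ''R'', ''b''}"
    by (auto simp: eliminate_def find_pivot_def clear_column_def)
  have w4: "writes count_solutions = {''Q'', ''j'', ''q'', ''r''}"
    by (auto simp: count_solutions_def)
  have w5: "writes save_system = {''r'', ''w'', ''R2'', ''b2'', ''j'', ''V2''}"
    by (auto simp: save_system_def)
  let ?M = "colour_class n s" and ?T = "chosen n s"
  have inp1: "input_ok n E g s1" using inp by (subst input_ok_cong[of _ s]) (auto simp: s1_def w1)
  have col1: "s1 ''col'' = s ''col''" by (simp add: s1_def w1)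
  have t1: "s1 ''t'' v = of_bool (v \<in> ?T)" if "v < n" for v
    using den_decode_assignment[OF n P] that by (simp add: s1_def chosen_def)
  have n1: "s1 ''n'' 0 = n" and g1: "\<And>r. r < n \<Longrightarrow> s1 ''g'' r = of_bool (g r)"
    and adj1: "\<And>u v. u < n \<Longrightarrow> v < n \<Longrightarrow> s1 ''adj'' (u * n + v) = of_bool (E u v)"
    using inp1 by (auto simp: input_ok_def)
  define h where "h = (\<lambda>r. (s1 ''g'' r + (\<Sum>w<n. s1 ''adj'' (r * n + w) * s1 ''t'' w)) mod 2)"
  have build: "\<forall>r<n. (\<forall>w<n. s2 ''R'' (r * n + w) = of_bool (r = w \<and> (odd (s1 ''col'' r) \<or> h r = 0)) \<and>
      s2 ''R'' ((n + r) * n + w) = s1 ''adj'' (r * n + w) * (s1 ''col'' r mod 2 * of_bool (s1 ''t'' r = 0))) \<and>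
    s2 ''b'' r = s1 ''col'' r mod 2 * s1 ''t'' r + of_bool (even (s1 ''col'' r)) * of_bool (h r = 0) \<and>
    s2 ''b'' (n + r) = s1 ''col'' r mod 2 * (of_bool (s1 ''t'' r = 0) * of_bool (s1 ''g'' r = 0))"
    using den_build_system[of s1 n] n1 g1 unfolding s2_def h_def by (simp del: One_nat_def)
  have odd_col: "odd (s1 ''col'' r) \<longleftrightarrow> r \<in> ?M" if "r < n" for r
    using that by (simp add: col1 colour_class_def)
  have h_bit: "of_nat (h r) = mask_bit g r + (\<Sum>w<n. adj_bit E r w * ind ?T w)" if r: "r < n" for r
  proof -
    have "of_nat (h r) = (of_nat (s1 ''g'' r) + (\<Sum>w<n. of_nat (s1 ''adj'' (r * n + w)) * of_nat (s1 ''t'' w)) :: bit)"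
      by (simp add: h_def)
    also have "(\<Sum>w<n. of_nat (s1 ''adj'' (r * n + w)) * of_nat (s1 ''t'' w)) = (\<Sum>w<n. adj_bit E r w * ind ?T w)"
      using adj1[OF r] t1 by (intro sum.cong) auto
    finally show ?thesis using g1[OF r] by simp
  qed
  have h2: "h r < 2" for r by (simp add: h_def)
  have TM: "?T \<subseteq> ?M" "?M \<subseteq> {..<n}" by (auto simp: chosen_def colour_class_def)
  have b2: "s2 ''b'' r = of_bool (if r \<in> ?M then r \<in> ?T else h r = 0)"
      "s2 ''b'' (n + r) = of_bool (r \<in> ?M \<and> r \<notin> ?T \<and> \<not> g r)" if "r < n" for r
    using build that odd_col[OF that] t1[OF that] g1[OF that] by (auto simp: mod_2_eq_odd)
  have R2: "s2 ''R'' (r * n + w) = of_bool (r = w \<and> (r \<in> ?M \<or> h r = 0))"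
      "s2 ''R'' ((n + r) * n + w) = of_bool (E r w \<and> r \<in> ?M \<and> r \<notin> ?T)" if "r < n" "w < n" for r w
    using build that odd_col[OF that(1)] t1[OF that(1)] adj1[OF that] by (auto simp: mod_2_eq_odd)
  have sat2: "sat (2 * n) n (matrix_of n s2 ''R'') (vector_of s2 ''b'') (ind X) \<longleftrightarrow> X \<in> S"
    if X: "X \<subseteq> {..<n}" for X
  proof -
    have "sat (2 * n) n (matrix_of n s2 ''R'') (vector_of s2 ''b'') (ind X) \<longleftrightarrow>
        X \<in> alive n (adj_bit E) (mask_bit g) \<and> X \<inter> ?M = ?T"
    proof (rule sat_system_iff[where h = "\<lambda>r. of_nat (h r)", OF TM(2,1) X])
      show "v \<in> ?M" if "u < n" "v < n" "u \<notin> ?M" "adj_bit E u v = 1" for u v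
        using indep[of u v] that by simp
      have h0: "of_nat (h r) = (0 :: bit) \<longleftrightarrow> h r = 0" for r using of_nat_bit_eq_0[OF h2] .
      show "matrix_of n s2 ''R'' r w = of_bool (r = w \<and> (r \<in> ?M \<or> of_nat (h r) = (0 :: bit)))"
        if "r < n" "w < n" for r w
        unfolding h0 matrix_of_def R2(1)[OF that] by (rule of_bool_of_nat)
      show "matrix_of n s2 ''R'' (n + r) w = adj_bit E r w * of_bool (r \<in> ?M \<and> r \<notin> ?T)"
        if "r < n" "w < n" for r w
        unfolding matrix_of_def R2(2)[OF that] of_bool_of_nat by (simp only: of_bool_conj)
      show "vector_of s2 ''b'' r = of_bool (if r \<in> ?M then r \<in> ?T else of_nat (h r) = (0 :: bit))"
        if "r < n" for r
        unfolding h0 vector_of_def b2(1)[OF that] by (rule of_bool_of_nat)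
      show "vector_of s2 ''b'' (n + r) = of_bool (r \<in> ?M \<and> r \<notin> ?T) * (1 + mask_bit g r)" if "r < n" for r
        unfolding vector_of_def b2(2)[OF that] by (cases "g r") simp_all
    qed (rule h_bit)
    then show ?thesis by (simp add: S_def)
  qed
  have nm2: "s2 ''m'' 0 = 2 * n" "s2 ''n'' 0 = n"
    using inp1 by (simp_all add: s2_def w2 input_ok_def)
  have "binary (2 * n) n s2"
    unfolding binary_def all_less_double using R2 b2 by simp
  note elim = den_eliminate[of s2 "2 * n" n, OF nm2 this, folded s3_def]
  have nm3: "s3 ''m'' 0 = 2 * n" "s3 ''n'' 0 = n" using nm2 by (simp_all add: s3_def w3)
  have b3: "s3 ''b'' r < 2" if "r < 2 * n" for r using elim(3) that by (simp add: binary_def)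
  note cs = den_count_solutions[of s3 "2 * n" n, OF nm3 b3, folded s4_def]
  have fr4: "s4 ''R'' = s3 ''R''" "s4 ''b'' = s3 ''b''" "s4 ''V'' = s3 ''V''" "s4 ''m'' 0 = 2 * n" "s4 ''n'' 0 = n"
    using nm3 by (simp_all add: s4_def w4)
  note sv = den_save_system[of s4 "2 * n" n, OF fr4(4,5), folded t]
  have fr5: "t ''Q'' = s4 ''Q''" "t ''q'' = s4 ''q''" by (simp_all add: t w5)
  have Rt: "matrix_of n t ''R2'' r w = matrix_of n s3 ''R'' r w" if "r < 2 * n" "w < n" for r w
    using sv(1) that fr4 by (simp add: matrix_of_def)
  have bt: "vector_of t ''b2'' r = vector_of s3 ''b'' r" "t ''b2'' r < 2" if "r < 2 * n" for r
    using sv(1) that fr4 b3[OF that] by (simp_all add: vector_of_def)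
  have Vt: "t ''V2'' j = s3 ''V'' j" if "j < n" for j using sv(2) that fr4 by simp
  have red: "row_reduced (2 * n) n (matrix_of n t ''R2'') (\<lambda>r. s3 ''U'' r \<noteq> 0) (t ''V2'')"
    by (rule row_reduced_cong_V[OF row_reduced_cong[OF elim(1)]]) (use Rt Vt in auto)
  have satt: "sat (2 * n) n (matrix_of n t ''R2'') (vector_of t ''b2'') (ind X) \<longleftrightarrow> X \<in> S" if "X \<subseteq> {..<n}" for X
  proof -
    have "sat (2 * n) n (matrix_of n t ''R2'') (vector_of t ''b2'') (ind X) \<longleftrightarrow>
        sat (2 * n) n (matrix_of n s3 ''R'') (vector_of s3 ''b'') (ind X)"
      using Rt bt by (intro sat_cong) auto
    then show ?thesis using elim(2) sat2[OF that] by simp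
  qed
  have "t ''Q'' j = 2 ^ count_below (\<lambda>j. t ''V2'' j = 0) j" if "j < n" for j
    using cs(1) that Vt by (simp add: fr5) (intro count_below_cong, simp)
  then show "solved n S t"
    unfolding solved_def using red satt bt(2) by blast
  have "S \<subseteq> Pow {..<n}" by (auto simp: S_def alive_def)
  then have "S = {X \<in> Pow {..<n}. sat (2 * n) n (matrix_of n s3 ''R'') (vector_of s3 ''b'') (ind X)}"
    using elim(2) sat2 by auto
  then have "card S = (if \<forall>r<2 * n. \<not> s3 ''U'' r \<noteq> 0 \<longrightarrow> vector_of s3 ''b'' r = 0
      then 2 ^ card {j. j < n \<and> s3 ''V'' j = 0} else 0)"
    using card_solutions[OF elim(1), of "vector_of s3 ''b''"] by simp
  also have "\<dots> = 2 ^ count_below (\<lambda>j. s3 ''V'' j = 0) n * of_bool (\<forall>r<2 * n. s3 ''U'' r = 0 \<longrightarrow> s3 ''b'' r = 0)"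
    using b3 by (auto simp: vector_of_def of_nat_bit_eq_0 count_below_def)
  also have "\<dots> = t ''q'' 0" using cs(2) by (simp add: fr5)
  finally show "t ''q'' 0 = card S" by simp
qed

definition solution_set :: "nat \<Rightarrow> store \<Rightarrow> nat \<Rightarrow> nat set" where
  "solution_set n t e = {j. j < n \<and> solution n (matrix_of n t ''R2'') (vector_of t ''b2'') (t ''V2'')
     (ind {j. j < n \<and> t ''V2'' j = 0 \<and> odd (e div 2 ^ count_below (\<lambda>j. t ''V2'' j = 0) j)}) j = 1}"

text \<open>The counter is decoded into a free part, which extends to a solution. A member of
  \<open>S\<close> guarantees that the system is consistent; for empty \<open>S\<close> the count is
  0 and the loop has no rounds.\<close>

lemma bij_betw_solution_set:
  assumes "solved n S t" "S \<subseteq> Pow {..<n}" "S \<noteq> {}"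
  shows "bij_betw (solution_set n t) {..<card S} S"
proof -
  let ?R = "matrix_of n t ''R2''" and ?b = "vector_of t ''b2''" and ?V = "t ''V2''"
  obtain U where red: "row_reduced (2 * n) n ?R U ?V"
    and sat: "\<And>X. X \<subseteq> {..<n} \<Longrightarrow> sat (2 * n) n ?R ?b (ind X) \<longleftrightarrow> X \<in> S"
    using assms(1) unfolding solved_def by blast
  have S: "S = {X \<in> Pow {..<n}. sat (2 * n) n ?R ?b (ind X)}" using sat assms(2) by auto
  have cons: "?b r = 0" if "r < 2 * n" "\<not> U r" for r
    using assms(3) that unfolding S sat_row_reduced_iff[OF red] by blast
  have card: "card S = 2 ^ count_below (\<lambda>j. ?V j = 0) n"
    using card_solutions[OF red, of ?b] cons unfolding S count_below_def by simp
  have "bij_betw ((\<lambda>Y. {j. j < n \<and> solution n ?R ?b ?V (ind Y) j = 1}) \<circ>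
     (\<lambda>e. {j. j < n \<and> ?V j = 0 \<and> odd (e div 2 ^ count_below (\<lambda>j. ?V j = 0) j)})) {..<card S} S"
    unfolding card using bij_betw_solution[OF red, of ?b] cons
    by (intro bij_betw_trans[OF bij_betw_decode]) (simp add: S)
  then show ?thesis by (simp add: comp_def solution_set_def[abs_def])
qed

text \<open>The elimination runs on the Laplacian padded by zero rows, which has the same kernel;
  the determinant is then read off from the pivots.\<close>

lemma den_process_solution:
  fixes s :: store and n :: nat
  assumes inp: "input_ok n E g s" and sol: "solved n S s" and loop: "\<And>v. v < n \<Longrightarrow> \<not> E v v"
  defines "t \<equiv> den process_solution s"
  shows "t ''out'' 0 = (s ''out'' 0 +
    of_bool (perm_sum n (tlap n (adj_bit E) (mask_bit g) (solution_set n s (s ''e'' 0))) = 1)) mod 2"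
proof -
  define s1 where "s1 = den compute_solution s"
  define s2 where "s2 = den build_laplacian s1"
  define s3 where "s3 = den eliminate s2"
  have t: "t = den add_determinant s3"
    by (simp add: t_def process_solution_def s1_def s2_def s3_def)
  have w1: "writes compute_solution = {''j'', ''y'', ''s'', ''w'', ''x''}" by (auto simp: compute_solution_def)
  have w2: "writes build_laplacian = {''r'', ''s'', ''w'', ''h'', ''R'', ''b''}"
    by (auto simp: build_laplacian_def dot_def)
  have w3: "writes eliminate = {''r'', ''U'', ''j'', ''p'', ''V'', ''w'', ''R'', ''b''}"
    by (auto simp: eliminate_def find_pivot_def clear_column_def)
  let ?R = "matrix_of n s ''R2''" and ?b = "vector_of s ''b2''" and ?V = "s ''V2''"
  let ?X = "solution_set n s (s ''e'' 0)"
  let ?Y = "{j. j < n \<and> ?V j = 0 \<and> odd (s ''e'' 0 div 2 ^ count_below (\<lambda>j. ?V j = 0) j)}"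
  obtain U where red: "row_reduced (2 * n) n ?R U ?V" using sol unfolding solved_def by blast
  have b2: "s ''b2'' r < 2" if "r < 2 * n" for r using sol that unfolding solved_def by blast
  have Q: "s ''Q'' j = 2 ^ count_below (\<lambda>j. ?V j = 0) j" if "j < n" for j using sol that unfolding solved_def by blast
  have n: "s ''n'' 0 = n" using inp by (simp add: input_ok_def)
  have V: "?V j - 1 < 2 * n" if "j < n" "?V j \<noteq> 0" for j
    using row_reduced_pivotD(1)[OF red that] that by linarith
  define y where "y = (\<lambda>j. s ''e'' 0 div s ''Q'' j mod 2 * of_bool (s ''V2'' j = 0))"
  have y: "y j = of_bool (j \<in> ?Y)" if "j < n" for j
    using that Q[OF that] by (simp add: y_def mod_2_eq_odd)
  have x0: "\<forall>j<n. s1 ''x'' j = (if ?V j = 0 then y j else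
    (s ''b2'' (?V j - 1) + (\<Sum>w<n. s ''R2'' ((?V j - 1) * n + w) * y w)) mod 2)"
    unfolding s1_def y_def
    by (rule den_compute_solution[of s n, OF n]) (rule b2[OF V])
  have x: "s1 ''x'' j = of_bool (j \<in> ?X)" if j: "j < n" for j
  proof -
    have "of_nat (s1 ''x'' j) = solution n ?R ?b ?V (ind ?Y) j"
    proof (cases "?V j = 0")
      case True
      then show ?thesis using x0 j y[OF j] by (simp add: solution_def)
    next
      case False
      have "(\<Sum>w<n. of_nat (s ''R2'' ((?V j - 1) * n + w)) * of_nat (y w)) =
          (\<Sum>w<n. ?R (?V j - 1) w * (of_bool (?V w = 0) * ind ?Y w))"
        using y by (intro sum.cong) (auto simp: matrix_of_def)
      then show ?thesis using x0 j False by (simp add: solution_def vector_of_def del: One_nat_def)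
    qed
    moreover have "s1 ''x'' j < 2" using x0 j y[OF j] by (cases "?V j = 0") auto
    ultimately show ?thesis using of_nat_bit_eq_1[of "s1 ''x'' j"] j
      by (auto simp: solution_set_def less_2_cases_iff)
  qed
  have inp1: "input_ok n E g s1" using inp by (subst input_ok_cong[of _ s]) (auto simp: s1_def w1)
  have n1: "s1 ''n'' 0 = n" and g1: "\<And>r. r < n \<Longrightarrow> s1 ''g'' r = of_bool (g r)"
    and adj1: "\<And>u v. u < n \<Longrightarrow> v < n \<Longrightarrow> s1 ''adj'' (u * n + v) = of_bool (E u v)"
    using inp1 by (auto simp: input_ok_def)
  define h where "h = (\<lambda>r. (s1 ''g'' r + (\<Sum>w<n. s1 ''adj'' (r * n + w) * s1 ''x'' w)) mod 2)"
  have build: "\<forall>r<n. (\<forall>w<n. s2 ''R'' (r * n + w) = (s1 ''adj'' (r * n + w) * s1 ''x'' w * of_bool (r \<noteq> w \<and> w \<noteq> 0) +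
        of_bool (r = w) * h r) mod 2 \<and> s2 ''R'' ((n + r) * n + w) = 0) \<and>
    s2 ''b'' r = 0 \<and> s2 ''b'' (n + r) = 0"
    using den_build_laplacian[of s1 n] n1 g1 unfolding s2_def h_def by (simp del: One_nat_def)
  let ?L = "tlap n (adj_bit E) (mask_bit g) ?X"
  have h_bit: "of_nat (h r) = mask_bit g r + (\<Sum>w<n. adj_bit E r w * ind ?X w)" if r: "r < n" for r
  proof -
    have "of_nat (h r) = (of_nat (s1 ''g'' r) + (\<Sum>w<n. of_nat (s1 ''adj'' (r * n + w)) * of_nat (s1 ''x'' w)) :: bit)"
      by (simp add: h_def)
    also have "(\<Sum>w<n. of_nat (s1 ''adj'' (r * n + w)) * of_nat (s1 ''x'' w)) = (\<Sum>w<n. adj_bit E r w * ind ?X w)"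
      using adj1[OF r] x by (intro sum.cong) auto
    finally show ?thesis using g1[OF r] by simp
  qed
  have R2: "matrix_of n s2 ''R'' r w = ?L r w" if "r < n" "w < n" for r w
  proof (cases "r = w")
    case True
    then have "matrix_of n s2 ''R'' r w = of_nat (h r)" using build that by (simp add: matrix_of_def)
    then show ?thesis using h_bit[OF that(1)] True unfolding tlap_def by (simp only: if_True refl)
  next
    case False
    then show ?thesis using build that adj1[OF that] x[OF that(2)] by (simp add: matrix_of_def tlap_def)
  qed
  have R2': "matrix_of n s2 ''R'' (n + r) w = 0" if "r < n" "w < n" for r w
    using build that by (simp add: matrix_of_def)
  have b0: "s2 ''b'' r = 0" if "r < 2 * n" for r
    using build that all_less_double[of n "\<lambda>r. s2 ''b'' r = 0"] by blast
  have nm2: "s2 ''m'' 0 = 2 * n" "s2 ''n'' 0 = n"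
    using inp1 by (simp_all add: s2_def w2 input_ok_def)
  have "binary (2 * n) n s2"
    unfolding binary_def all_less_double using build by simp
  note elim = den_eliminate[of s2 "2 * n" n, OF nm2 this, folded s3_def]
  have sat2: "sat (2 * n) n (matrix_of n s2 ''R'') (\<lambda>_. 0) z \<longleftrightarrow> sat n n ?L (\<lambda>_. 0) z" for z
  proof -
    have "(\<Sum>w<n. matrix_of n s2 ''R'' r w * z w) = (\<Sum>w<n. ?L r w * z w)"
      "(\<Sum>w<n. matrix_of n s2 ''R'' (n + r) w * z w) = 0" if "r < n" for r
      using R2[OF that] R2'[OF that] by (auto intro!: sum.cong sum.neutral)
    then show ?thesis unfolding sat_def all_less_double by simp
  qed
  text \<open>The zero right-hand side stays zero because it has the zero solution before and after.\<close>
  have b3: "vector_of s3 ''b'' r = 0" if "r < 2 * n" for r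
  proof -
    have "sat (2 * n) n (matrix_of n s2 ''R'') (vector_of s2 ''b'') (\<lambda>_. 0)"
      using b0 by (simp add: sat_def vector_of_def)
    then have "sat (2 * n) n (matrix_of n s3 ''R'') (vector_of s3 ''b'') (\<lambda>_. 0)" by (simp only: elim(2))
    then show ?thesis using that unfolding sat_def by simp
  qed
  have "sat (2 * n) n (matrix_of n s3 ''R'') (\<lambda>_. 0) z \<longleftrightarrow> sat n n ?L (\<lambda>_. 0) z" for z
  proof -
    have "sat (2 * n) n (matrix_of n s3 ''R'') (\<lambda>_. 0) z \<longleftrightarrow> sat (2 * n) n (matrix_of n s3 ''R'') (vector_of s3 ''b'') z"
      using b3 by (intro sat_cong) auto
    also have "\<dots> \<longleftrightarrow> sat (2 * n) n (matrix_of n s2 ''R'') (vector_of s2 ''b'') z" by (rule elim(2))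
    also have "\<dots> \<longleftrightarrow> sat (2 * n) n (matrix_of n s2 ''R'') (\<lambda>_. 0) z"
      using b0 by (intro sat_cong) (auto simp: vector_of_def)
    finally show ?thesis using sat2 by simp
  qed
  then have "perm_sum n ?L = of_bool (\<forall>j<n. s3 ''V'' j \<noteq> 0)" by (rule perm_sum_row_reduced[OF elim(1)])
  moreover have "s3 ''n'' 0 = n" using nm2 by (simp add: s3_def w3)
  moreover have "s3 ''out'' = s ''out''" by (simp add: s3_def s2_def s1_def w1 w2 w3)
  ultimately show ?thesis using den_add_determinant[of s3 n] unfolding t by simp
qed

section \<open>Colouring by reachability from vertex 0\<close>

definition layer :: "nat \<Rightarrow> (nat \<Rightarrow> nat \<Rightarrow> bool) \<Rightarrow> nat \<Rightarrow> nat set" where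
  "layer n E k = ((\<lambda>D. D \<union> {v. v < n \<and> (\<exists>u<n. u \<in> D \<and> E u v)}) ^^ k) {0}"

lemma layer_0: "layer n E 0 = {0}"
  by (simp add: layer_def)

lemma layer_Suc: "layer n E (Suc k) = layer n E k \<union> {v. v < n \<and> (\<exists>u<n. u \<in> layer n E k \<and> E u v)}"
  by (simp add: layer_def)

lemma layer_mono: "i \<le> j \<Longrightarrow> layer n E i \<subseteq> layer n E j"
  by (rule lift_Suc_mono_le[of "layer n E"]) (auto simp: layer_Suc)

definition coloured :: "nat \<Rightarrow> nat set \<Rightarrow> nat set \<Rightarrow> nat set \<Rightarrow> store \<Rightarrow> bool" where
  "coloured n AA BB D t \<longleftrightarrow>
     (\<forall>v<n. t ''col'' v = 0 \<or> t ''col'' v = 1 \<and> v \<in> AA \<or> t ''col'' v = 2 \<and> v \<in> BB) \<and>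
     (\<forall>v\<in>D. t ''col'' v \<noteq> 0)"

text \<open>A vertex coloured during a round may pass on its colour in the same round, so the store
  can be ahead of \<open>layer\<close>, and the invariant bounds the coloured vertices only from
  below. Arcs switch classes, so every colour assigned is the right one and assigning it again is
  harmless.\<close>

lemma den_colour:
  fixes s :: store and n :: nat
  assumes n: "s ''n'' 0 = n" "0 < n" and adj: "\<forall>u<n. \<forall>v<n. s ''adj'' (u * n + v) = of_bool (E u v)"
    and col: "\<And>v. s ''col'' v = 0" and AA: "0 \<in> AA"
    and bip: "\<And>u v. E u v \<Longrightarrow> u \<in> AA \<and> v \<in> BB \<or> u \<in> BB \<and> v \<in> AA" and dis: "AA \<inter> BB = {}"
  shows "coloured n AA BB (layer n E n) (den colour s)"
proof -
  let ?if = "PIf (Times (Cell ''adj'' (idx (var ''u'') (var ''v''))) (Cell ''col'' (var ''u'')))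
         (PAssign ''col'' (var ''v'') (Minus (N 3) (Cell ''col'' (var ''u'')))) PSkip"
  let ?v = "PFor ''v'' ''n'' ?if"
  let ?u = "PFor ''u'' ''n'' ?v"
  let ?s = "write_cell ''col'' 0 1 s"
  let ?L = "layer n E"
  let ?I = "\<lambda>k (t :: store). coloured n AA BB (?L k) t"
  have "?I (?s ''n'' 0) (den (PFor ''k'' ''n'' ?u) ?s)"
  proof (rule den_For[where I = ?I], goal_cases)
    case 2
    show ?case using col AA by (simp add: coloured_def layer_0)
  next
    case (3 k t)
    have fr: "t ''n'' = s ''n''" "t ''adj'' = s ''adj''" using 3(3) by simp_all
    let ?D = "\<lambda>u. ?L k \<union> {v. v < n \<and> (\<exists>u'<u. u' \<in> ?L k \<and> E u' v)}"
    let ?J = "\<lambda>u (t :: store). coloured n AA BB (?D u) t"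
    have "?J (t ''n'' 0) (den ?u t)"
    proof (rule den_For[where I = ?J], goal_cases)
      case 2
      show ?case using 3(4) by (simp add: coloured_def)
    next
      case (3 u t')
      have fr': "t' ''n'' = s ''n''" "t' ''adj'' = s ''adj''" using 3(3) fr by simp_all
      have u: "u < n" using 3(1) fr n by simp
      let ?K = "\<lambda>v (t :: store). coloured n AA BB (?D u \<union> {v'. v' < v \<and> u \<in> ?L k \<and> E u v'}) t"
      have "?K (t' ''n'' 0) (den ?v t')"
      proof (rule den_For[where I = ?K], goal_cases)
        case 2
        show ?case using 3(4) by (simp add: coloured_def)
      next
        case (3 v t'')
        have v: "v < n" "t'' ''v'' 0 = v" "t'' ''u'' 0 = u" "t'' ''n'' 0 = n" "t'' ''adj'' = s ''adj''"
          using 3(1-3) fr' n \<open>t' ''u'' 0 = u\<close> by simp_all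
        have auv: "s ''adj'' (u * n + v) = of_bool (E u v)" using adj u v(1) by blast
        have ok: "\<And>w. w < n \<Longrightarrow> t'' ''col'' w = 0 \<or> t'' ''col'' w = 1 \<and> w \<in> AA \<or> t'' ''col'' w = 2 \<and> w \<in> BB"
          and ne: "\<And>w. w \<in> ?D u \<union> {v'. v' < v \<and> u \<in> ?L k \<and> E u v'} \<Longrightarrow> t'' ''col'' w \<noteq> 0"
          using 3(4) unfolding coloured_def by blast+
        have step: "den ?if t'' ''col'' = (if E u v \<and> t'' ''col'' u \<noteq> 0
            then (t'' ''col'')(v := 3 - t'' ''col'' u) else t'' ''col'')"
          using v auv by simp
        have colv: "3 - t'' ''col'' u = 1 \<and> v \<in> AA \<or> 3 - t'' ''col'' u = 2 \<and> v \<in> BB"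
          if "E u v" "t'' ''col'' u \<noteq> 0"
          using ok[OF u] bip[OF that(1)] that(2) dis by auto
        have "den ?if t'' ''col'' w = 0 \<or> den ?if t'' ''col'' w = 1 \<and> w \<in> AA \<or> den ?if t'' ''col'' w = 2 \<and> w \<in> BB"
          if "w < n" for w
          unfolding step using ok[OF that] colv by simp
        moreover have "den ?if t'' ''col'' w \<noteq> 0"
          if w: "w \<in> ?D u \<union> {v'. v' < Suc v \<and> u \<in> ?L k \<and> E u v'}" for w
        proof (cases "w = v \<and> u \<in> ?L k \<and> E u v")
          case True
          then have "t'' ''col'' u \<noteq> 0" using ne[of u] by simp
          then show ?thesis unfolding step using True colv by auto
        next
          case False
          then have "w \<in> ?D u \<union> {v'. v' < v \<and> u \<in> ?L k \<and> E u v'}" using w by (auto simp: less_Suc_eq)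
          then show ?thesis unfolding step using ne[of w] colv by auto
        qed
        ultimately show ?case unfolding coloured_def write_cell_apply by simp
      qed simp
      moreover have "?D (Suc u) = ?D u \<union> {v'. v' < n \<and> u \<in> ?L k \<and> E u v'}" by (auto simp: less_Suc_eq)
      ultimately show ?case using fr' n(1) by (simp add: coloured_def)
    qed simp
    moreover have "?D n = ?L (Suc k)" by (auto simp: layer_Suc)
    ultimately show ?case using fr n(1) by (simp add: coloured_def)
  qed simp
  then show ?thesis using n(1) by (simp add: colour_def)
qed

lemma ham_map_layer:
  assumes h: "h \<in> ham_maps n (adj_bit E)" and n: "0 < n" and v: "v < n"
  shows "v \<in> layer n E n"
proof -
  have h': "bij_betw h {..<n} {..<n}" "\<forall>v<n. \<exists>k. (h ^^ k) 0 = v" "\<And>v. v < n \<Longrightarrow> E v (h v)"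
    using h by (auto simp: ham_maps_def)
  have hV: "h v < n" if "v < n" for v using h'(1) that by (auto simp: bij_betw_def)
  have "(h ^^ k) 0 < n \<and> (h ^^ k) 0 \<in> layer n E k" for k
  proof (induction k)
    case (Suc k)
    then show ?case using hV h'(3) by (auto simp: layer_Suc)
  qed (use n in \<open>simp add: layer_0\<close>)
  moreover have "v \<in> (\<lambda>k. (h ^^ k) 0) ` {..<n}"
    using funpow_orbit(2)[OF n h'(1,2)] v by (simp add: bij_betw_def)
  then obtain k where "k < n" "(h ^^ k) 0 = v" by blast
  ultimately show ?thesis using layer_mono[of k n n E] by (metis less_imp_le subsetD)
qed

text \<open>Groups the members of \<open>S\<close> by their trace on the class given by
  \<open>P\<close>, the traces being numbered by the counter.\<close>

lemma sum_decode:
  fixes f :: "nat set \<Rightarrow> 'a :: comm_monoid_add"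
  assumes S: "S \<subseteq> Pow {..<n}"
  shows "(\<Sum>c<(2 :: nat) ^ count_below P n. \<Sum>X | X \<in> S \<and> X \<inter> {v. v < n \<and> P v} = {v. v < n \<and> P v \<and> odd (c div 2 ^ count_below P v)}. f X) =
     (\<Sum>X\<in>S. f X)"
proof -
  let ?M = "{v. v < n \<and> P v}"
  have "finite S" using S by (rule finite_subset) simp
  then have "(\<Sum>X\<in>S. f X) = (\<Sum>T\<in>Pow ?M. \<Sum>X | X \<in> S \<and> X \<inter> ?M = T. f X)"
    by (intro sum.group[symmetric]) auto
  also have "\<dots> = (\<Sum>c<(2 :: nat) ^ count_below P n. \<Sum>X | X \<in> S \<and> X \<inter> ?M = {v. v < n \<and> P v \<and> odd (c div 2 ^ count_below P v)}. f X)"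
    by (rule sum.reindex_bij_betw[OF bij_betw_decode, symmetric])
  finally show ?thesis by simp
qed

section \<open>The complete search and its step count\<close>

lemma writes_process_solution:
  "writes process_solution = {''j'', ''y'', ''s'', ''w'', ''x'', ''r'', ''h'', ''R'', ''b'', ''U'', ''p'', ''V'', ''d'', ''out''}"
  by (auto simp: prog_defs)

lemma writes_solve_system:
  "writes solve_system = {''v'', ''t'', ''r'', ''s'', ''w'', ''h'', ''R'', ''b'', ''U'', ''j'', ''p'', ''V'',
     ''Q'', ''q'', ''R2'', ''b2'', ''V2''}"
  by (auto simp: prog_defs)

definition small_steps :: "nat poly" where
  "small_steps = steps_poly solve_system + steps_poly process_solution + steps_poly colour + steps_poly count_colours"

lemma steps_small:
  fixes s :: store and n :: nat
  assumes "s ''n'' 0 = n" "s ''m'' 0 = 2 * n"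
  shows "steps solve_system s \<le> poly small_steps (2 * n)" "steps process_solution s \<le> poly small_steps (2 * n)"
    "steps colour s \<le> poly small_steps (2 * n)" "steps count_colours s \<le> poly small_steps (2 * n)"
proof -
  have b: "loop_bounds solve_system \<subseteq> {''n'', ''m''}" "loop_bounds process_solution \<subseteq> {''n'', ''m''}"
    "loop_bounds colour \<subseteq> {''n'', ''m''}" "loop_bounds count_colours \<subseteq> {''n'', ''m''}"
    by (simp_all add: prog_defs)
  have w: "{''n'', ''m''} \<inter> writes solve_system = {}" "{''n'', ''m''} \<inter> writes process_solution = {}"
    "{''n'', ''m''} \<inter> writes colour = {}" "{''n'', ''m''} \<inter> writes count_colours = {}"
    by (simp_all add: writes_solve_system writes_process_solution colour_def count_colours_def)
  have nm: "s b 0 \<le> 2 * n" if "b \<in> {''n'', ''m''}" for b using assms that by auto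
  have wf: "wf_prog solve_system" "wf_prog process_solution" "wf_prog colour" "wf_prog count_colours"
    by (simp_all add: prog_defs)
  have le: "steps p s \<le> poly (steps_poly p) (2 * n)"
    if p: "loop_bounds p \<subseteq> {''n'', ''m''}" "{''n'', ''m''} \<inter> writes p = {}" "wf_prog p" for p
  proof (rule steps_le_poly)
    show "loop_bounds p \<inter> writes p = {}" using p(1,2) by blast
    show "s b 0 \<le> 2 * n" if "b \<in> loop_bounds p" for b using nm p(1) that by blast
  qed (rule p(3))
  note le = le[OF b(1) w(1) wf(1)] le[OF b(2) w(2) wf(2)] le[OF b(3) w(3) wf(3)] le[OF b(4) w(4) wf(4)]
  show "steps solve_system s \<le> poly small_steps (2 * n)" "steps process_solution s \<le> poly small_steps (2 * n)"
    "steps colour s \<le> poly small_steps (2 * n)" "steps count_colours s \<le> poly small_steps (2 * n)"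
    using le unfolding small_steps_def poly_add by linarith+
qed

lemma solved_cong:
  assumes "\<And>y. y \<in> {''R2'', ''b2'', ''V2'', ''Q''} \<Longrightarrow> t y = s y"
  shows "solved n S t \<longleftrightarrow> solved n S s" and "solution_set n t = solution_set n s"
  using assms by (simp_all add: solved_def solution_set_def[abs_def] matrix_of_def[abs_def] vector_of_def[abs_def])

lemma solve_all:
  fixes s :: store and n :: nat
  assumes inp: "input_ok n E g s" and sol: "solved n S s" and S: "S \<subseteq> Pow {..<n}" and q: "s ''q'' 0 = card S"
    and loop: "\<And>v. v < n \<Longrightarrow> \<not> E v v" and out: "s ''out'' 0 < 2"
  defines "f \<equiv> \<lambda>X. of_bool (perm_sum n (tlap n (adj_bit E) (mask_bit g) X) = 1) :: nat"
  defines "p \<equiv> PFor ''e'' ''q'' process_solution"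
  shows "den p s ''out'' 0 = (s ''out'' 0 + (\<Sum>X\<in>S. f X)) mod 2"
    and "steps p s \<le> 3 + card S * (4 + poly small_steps (2 * n))"
proof -
  let ?I = "\<lambda>e (t :: store). t ''out'' 0 = (s ''out'' 0 + (\<Sum>i<e. f (solution_set n s i))) mod 2"
  have x: "''e'' \<notin> writes process_solution" by (simp add: writes_process_solution)
  have I0: "?I 0 (write_cell ''e'' 0 0 s)" using out by simp
  have fr: "input_ok n E g t" "solved n S t" "solution_set n t = solution_set n s"
    if same: "\<forall>y. y \<notin> insert ''e'' (writes process_solution) \<longrightarrow> t y = s y" for t
  proof -
    have eq: "t y = s y" if "y \<in> {''n'', ''m'', ''adj'', ''g'', ''R2'', ''b2'', ''V2'', ''Q''}" for y
      using same[rule_format, of y] that by (auto simp: writes_process_solution)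
    show "input_ok n E g t" using inp by (subst input_ok_cong[of _ s]) (auto simp: eq)
    show "solved n S t" using sol by (subst solved_cong(1)[of _ s]) (auto simp: eq)
    show "solution_set n t = solution_set n s" by (rule solved_cong(2)) (auto simp: eq)
  qed
  have step: "?I (Suc e) (write_cell ''e'' 0 (Suc e) (den process_solution t))"
    if "e < s ''q'' 0" "t ''e'' 0 = e" "\<And>y. y \<notin> insert ''e'' (writes process_solution) \<Longrightarrow> t y = s y" "?I e t"
    for e and t :: store
  proof -
    have "\<forall>y. y \<notin> insert ''e'' (writes process_solution) \<longrightarrow> t y = s y" using that(3) by blast
    note fr' = fr[OF this]
    have "den process_solution t ''out'' 0 = (t ''out'' 0 + f (solution_set n s e)) mod 2"
      using den_process_solution[of n E g t S, OF fr'(1,2) loop] unfolding fr'(3) that(2) f_def .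
    then show ?thesis using that(4) by (simp add: mod_simps add.assoc)
  qed
  have "?I (s ''q'' 0) (den p s)"
    unfolding p_def by (rule den_For[where I = ?I]) (rule x, rule I0, rule step)
  also have "(\<Sum>i<s ''q'' 0. f (solution_set n s i)) = (\<Sum>X\<in>S. f X)"
  proof (cases "S = {}")
    case False
    then show ?thesis unfolding q by (intro sum.reindex_bij_betw bij_betw_solution_set[OF sol S])
  qed (simp add: q)
  finally show "den p s ''out'' 0 = (s ''out'' 0 + (\<Sum>X\<in>S. f X)) mod 2" .
  have "steps p s \<le> 3 + (\<Sum>i<s ''q'' 0. 4 + poly small_steps (2 * n))"
    unfolding p_def
  proof (rule steps_For_le[where I = ?I and K = "\<lambda>_. poly small_steps (2 * n)"])
    fix i and t :: store
    assume "\<And>y. y \<notin> insert ''e'' (writes process_solution) \<Longrightarrow> t y = s y"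
    then have "input_ok n E g t" by (intro fr) blast
    then show "steps process_solution t \<le> poly small_steps (2 * n)"
      by (intro steps_small) (simp_all add: input_ok_def)
  qed (rule x, rule I0, rule step)
  then show "steps p s \<le> 3 + card S * (4 + poly small_steps (2 * n))" by (simp add: q)
qed

text \<open>An alive set has one trace on the colour class and is therefore visited for one
  \<open>c\<close> only. Hence the rounds of all inner loops add up to \<open>card al\<close>, while
  solving a system is paid once per \<open>c\<close>.\<close>

lemma search_all:
  fixes s :: store and n :: nat
  assumes inp: "input_ok n E g s" and loop: "\<And>v. v < n \<Longrightarrow> \<not> E v v"
    and P: "\<forall>v<n. s ''P'' v = 2 ^ count_below (\<lambda>v. odd (s ''col'' v)) v"
    and indep: "\<And>u v. u < n \<Longrightarrow> v < n \<Longrightarrow> E u v \<Longrightarrow> u \<notin> colour_class n s \<Longrightarrow> v \<in> colour_class n s"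
    and pw: "s ''pw'' 0 = 2 ^ count_below (\<lambda>v. odd (s ''col'' v)) n" and out: "s ''out'' 0 = 0"
  defines "f \<equiv> \<lambda>X. of_bool (perm_sum n (tlap n (adj_bit E) (mask_bit g) X) = 1) :: nat"
  defines "p \<equiv> PFor ''c'' ''pw'' (solve_system ;; PFor ''e'' ''q'' process_solution)"
  defines "al \<equiv> alive n (adj_bit E) (mask_bit g)" and "k \<equiv> poly small_steps (2 * n)"
  shows "den p s ''out'' 0 = (\<Sum>X\<in>al. f X) mod 2"
    and "steps p s \<le> 3 + s ''pw'' 0 * (8 + k) + card al * (4 + k)"
proof -
  let ?cb = "count_below (\<lambda>v. odd (s ''col'' v))"
  define S where "S = (\<lambda>c :: nat. {X. X \<in> al \<and> X \<inter> {v. v < n \<and> odd (s ''col'' v)} =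
    {v. v < n \<and> odd (s ''col'' v) \<and> odd (c div 2 ^ ?cb v)}})"
  have al: "al \<subseteq> Pow {..<n}" by (auto simp: al_def alive_def)
  let ?b = "solve_system ;; PFor ''e'' ''q'' process_solution"
  let ?I = "\<lambda>c (t :: store). t ''out'' 0 = (\<Sum>c'<c. \<Sum>X\<in>S c'. f X) mod 2"
  have x: "''c'' \<notin> writes ?b" by (simp add: writes_solve_system writes_process_solution)
  have I0: "?I 0 (write_cell ''c'' 0 0 s)" using out by simp
  have body: "den ?b t ''out'' 0 = (t ''out'' 0 + (\<Sum>X\<in>S c. f X)) mod 2 \<and> steps ?b t \<le> 4 + k + card (S c) * (4 + k)"
    if c: "t ''c'' 0 = c" and same: "\<forall>y. y \<notin> insert ''c'' (writes ?b) \<longrightarrow> t y = s y" and o2: "t ''out'' 0 < 2"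
    for c and t :: store
  proof -
    have eq: "t y = s y" if "y \<in> {''n'', ''m'', ''adj'', ''g'', ''P'', ''col''}" for y
      using that by (intro same[rule_format]) (auto simp: writes_solve_system writes_process_solution)
    have inp': "input_ok n E g t" using inp by (subst input_ok_cong[of _ s]) (auto simp: eq)
    have col: "t ''col'' = s ''col''" "t ''P'' = s ''P''" by (simp_all add: eq)
    have cc: "colour_class n t = colour_class n s" by (simp add: colour_class_def col)
    let ?t = "den solve_system t"
    have S': "{X \<in> alive n (adj_bit E) (mask_bit g). X \<inter> colour_class n t = chosen n t} = S c"
      by (simp add: S_def al_def colour_class_def chosen_def col c)
    have P': "\<forall>v<n. t ''P'' v = 2 ^ count_below (\<lambda>v. odd (t ''col'' v)) v" using P by (simp add: col)
    have sol: "solved n (S c) ?t"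
      unfolding S'[symmetric] by (rule den_solve_system(1)[OF inp' P']) (unfold cc, rule indep)
    have q: "?t ''q'' 0 = card (S c)"
      unfolding S'[symmetric] by (rule den_solve_system(2)[OF inp' P']) (unfold cc, rule indep)
    have inp'': "input_ok n E g ?t"
      using inp' by (subst input_ok_cong[of _ t]) (auto simp: writes_solve_system)
    have out': "?t ''out'' 0 = t ''out'' 0" by (simp add: writes_solve_system)
    have SP: "S c \<subseteq> Pow {..<n}" using al by (auto simp: S_def)
    have "steps solve_system t \<le> k"
      unfolding k_def using inp' by (intro steps_small) (simp_all add: input_ok_def)
    then show ?thesis
      using solve_all[OF inp'' sol SP q loop] o2 out' unfolding f_def k_def by simp
  qed
  have step: "?I (Suc c) (write_cell ''c'' 0 (Suc c) (den ?b t))"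
    if "c < s ''pw'' 0" "t ''c'' 0 = c" "\<And>y. y \<notin> insert ''c'' (writes ?b) \<Longrightarrow> t y = s y" "?I c t" for c and t :: store
  proof -
    have "\<forall>y. y \<notin> insert ''c'' (writes ?b) \<longrightarrow> t y = s y" using that(3) by blast
    from body[OF that(2) this] have "den ?b t ''out'' 0 = (t ''out'' 0 + (\<Sum>X\<in>S c. f X)) mod 2"
      unfolding that(4) by simp
    then show ?thesis using that(4) by (simp add: mod_simps del: den.simps)
  qed
  have sum: "(\<Sum>c<s ''pw'' 0. \<Sum>X\<in>S c. h X) = (\<Sum>X\<in>al. h X)" for h :: "nat set \<Rightarrow> nat"
    unfolding pw S_def by (rule sum_decode[OF al])
  have "?I (s ''pw'' 0) (den p s)"
    unfolding p_def by (rule den_For[where I = ?I]) (rule x, rule I0, rule step)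
  then show "den p s ''out'' 0 = (\<Sum>X\<in>al. f X) mod 2" unfolding sum .
  have "steps p s \<le> 3 + (\<Sum>c<s ''pw'' 0. 4 + (4 + k + card (S c) * (4 + k)))"
    unfolding p_def
  proof (rule steps_For_le[where I = ?I and K = "\<lambda>c. 4 + k + card (S c) * (4 + k)"])
    fix c and t :: store
    assume c: "t ''c'' 0 = c" "\<And>y. y \<notin> insert ''c'' (writes ?b) \<Longrightarrow> t y = s y" "?I c t"
    have "\<forall>y. y \<notin> insert ''c'' (writes ?b) \<longrightarrow> t y = s y" using c(2) by blast
    from body[OF c(1) this] c(3) show "steps ?b t \<le> 4 + k + card (S c) * (4 + k)"
      by (simp del: steps.simps)
  qed (rule x, rule I0, rule step)
  also have "(\<Sum>c<s ''pw'' 0. 4 + (4 + k + card (S c) * (4 + k))) = (\<Sum>c<s ''pw'' 0. (8 + k) + card (S c) * (4 + k))"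
    by (intro sum.cong) simp_all
  also have "\<dots> = s ''pw'' 0 * (8 + k) + (\<Sum>c<s ''pw'' 0. card (S c)) * (4 + k)"
    by (simp add: sum.distrib sum_distrib_right distrib_left)
  also have "(\<Sum>c<s ''pw'' 0. card (S c)) = card al" using sum[of "\<lambda>_. 1"] by simp
  finally show "steps p s \<le> 3 + s ''pw'' 0 * (8 + k) + card al * (4 + k)" by simp
qed

text \<open>Sets that are not alive have determinant 0, so leaving them out does not change the
  sum.\<close>

lemma sum_alive:
  assumes "0 < n" "\<And>v. v < n \<Longrightarrow> A v v = 0"
  shows "(\<Sum>X\<in>alive n A g. of_bool (perm_sum n (tlap n A g X) = 1) :: nat) mod 2 = card (ham_maps n A) mod 2"
proof -
  have b: "of_bool (b = 1) = b" for b :: bit by (cases b) simp_all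
  have "(of_nat (\<Sum>X\<in>alive n A g. of_bool (perm_sum n (tlap n A g X) = 1)) :: bit) =
      (\<Sum>X\<in>alive n A g. perm_sum n (tlap n A g X))"
    unfolding of_nat_sum of_bool_of_nat b ..
  also have "\<dots> = (\<Sum>X\<in>Pow {..<n}. perm_sum n (tlap n A g X))"
    by (rule sum.mono_neutral_left) (auto simp: perm_sum_tlap_eq_0, auto simp: alive_def)
  also have "\<dots> = of_nat (card (ham_maps n A))" by (rule sum_perm_sum_tlap[OF assms])
  finally show ?thesis by (simp only: of_nat_bit of_bool_eq_iff mod_2_eq_odd)
qed

text \<open>A Hamiltonian cycle forces every vertex to be coloured, the colour classes to be
  \<open>AA\<close> and \<open>BB\<close>, and these to be balanced; so if \<open>unbalanced\<close>
  holds, the output 0 is right. Otherwise the first class has exactly n/2 vertices, which bounds the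
  outer loop.\<close>

lemma main_prog_spec:
  fixes s :: store and n :: nat
  assumes n: "s ''n'' 0 = n" "0 < n"
    and adj: "\<forall>u<n. \<forall>v<n. s ''adj'' (u * n + v) = of_bool (E u v)"
    and g: "\<forall>v<n. s ''g'' v = of_bool (g v)"
    and init: "\<And>v. s ''col'' v = 0" "s ''c1'' 0 = 0" "s ''c2'' 0 = 0" "s ''out'' 0 = 0"
    and AB: "AA \<union> BB = {..<n}" "AA \<inter> BB = {}" "0 \<in> AA"
    and bip: "\<And>u v. E u v \<Longrightarrow> u \<in> AA \<and> v \<in> BB \<or> u \<in> BB \<and> v \<in> AA"
  defines "k \<equiv> poly small_steps (2 * n)"
  shows "den main_prog s ''out'' 0 = card (ham_maps n (adj_bit E)) mod 2"
    and "steps main_prog s \<le> 10 + 2 * k + 2 ^ (n div 2) * (8 + k) + card (alive n (adj_bit E) (mask_bit g)) * (4 + k)"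
proof -
  define s1 where "s1 = write_cell ''m'' 0 (2 * n) s"
  define s2 where "s2 = den colour s1"
  define s3 where "s3 = den count_colours s2"
  define s4 where "s4 = write_cell ''pw'' 0 (s3 ''P'' n) s3"
  let ?loop = "PFor ''c'' ''pw'' (solve_system ;; PFor ''e'' ''q'' process_solution)"
  have w: "writes colour = {''col'', ''k'', ''u'', ''v''}" "writes count_colours = {''P'', ''v'', ''c1'', ''c2''}"
    by (auto simp: colour_def count_colours_def)
  have n1: "s1 ''n'' 0 = n" "s1 ''m'' 0 = 2 * n" using n by (simp_all add: s1_def)
  have n2: "s2 ''n'' 0 = n" "s2 ''m'' 0 = 2 * n" "s2 ''c1'' 0 = 0" "s2 ''c2'' 0 = 0"
    using n1 init by (simp_all add: s2_def w s1_def)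
  have n3: "s3 ''n'' 0 = n" "s3 ''col'' = s2 ''col''" using n2 by (simp_all add: s3_def w)
  have adj1: "\<forall>u<n. \<forall>v<n. s1 ''adj'' (u * n + v) = of_bool (E u v)" using adj by (simp add: s1_def)
  have col1: "s1 ''col'' v = 0" for v using init by (simp add: s1_def)
  have coloured: "coloured n AA BB (layer n E n) s2"
    unfolding s2_def by (rule den_colour[of s1 n E AA BB, OF n1(1) n(2) adj1 col1 AB(3) bip AB(2)])
  have ok: "s2 ''col'' v = 0 \<or> s2 ''col'' v = 1 \<and> v \<in> AA \<or> s2 ''col'' v = 2 \<and> v \<in> BB" if "v < n" for v
    using coloured that unfolding coloured_def by blast
  let ?cb = "count_below (\<lambda>v. odd (s2 ''col'' v))"
  have cnt: "\<forall>v\<le>n. s3 ''P'' v = 2 ^ ?cb v \<and> s3 ''c1'' v = ?cb v \<and> s3 ''c2'' v = (\<Sum>u<v. s2 ''col'' u div 2)"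
    unfolding s3_def by (rule den_count_colours[of s2 n, OF n2(1,3,4)])
  let ?C1 = "{v. v < n \<and> s2 ''col'' v = 1}" and ?C2 = "{v. v < n \<and> s2 ''col'' v = 2}"
  have odd: "odd (s2 ''col'' v) \<longleftrightarrow> s2 ''col'' v = 1" if "v < n" for v using ok[OF that] by auto
  have c1: "s3 ''c1'' n = card ?C1"
    using cnt odd by (auto simp: count_below_def intro!: arg_cong[where f = card])
  have "(\<Sum>u<n. s2 ''col'' u div 2) = (\<Sum>u<n. of_bool (s2 ''col'' u = 2))"
    using ok by (intro sum.cong) fastforce+
  also have "\<dots> = card ?C2" by (simp add: Int_def)
  finally have c2: "s3 ''c2'' n = card ?C2" using cnt by simp
  have bal: "aval unbalanced s3 = 0 \<longleftrightarrow> card ?C1 = card ?C2 \<and> card ?C1 + card ?C2 = n"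
    using n3 n(2) by (simp add: unbalanced_def c1 c2)
  have den: "den main_prog s = (if aval unbalanced s3 \<noteq> 0 then s3 else den ?loop s4)"
    using n n3 by (simp add: main_prog_def s4_def s3_def s2_def s1_def mult_2)
  have nm: "s1 = write_cell ''m'' 0 (s ''n'' 0 + s ''n'' 0) s" using n by (simp add: s1_def mult_2)
  have steps: "steps main_prog s = 5 + steps colour s1 + steps count_colours s2 +
      (if aval unbalanced s3 \<noteq> 0 then 0 else 2 + steps ?loop s4)"
    using n3(1) by (simp add: main_prog_def s4_def s3_def s2_def nm del: steps.simps(4))
  have st: "steps colour s1 \<le> k" "steps count_colours s2 \<le> k"
    unfolding k_def using n1 n2 by (auto intro: steps_small)
  have loop: "\<not> E v v" for v using bip[of v v] AB(2) by blast
  have "den main_prog s ''out'' 0 = card (ham_maps n (adj_bit E)) mod 2 \<and> steps main_prog s \<le>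
      10 + 2 * k + 2 ^ (n div 2) * (8 + k) + card (alive n (adj_bit E) (mask_bit g)) * (4 + k)"
  proof (cases "aval unbalanced s3 = 0")
    case False
    have "ham_maps n (adj_bit E) = {}"
    proof (rule ccontr)
      assume "ham_maps n (adj_bit E) \<noteq> {}"
      then obtain h where h: "h \<in> ham_maps n (adj_bit E)" by blast
      have all: "s2 ''col'' v \<noteq> 0" if "v < n" for v
        using ham_map_layer[OF h n(2) that] coloured unfolding coloured_def by blast
      have "v \<in> ?C1 \<longleftrightarrow> v \<in> AA" "v \<in> ?C2 \<longleftrightarrow> v \<in> BB" for v
      proof -
        have "v < n" if "v \<in> AA \<or> v \<in> BB" using that AB(1) by blast
        then show "v \<in> ?C1 \<longleftrightarrow> v \<in> AA" "v \<in> ?C2 \<longleftrightarrow> v \<in> BB"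
          using ok[of v] all[of v] AB(2) by auto
      qed
      then have "?C1 = AA" "?C2 = BB" by blast+
      moreover have "card AA = card BB"
        using ham_map_imp_balanced[OF h AB(1,2)] bip by simp
      moreover have "card AA + card BB = n"
        using AB(1,2) by (metis card_Un_disjoint card_lessThan finite_Un finite_lessThan)
      ultimately show False using False bal by simp
    qed
    moreover have "s3 ''out'' 0 = 0" using init(4) by (simp add: s3_def s2_def s1_def w)
    ultimately show ?thesis using False st unfolding den steps by simp
  next
    case True
    then have b: "card ?C1 = card ?C2" "card ?C1 + card ?C2 = n" using bal by auto
    have col: "s2 ''col'' v = 1 \<or> s2 ''col'' v = 2" if "v < n" for v
    proof -
      have "card (?C1 \<union> ?C2) = card ?C1 + card ?C2" by (rule card_Un_disjoint) auto
      then have "?C1 \<union> ?C2 = {..<n}" using b by (intro card_subset_eq) auto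
      then show ?thesis using that by blast
    qed
    have s4: "s4 ''col'' = s2 ''col''" "s4 ''P'' = s3 ''P''" "s4 ''pw'' 0 = 2 ^ ?cb n" "s4 ''out'' 0 = 0"
      using n3 cnt init(4) by (simp_all add: s4_def s3_def s2_def s1_def w)
    have inp: "input_ok n E g s4"
      using n adj g by (simp add: input_ok_def s4_def s3_def s2_def s1_def w)
    have cc: "v \<in> colour_class n s4 \<longleftrightarrow> v < n \<and> s2 ''col'' v = 1" for v
      using odd by (auto simp: colour_class_def s4)
    have indep: "v \<in> colour_class n s4" if "u < n" "v < n" "E u v" "u \<notin> colour_class n s4" for u v
    proof -
      have "s2 ''col'' u = 2" using col[of u] that(1,4) by (auto simp: cc)
      then have "u \<in> BB" using ok[OF that(1)] by auto
      then have "v \<notin> BB" using bip[OF that(3)] AB(2) by blast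
      then show ?thesis using ok[OF that(2)] col[OF that(2)] that(2) by (auto simp: cc)
    qed
    have P: "\<forall>v<n. s4 ''P'' v = 2 ^ count_below (\<lambda>v. odd (s4 ''col'' v)) v" using cnt by (simp add: s4)
    have pw: "s4 ''pw'' 0 = 2 ^ count_below (\<lambda>v. odd (s4 ''col'' v)) n" by (simp add: s4)
    have "den ?loop s4 ''out'' 0 = (\<Sum>X\<in>alive n (adj_bit E) (mask_bit g).
        of_bool (perm_sum n (tlap n (adj_bit E) (mask_bit g) X) = 1)) mod 2"
      by (rule search_all(1)[OF inp _ P _ pw s4(4)]) (rule loop, rule indep)
    also have "\<dots> = card (ham_maps n (adj_bit E)) mod 2"
      by (rule sum_alive) (use n loop in simp_all)
    finally have "den ?loop s4 ''out'' 0 = card (ham_maps n (adj_bit E)) mod 2" .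
    moreover have "steps ?loop s4 \<le> 3 + s4 ''pw'' 0 * (8 + k) + card (alive n (adj_bit E) (mask_bit g)) * (4 + k)"
      unfolding k_def by (rule search_all(2)[OF inp _ P _ pw s4(4)]) (rule loop, rule indep)
    moreover have "s4 ''pw'' 0 = 2 ^ (n div 2)"
      using b c1 cnt by (simp add: s4)
    ultimately show ?thesis using True st unfolding den steps by simp
  qed
  then show "den main_prog s ''out'' 0 = card (ham_maps n (adj_bit E)) mod 2"
    "steps main_prog s \<le> 10 + 2 * k + 2 ^ (n div 2) * (8 + k) + card (alive n (adj_bit E) (mask_bit g)) * (4 + k)"
    by blast+
qed

lemma main_prog_empty:
  fixes s :: store
  assumes "s ''n'' 0 = 0" "s ''out'' 0 = 0"
  shows "den main_prog s ''out'' 0 = 0" "steps main_prog s \<le> 5 + 2 * poly small_steps 0"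
proof -
  define s1 where "s1 = write_cell ''m'' 0 0 s"
  define s3 where "s3 = den count_colours (den colour s1)"
  have w: "writes colour = {''col'', ''k'', ''u'', ''v''}" "writes count_colours = {''P'', ''v'', ''c1'', ''c2''}"
    by (auto simp: colour_def count_colours_def)
  have u: "aval unbalanced s3 \<noteq> 0" using assms by (simp add: unbalanced_def s3_def s1_def w)
  have "den main_prog s = s3" using assms u by (simp add: main_prog_def s3_def s1_def)
  then show "den main_prog s ''out'' 0 = 0" using assms by (simp add: s3_def s1_def w)
  have "steps main_prog s = 5 + steps colour s1 + steps count_colours (den colour s1)"
    using assms u by (simp add: main_prog_def s3_def s1_def del: steps.simps(4))
  moreover have "steps colour s1 \<le> poly small_steps (2 * 0)"
    by (rule steps_small) (simp_all add: s1_def assms)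
  moreover have "steps count_colours (den colour s1) \<le> poly small_steps (2 * 0)"
    by (rule steps_small) (simp_all add: s1_def assms w)
  ultimately show "steps main_prog s \<le> 5 + 2 * poly small_steps 0" by simp
qed

section \<open>Random bits and expected time\<close>

text \<open>A round consists of test, toss, discard, increment, discard. The toss is its second
  step, hence the offset 1 and the period 5.\<close>

lemma exec_flip_loop:
  fixes s :: store
  assumes "s ''i'' 0 + d = s ''n'' 0"
  shows "\<exists>s'. exec (While (Minus (var ''n'') (var ''i'')) (Seq (Flip ''g'' (var ''i'')) (Assign ''i'' (N 0) (incr ''i'' ''n''))))
      s \<omega> (5 * d + 1) s' \<and> (\<forall>y. y \<notin> {''i'', ''g''} \<longrightarrow> s' y = s y) \<and>
    (\<forall>v. s' ''g'' v = (if s ''i'' 0 \<le> v \<and> v < s ''n'' 0 then of_bool (\<omega> !! (1 + 5 * (v - s ''i'' 0))) else s ''g'' v))"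
  using assms
proof (induction d arbitrary: s \<omega>)
  case 0
  then show ?case by (intro exI[of _ s]) (auto intro!: exec_step[OF _ _ exec_Skip, simplified])
next
  case (Suc d)
  let ?body = "Seq (Flip ''g'' (var ''i'')) (Assign ''i'' (N 0) (incr ''i'' ''n''))"
  let ?W = "While (Minus (var ''n'') (var ''i'')) ?body"
  let ?i = "s ''i'' 0"
  define s0 where "s0 = write_cell ''g'' ?i (of_bool (\<omega> !! 1)) s"
  define s1 where "s1 = write_cell ''i'' 0 (Suc ?i) s0"
  have "s1 ''i'' 0 + d = s1 ''n'' 0" using Suc.prems by (simp add: s1_def s0_def)
  from Suc.IH[of s1 "sdrop 5 \<omega>", OF this] obtain s' where
    W: "exec ?W s1 (sdrop 5 \<omega>) (5 * d + 1) s'" and fr: "\<forall>y. y \<notin> {''i'', ''g''} \<longrightarrow> s' y = s1 y"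
    and g: "\<forall>v. s' ''g'' v = (if s1 ''i'' 0 \<le> v \<and> v < s1 ''n'' 0
      then of_bool (sdrop 5 \<omega> !! (1 + 5 * (v - s1 ''i'' 0))) else s1 ''g'' v)" by blast
  have flip: "exec (Flip ''g'' (var ''i'')) s (stl \<omega>) 1 s0"
    by (auto intro!: exec_step[OF _ _ exec_Skip, simplified] simp: s0_def)
  have asg: "exec (Assign ''i'' (N 0) (incr ''i'' ''n'')) s0 \<omega>' 1 s1" for \<omega>'
    using Suc.prems by (auto intro!: exec_step[OF _ _ exec_Skip, simplified] simp: s1_def s0_def incr_def)
  have body: "exec ?body s (stl \<omega>) 3 s1"
    using exec_Seq[OF flip asg] by (simp add: eval_nat_numeral)
  have "sdrop (Suc 3) (stl \<omega>) = sdrop 5 \<omega>" by (simp add: eval_nat_numeral)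
  with exec_Seq[OF body, of ?W "5 * d + 1" s'] W
  have "exec (Seq ?body ?W) s (stl \<omega>) (3 + 1 + (5 * d + 1)) s'" by simp
  moreover have "step (shd \<omega>) ?W s = (Seq ?body ?W, s)" using Suc.prems by simp
  ultimately have "exec ?W s \<omega> (Suc (3 + 1 + (5 * d + 1))) s'" by (intro exec_step) simp_all
  then have ex: "exec ?W s \<omega> (5 * Suc d + 1) s'" by (simp add: eval_nat_numeral)
  have gs: "s' ''g'' v = (if ?i \<le> v \<and> v < s ''n'' 0 then of_bool (\<omega> !! (1 + 5 * (v - ?i))) else s ''g'' v)" for v
  proof -
    consider "v < ?i" | "v = ?i" | "?i < v" by linarith
    then show ?thesis
    proof cases
      case 3
      then have "5 + (1 + 5 * (v - Suc ?i)) = 1 + 5 * (v - ?i)" by simp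
      then have "sdrop 5 \<omega> !! (1 + 5 * (v - Suc ?i)) = \<omega> !! (1 + 5 * (v - ?i))"
        by (simp only: sdrop_snth)
      then show ?thesis using g 3 by (simp add: s1_def s0_def)
    qed (use g Suc.prems in \<open>simp_all add: s1_def s0_def\<close>)
  qed
  show ?case
    by (intro exI[of _ s'] conjI ex) (use gs fr in \<open>simp_all add: s1_def s0_def\<close>)
qed

lemma exec_flips:
  fixes s :: store and n :: nat
  assumes "s ''n'' 0 = n"
  shows "\<exists>s'. exec flips s \<omega> (5 * n + 3) s' \<and> (\<forall>y. y \<notin> {''i'', ''g''} \<longrightarrow> s' y = s y) \<and>
    (\<forall>v<n. s' ''g'' v = of_bool (\<omega> !! (3 + 5 * v)))"
proof -
  let ?W = "While (Minus (var ''n'') (var ''i'')) (Seq (Flip ''g'' (var ''i'')) (Assign ''i'' (N 0) (incr ''i'' ''n'')))"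
  let ?s = "write_cell ''i'' 0 0 s"
  have init: "exec (Assign ''i'' (N 0) (N 0)) s \<omega> 1 ?s"
    by (auto intro!: exec_step[OF _ _ exec_Skip, simplified])
  obtain s' where W: "exec ?W ?s (sdrop (Suc 1) \<omega>) (5 * n + 1) s'" and fr: "\<forall>y. y \<notin> {''i'', ''g''} \<longrightarrow> s' y = ?s y"
    and g: "\<forall>v. s' ''g'' v = (if ?s ''i'' 0 \<le> v \<and> v < ?s ''n'' 0
      then of_bool (sdrop (Suc 1) \<omega> !! (1 + 5 * (v - ?s ''i'' 0))) else ?s ''g'' v)"
    using exec_flip_loop[of ?s n "sdrop (Suc 1) \<omega>"] assms by auto
  have "1 + 1 + (5 * n + 1) = 5 * n + 3" by simp
  with exec_Seq[OF init W] have "exec flips s \<omega> (5 * n + 3) s'"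
    unfolding flips_def by (simp only:)
  moreover have "s' ''g'' v = of_bool (\<omega> !! (3 + 5 * v))" if "v < n" for v
  proof -
    have "sdrop (Suc 1) \<omega> !! (1 + 5 * v) = \<omega> !! (Suc 1 + (1 + 5 * v))" by (simp only: sdrop_snth)
    also have "Suc 1 + (1 + 5 * v) = 3 + 5 * v" by simp
    finally show ?thesis using g that assms by simp
  qed
  ultimately show ?thesis using fr by (intro exI[of _ s']) simp
qed

section \<open>Expected number of alive sets\<close>

lemma prob_space_coins: "prob_space coins"
  unfolding coins_def by (rule prob_space.prob_space_stream_space) (rule prob_space_measure_pmf)

text \<open>The setup takes three steps and every iteration five, so vertex \<open>v\<close> gets the toss of step \<open>3 + 5 v\<close>.\<close>

definition toss :: "bool stream \<Rightarrow> nat \<Rightarrow> bool" where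
  "toss \<omega> v = \<omega> !! (3 + 5 * v)"

text \<open>The measure on streams is the image of the infinite product measure, and there the event
  is a cylinder.\<close>

lemma emeasure_coins_fixed:
  assumes J: "finite J"
  shows "emeasure coins {\<omega>. \<forall>i\<in>J. \<omega> !! i = d i} = ennreal ((1/2) ^ card J)"
proof -
  let ?M = "measure_pmf (bernoulli_pmf (1/2))"
  interpret product_prob_space "\<lambda>_. ?M" "UNIV :: nat set" ..
  have space: "space coins = UNIV" by (simp add: coins_def space_stream_space)
  have "{\<omega> \<in> space (stream_space ?M). \<forall>i\<in>J. \<omega> !! i = d i} \<in> sets (stream_space ?M)"
    using J by measurable
  then have meas: "{\<omega>. \<forall>i\<in>J. \<omega> !! i = d i} \<in> sets (stream_space ?M)"
    by (simp add: space_stream_space)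
  have "emeasure coins {\<omega>. \<forall>i\<in>J. \<omega> !! i = d i} =
      emeasure (PiM UNIV (\<lambda>_. ?M)) (to_stream -` {\<omega>. \<forall>i\<in>J. \<omega> !! i = d i} \<inter> space (PiM UNIV (\<lambda>_. ?M)))"
    unfolding coins_def by (subst stream_space_eq_distr, subst emeasure_distr) (use meas in auto)
  also have "to_stream -` {\<omega>. \<forall>i\<in>J. \<omega> !! i = d i} \<inter> space (PiM UNIV (\<lambda>_. ?M)) =
      emb UNIV J (Pi\<^sub>E J (\<lambda>i. {d i}))"
    by (auto simp: prod_emb_def space_PiM to_stream_def PiE_iff extensional_def restrict_def)
  also have "emeasure (PiM UNIV (\<lambda>_. ?M)) \<dots> = (\<Prod>i\<in>J. emeasure ?M {d i})"
    using J by (intro emeasure_PiM_emb) auto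
  also have "\<dots> = (\<Prod>i\<in>J. ennreal (1/2))"
    by (intro prod.cong refl) (case_tac "d i", simp_all add: emeasure_pmf_single)
  also have "\<dots> = ennreal (1/2) ^ card J" by (rule prod_constant)
  also have "\<dots> = ennreal ((1/2) ^ card J)" by (rule ennreal_power) simp
  finally show ?thesis .
qed

lemma sum_Pow_power:
  fixes a :: real
  assumes "finite S"
  shows "(\<Sum>T\<in>Pow S. a ^ card (S - T)) = (1 + a) ^ card S"
  using prod_add[OF assms, of "\<lambda>_. 1" "\<lambda>_. a"] by simp

text \<open>For fixed \<open>T\<close>, being alive prescribes the toss of each vertex outside
  \<open>T\<close> and leaves the others open, which is the event \<open>E T\<close>. The sum of the
  probabilities over all \<open>T\<close> is the binomial expansion of (1 + 1/2) ^ n.\<close>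

lemma
  shows borel_measurable_card_alive:
      "(\<lambda>\<omega>. of_nat (card (alive n A (mask_bit (toss \<omega>)))) :: ennreal) \<in> borel_measurable coins"
    and nn_integral_card_alive:
      "(\<integral>\<^sup>+ \<omega>. of_nat (card (alive n A (mask_bit (toss \<omega>)))) \<partial>coins) = ennreal (1.5 ^ n)"
proof -
  define c where "c = (\<lambda>T v. (\<Sum>u<n. A v u * ind T u) = 0)"
  define J where "J = (\<lambda>T. (\<lambda>v. 3 + 5 * v :: nat) ` ({..<n} - T))"
  \<comment> \<open>\<open>(i - 3) div 5\<close> recovers the vertex from the position of its
    toss.\<close>
  define E where "E = (\<lambda>T. {\<omega>. \<forall>i\<in>J T. \<omega> !! i = c T ((i - 3) div 5)})"
  have em: "emeasure coins (E T) = ennreal ((1/2) ^ card ({..<n} - T))" for T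
  proof -
    have "card (J T) = card ({..<n} - T)" unfolding J_def by (rule card_image) (simp add: inj_on_def)
    moreover have "finite (J T)" by (simp add: J_def)
    ultimately show ?thesis unfolding E_def by (simp only: emeasure_coins_fixed)
  qed
  have sets: "E T \<in> sets coins" for T
  \<comment> \<open>A set that is not measurable has \<open>emeasure\<close> 0 by convention,
    whereas \<open>em\<close> gives a positive value.\<close>
  proof (rule ccontr)
    assume "E T \<notin> sets coins"
    then have "emeasure coins (E T) = 0" by (rule emeasure_notin_sets)
    then show False using em[of T] by simp
  qed
  have alive_eq: "alive n A (mask_bit (toss \<omega>)) = {T \<in> Pow {..<n}. \<omega> \<in> E T}" for \<omega>
  proof -
    have b: "(of_bool b + x = (1 :: bit)) \<longleftrightarrow> b = (x = 0)" for b x by (cases x) auto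
    show ?thesis unfolding alive_def E_def J_def c_def b toss_def by auto
  qed
  have card: "of_nat (card (alive n A (mask_bit (toss \<omega>)))) = (\<Sum>T\<in>Pow {..<n}. indicator (E T) \<omega> :: ennreal)" for \<omega>
    unfolding alive_eq by (simp add: indicator_def sum.If_cases Int_def)
  show "(\<lambda>\<omega>. of_nat (card (alive n A (mask_bit (toss \<omega>)))) :: ennreal) \<in> borel_measurable coins"
    unfolding card using sets by (intro borel_measurable_sum borel_measurable_indicator)
  have "(\<integral>\<^sup>+ \<omega>. of_nat (card (alive n A (mask_bit (toss \<omega>)))) \<partial>coins) =
      (\<Sum>T\<in>Pow {..<n}. \<integral>\<^sup>+ \<omega>. indicator (E T) \<omega> \<partial>coins)"
    unfolding card using sets by (intro nn_integral_sum borel_measurable_indicator)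
  also have "\<dots> = (\<Sum>T\<in>Pow {..<n}. ennreal ((1/2) ^ card ({..<n} - T)))"
    using sets em by (intro sum.cong refl) simp
  also have "\<dots> = ennreal (\<Sum>T\<in>Pow {..<n}. (1/2) ^ card ({..<n} - T))"
    by (rule sum_ennreal) simp
  also have "(\<Sum>T\<in>Pow {..<n}. (1/2 :: real) ^ card ({..<n} - T)) = 1.5 ^ n"
    by (subst sum_Pow_power) simp_all
  finally show "(\<integral>\<^sup>+ \<omega>. of_nat (card (alive n A (mask_bit (toss \<omega>)))) \<partial>coins) = ennreal (1.5 ^ n)" .
qed

section \<open>Assembly of the time and space bounds\<close>

lemma safe_ham_alg: "safe (bound n) ham_alg"
proof -
  have g: "1 \<le> bound n ''g'' (s ''i'' 0)" if "bounded_by (bound n) s" for s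
    using bounded_byD[OF that, of "''i''" 0] by (simp add: bound_def val_bound_simps amax_def)
  have i: "aval (incr ''i'' ''n'') s \<le> bound n ''i'' 0" if "bounded_by (bound n) s" for s
    using bounded_byD[OF that, of "''n''" 0] by (simp add: bound_def val_bound_simps incr_def)
  show ?thesis using safe_main_prog g i by (simp add: ham_alg_def flips_def)
qed

lemma bounded_by_graph_input: "bounded_by (bound n) (graph_input n G)"
proof -
  have "i \<le> amax n" if "i < n * n" for i using that by (simp add: amax_def)
  then show ?thesis by (auto simp: bounded_by_def graph_input_def bound_def val_bound_simps)
qed

lemma bound_le: "bound n x i \<le> 2 ^ amax n"
proof (cases "i \<le> amax n")
  case True
  have le: "a \<le> 2 ^ amax n" if "a \<le> amax n" for a
    using that less_exp[of "amax n"] by linarith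
  have "2 ^ i \<le> (2 :: nat) ^ amax n" using True by (intro power_increasing) auto
  moreover have "2 ^ n \<le> (2 :: nat) ^ amax n" by (intro power_increasing) (auto simp: amax_def)
  moreover have "n \<le> 2 ^ amax n" "2 * n \<le> 2 ^ amax n" "2 * n + 1 \<le> 2 ^ amax n" "3 \<le> (2 :: nat) ^ amax n"
    "1 \<le> (2 :: nat) ^ amax n" by (intro le, simp add: amax_def)+
  ultimately show ?thesis using True le[OF True] unfolding bound_def val_bound_def by (simp del: One_nat_def)
qed (simp add: bound_def)

definition memories :: "string set" where
  "memories = {''n'', ''i'', ''k'', ''u'', ''v'', ''w'', ''j'', ''m'', ''r'', ''p'', ''V'', ''V2'',
    ''adj'', ''g'', ''h'', ''s'', ''t'', ''R'', ''b'', ''U'', ''R2'', ''b2'', ''y'', ''x'', ''d'', ''out'',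
    ''col'', ''c1'', ''c2'', ''P'', ''Q'', ''pw'', ''c'', ''q'', ''e''}"

lemma bound_support:
  assumes "bound n x i \<noteq> 0"
  shows "x \<in> memories \<and> i \<le> amax n"
proof -
  have "val_bound n x i = 0" if "x \<notin> memories"
    using that by (simp add: memories_def val_bound_def)
  then show ?thesis using assms by (auto simp: bound_def split: if_splits)
qed

definition amax_poly :: "nat poly" where
  "amax_poly = [:4, 4, 4:]"

lemma poly_amax: "poly amax_poly n = amax n"
  by (simp add: amax_poly_def amax_def algebra_simps)

definition space_poly :: "nat poly" where
  "space_poly = of_nat (card memories) * (amax_poly + 1) * (amax_poly + amax_poly + 2)"

lemma store_size_run_le: "store_size (snd (run ham_alg (graph_input n G) \<omega> t)) \<le> poly space_poly n"
proof -
  have "bounded_by (bound n) (snd (run ham_alg (graph_input n G) \<omega> t))"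
    using safe_run[OF safe_ham_alg bounded_by_graph_input] by blast
  then have "store_size (snd (run ham_alg (graph_input n G) \<omega> t)) \<le> card memories * (amax n + 1) * (amax n + amax n + 2)"
    by (rule store_size_le[OF _ bound_le _ bound_support]) (simp add: memories_def)
  then show ?thesis by (simp add: space_poly_def poly_amax poly_of_nat)
qed

text \<open>The run halts with the right output for every sequence of tosses; the bound on
  \<open>K\<close> depends on the tosses only through the number of alive sets.\<close>

lemma exec_ham_alg:
  fixes G :: "nat pair_pre_digraph" and n :: nat
  assumes verts: "pverts G = {..<n}" and bip: "bipartite G"
  defines "al \<equiv> \<lambda>\<omega>. alive n (adj_bit (\<lambda>u v. (u, v) \<in> parcs G)) (mask_bit (toss \<omega>))" and "k \<equiv> poly small_steps (2 * n)"
  shows "\<exists>s' K. exec ham_alg (graph_input n G) \<omega> K s' \<and> s' ''out'' 0 = ham_parity G \<and>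
    K \<le> 5 * n + 14 + 2 * k + 2 ^ (n div 2) * (8 + k) + card (al \<omega>) * (4 + k)"
proof -
  let ?E = "\<lambda>u v. (u, v) \<in> parcs G"
  have in_n: "graph_input n G ''n'' 0 = n" by (simp add: graph_input_def)
  obtain s where ex: "exec flips (graph_input n G) \<omega> (5 * n + 3) s"
    and fr: "\<forall>y. y \<notin> {''i'', ''g''} \<longrightarrow> s y = graph_input n G y" and g: "\<forall>v<n. s ''g'' v = of_bool (toss \<omega> v)"
    using exec_flips[of "graph_input n G" n \<omega>, OF in_n] unfolding toss_def by blast
  have n: "s ''n'' 0 = n" using fr in_n by simp
  have init: "s ''col'' v = 0" "s ''c1'' 0 = 0" "s ''c2'' 0 = 0" "s ''out'' 0 = 0" for v
    using fr by (simp_all add: graph_input_def)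
  have "exec ham_alg (graph_input n G) \<omega> (5 * n + 3 + 1 + steps main_prog s) (den main_prog s)"
    unfolding ham_alg_def by (rule exec_Seq[OF ex exec_compile[OF wf_main_prog]])
  moreover have "den main_prog s ''out'' 0 = ham_parity G \<and> steps main_prog s \<le>
      10 + 2 * k + 2 ^ (n div 2) * (8 + k) + card (al \<omega>) * (4 + k)"
  proof (cases "n = 0")
    case True
    \<comment> \<open>Only the empty list has no tails, and a cycle is not empty.\<close>
    have "\<not> (pre_digraph.cycle (with_proj G) p \<and> fst ` set p = pverts G)" for p
      unfolding verts True pre_digraph.cycle_def by auto
    then have "ham_cycles G = {}" unfolding ham_cycles_def by simp
    then show ?thesis
      using main_prog_empty[of s] n init True by (simp add: ham_parity_def k_def)
  next
    case False
    obtain A B where AB: "A \<union> B = {..<n}" "A \<inter> B = {}"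
      and arcs: "\<forall>(u, v) \<in> parcs G. (u \<in> A \<and> v \<in> B) \<or> (u \<in> B \<and> v \<in> A)"
    proof -
      from bip[unfolded bipartite_def] obtain A B where "A \<union> B = pverts G \<and> A \<inter> B = {} \<and>
          (\<forall>(u, v) \<in> parcs G. (u \<in> A \<and> v \<in> B) \<or> (u \<in> B \<and> v \<in> A))" by iprover
      then show ?thesis using that[of A B] verts by simp
    qed
    \<comment> \<open>The classes may have to be exchanged, since the program gives vertex 0 the
      first colour.\<close>
    obtain AA BB where AB': "AA \<union> BB = {..<n}" "AA \<inter> BB = {}" "0 \<in> AA"
      and arcs': "\<And>u v. ?E u v \<Longrightarrow> u \<in> AA \<and> v \<in> BB \<or> u \<in> BB \<and> v \<in> AA"
    proof (cases "0 \<in> A")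
      case True
      show ?thesis by (rule that[of A B]) (use AB True arcs in auto)
    next
      case F: False
      then have "0 \<in> B" using AB(1) False by blast
      show ?thesis by (rule that[of B A]) (use AB \<open>0 \<in> B\<close> arcs in auto)
    qed
    have adj: "\<forall>u<n. \<forall>v<n. s ''adj'' (u * n + v) = of_bool (?E u v)"
    proof (intro allI impI)
      fix u v assume uv: "u < n" "v < n"
      have "u * n + v < n * n"
      proof -
        have "u * n + v < u * n + n" using uv by simp
        also have "\<dots> = Suc u * n" by simp
        also have "\<dots> \<le> n * n" using uv by (intro mult_le_mono1) simp
        finally show ?thesis .
      qed
      then show "s ''adj'' (u * n + v) = of_bool (?E u v)"
        using fr uv by (simp add: graph_input_def)
    qed
    have "ham_parity G = card (ham_maps n (adj_bit ?E)) mod 2"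
      unfolding ham_parity_def using card_ham_cycles[OF verts] False by simp
    moreover have n0: "0 < n" using False by simp
    have "den main_prog s ''out'' 0 = card (ham_maps n (adj_bit ?E)) mod 2"
      by (rule main_prog_spec(1)[OF n n0 adj g init AB']) (rule arcs')
    moreover have "steps main_prog s \<le> 10 + 2 * k + 2 ^ (n div 2) * (8 + k) + card (al \<omega>) * (4 + k)"
      unfolding k_def al_def by (rule main_prog_spec(2)[OF n n0 adj g init AB']) (rule arcs')
    ultimately show ?thesis by simp
  qed
  ultimately show ?thesis
    by (intro exI[of _ "den main_prog s"] exI[of _ "5 * n + 3 + 1 + steps main_prog s"]) simp
qed

text \<open>Let \<open>k\<close> be \<open>small_steps\<close> at 2n. Since 1 and 2 ^ (n div 2) are
  at most 1.5 ^ n, the steps not due to alive sets contribute 5 n + 22 + 3 k; the alive sets add 4 +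
  k. The last factor bounds the cost of one step.\<close>

definition time_poly :: "nat poly" where
  "time_poly = ([:26, 5:] + 4 * pcompose small_steps [:0, 2:]) * pcompose (step_poly ham_alg) amax_poly"

lemma expected_time_le:
  fixes G :: "nat pair_pre_digraph" and n :: nat
  assumes "pverts G = {..<n}" "bipartite G"
  shows "expected_time ham_alg (graph_input n G) \<le> ennreal (real (poly time_poly n) * 1.5 ^ n)"
proof -
  define k where "k = poly small_steps (2 * n)"
  define C where "C = poly (step_poly ham_alg) (amax n)"
  define al where "al = (\<lambda>\<omega>. alive n (adj_bit (\<lambda>u v. (u, v) \<in> parcs G)) (mask_bit (toss \<omega>)))"
  define a where "a = 5 * n + 14 + 2 * k + 2 ^ (n div 2) * (8 + k)"
  have "run_time ham_alg (graph_input n G) \<omega> \<le> of_nat (a * C) + of_nat ((4 + k) * C) * of_nat (card (al \<omega>))" for \<omega>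
  proof -
    obtain K s' where ex: "exec ham_alg (graph_input n G) \<omega> K s'" and K: "K \<le> a + card (al \<omega>) * (4 + k)"
      using exec_ham_alg[OF assms, of \<omega>] unfolding a_def k_def al_def by blast
    have "run_time ham_alg (graph_input n G) \<omega> \<le> of_nat (K * C)"
      unfolding C_def by (rule run_time_le[OF ex safe_ham_alg bounded_by_graph_input bound_le])
    also have "\<dots> \<le> of_nat ((a + card (al \<omega>) * (4 + k)) * C)"
      using K by (intro of_nat_mono mult_le_mono1)
    also have "(a + card (al \<omega>) * (4 + k)) * C = a * C + (4 + k) * C * card (al \<omega>)"
      by (simp add: algebra_simps)
    finally show ?thesis by simp
  qed
  then have "expected_time ham_alg (graph_input n G) \<le>
      (\<integral>\<^sup>+ \<omega>. of_nat (a * C) + of_nat ((4 + k) * C) * of_nat (card (al \<omega>)) \<partial>coins)"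
    unfolding expected_time_def by (intro nn_integral_mono) simp
  also have "\<dots> = of_nat (a * C) + of_nat ((4 + k) * C) * ennreal (1.5 ^ n)"
  proof -
    note [measurable] = borel_measurable_card_alive[of n, folded al_def]
    show ?thesis
      by (subst nn_integral_add)
        (simp_all add: al_def borel_measurable_card_alive nn_integral_cmult nn_integral_card_alive
          prob_space.emeasure_space_1[OF prob_space_coins])
  qed
  also have "\<dots> = ennreal (real (a * C) + real ((4 + k) * C) * 1.5 ^ n)"
    by (simp add: ennreal_of_nat_eq_real_of_nat ennreal_mult ennreal_plus)
  also have "\<dots> \<le> ennreal (real (poly time_poly n) * 1.5 ^ n)"
  proof (rule ennreal_leI)
    \<comment> \<open>This rests on 2 \<le> 1.5 ^ 2 = 2.25.\<close>
    have "(2 :: real) ^ (n div 2) \<le> (1.5 ^ 2) ^ (n div 2)" by (rule power_mono) (simp_all add: power2_eq_square)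
    also have "\<dots> = 1.5 ^ (2 * (n div 2))" by (simp add: power_mult)
    also have "\<dots> \<le> 1.5 ^ n" by (intro power_increasing) simp_all
    finally have p2: "(2 :: real) ^ (n div 2) \<le> 1.5 ^ n" .
    have one: "1 \<le> (1.5 :: real) ^ n" by simp
    have "real a = real (5 * n + 14 + 2 * k) * 1 + 2 ^ (n div 2) * real (8 + k)" by (simp add: a_def)
    also have "\<dots> \<le> real (5 * n + 14 + 2 * k) * 1.5 ^ n + 1.5 ^ n * real (8 + k)"
      using one p2 by (intro add_mono mult_left_mono mult_right_mono) simp_all
    also have "\<dots> = real (5 * n + 22 + 3 * k) * 1.5 ^ n" by (simp add: algebra_simps)
    finally have "real (a * C) \<le> real (5 * n + 22 + 3 * k) * 1.5 ^ n * real C"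
      by (simp add: mult_right_mono)
    moreover have "poly time_poly n = (5 * n + 26 + 4 * k) * C"
      by (simp add: time_poly_def poly_pcompose poly_amax k_def C_def mult.commute)
    ultimately show "real (a * C) + real ((4 + k) * C) * 1.5 ^ n \<le> real (poly time_poly n) * 1.5 ^ n"
      by (simp add: algebra_simps)
  qed
  finally show ?thesis .
qed

theorem theorem2:
  shows "\<exists>(alg :: com) (p :: nat poly) (q :: nat poly).
    \<forall>(n :: nat) (G :: nat pair_pre_digraph).
      pair_wf_digraph G \<and> pverts G = {..<n} \<and> bipartite G \<longrightarrow>
        (AE \<omega> in coins. \<exists>t. halted (run alg (graph_input n G) \<omega> t)) \<and>
        (\<forall>\<omega> t. halted (run alg (graph_input n G) \<omega> t) \<longrightarrow>
           result (run alg (graph_input n G) \<omega> t) = ham_parity G) \<and>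
        expected_time alg (graph_input n G) \<le> ennreal (real (poly p n) * 1.5 ^ n) \<and>
        (\<forall>\<omega> t. store_size (snd (run alg (graph_input n G) \<omega> t)) \<le> poly q n)"
proof (rule exI[of _ ham_alg], rule exI[of _ time_poly], rule exI[of _ space_poly], intro allI impI conjI)
  fix n and G :: "nat pair_pre_digraph"
  assume "pair_wf_digraph G \<and> pverts G = {..<n} \<and> bipartite G"
  then have G: "pverts G = {..<n}" "bipartite G" by simp_all
  have ex: "\<exists>s' K. exec ham_alg (graph_input n G) \<omega> K s' \<and> s' ''out'' 0 = ham_parity G" for \<omega>
    using exec_ham_alg[OF G, of \<omega>] by blast
  show "AE \<omega> in coins. \<exists>t. halted (run ham_alg (graph_input n G) \<omega> t)"
    using ex by (intro AE_I2) (metis exec_def fst_conv halted_def)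
  show "expected_time ham_alg (graph_input n G) \<le> ennreal (real (poly time_poly n) * 1.5 ^ n)"
    by (rule expected_time_le[OF G])
  fix \<omega> t
  show "store_size (snd (run ham_alg (graph_input n G) \<omega> t)) \<le> poly space_poly n"
    by (rule store_size_run_le)
  assume halted: "halted (run ham_alg (graph_input n G) \<omega> t)"
  obtain s' K where ex: "exec ham_alg (graph_input n G) \<omega> K s'" and out: "s' ''out'' 0 = ham_parity G"
    using ex by blast
  \<comment> \<open>\<open>exec\<close> gives the first halting time, so no earlier configuration
    has halted.\<close>
  have "K \<le> t" using ex halted unfolding exec_def halted_def by (meson not_le)
  then show "result (run ham_alg (graph_input n G) \<omega> t) = ham_parity G"
    using run_after_exec[OF ex] out by (simp add: result_def)
qed

end
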